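(* Let $\mathcal B\subseteq\mathcal A$ be a unital inclusion of C$^*$-algebras and $E_{\mathcal B}\colon\mathcal A\to\mathcal B$ a positive conditional expectation. Let $\{X_{jk}\}_{j\in\mathbb N,\,1\le k\le k_j}$ be a triangular array of selfadjoint elements of $\mathcal A$, with $\lim_{j\to\infty}k_j=\infty$, which are free over $\mathcal B$ with respect to $E_{\mathcal B}$, and such that for each $j\in\mathbb N$ the elements $X_{j1},\dots,X_{jk_j}$ have the same distribution with respect to $E_{\mathcal B}$. Assume in addition that $$\limsup_{j\to\infty}\|X_{j1}+\cdots+X_{jk_j}\|\le M$$ for some $M\ge 0$. If the distributions of $X_{j1}+X_{j2}+\cdots+X_{jk_j}$ norm-converge in moments, as $j\to\infty$, to an element of $\Sigma_{\mathcal B}$, then the limit distribution is freely infinitely divisible over $\mathcal B$.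
   Context: $\mathcal B$ is a unital C$^*$-algebra. $\mathcal B\langle\mathcal X\rangle$ is the $*$-algebra freely generated by $\mathcal B$ and a selfadjoint symbol $\mathcal X$. $\Sigma_{\mathcal B}$ is the set of all positive conditional expectations (unital positive $\mathcal B$-bimodule maps) $\mu\colon\mathcal B\langle\mathcal X\rangle\to\mathcal B$; its elements are called ($\mathcal B$-valued) distributions. Distribution: for a selfadjoint $a\in\mathcal A$, let $\tau_a\colon\mathcal B\langle\mathcal X\rangle\to\mathcal A$ be the homomorphism with $\tau_a(\mathcal X)=a$ and $\tau_a(b)=b$ for $b\in\mathcal B$; the distribution of $a$ with respect to $E_{\mathcal B}$ is $E_{\mathcal B}\circ\tau_a\in\Sigma_{\mathcal B}$. $\mathcal B\langle a\rangle$ is the $*$-algebra generated by $\mathcal B$ and $a$. Freeness: a family $\{X_i\}_{i\in I}$ of selfadjoint elements of $\mathcal A$ is free over $\mathcal B$ if $E_{\mathcal B}(A_1A_2\cdots A_n)=0$ whenever $A_l\in\mathcal B\langle X_{\epsilon(l)}\rangle$, $E_{\mathcal B}(A_l)=0$, $\epsilon(l)\in I$ and $\epsilon(l)\ne\epsilon(l+1)$ for $1\le l\le n-1$. Free additive convolution: for $\mu_1,\dots,\mu_N\in\Sigma_{\mathcal B}$, $\mu_1\boxplus\cdots\boxplus\mu_N\in\Sigma_{\mathcal B}$ is the distribution of $X_1+\cdots+X_N$, where $X_1,\dots,X_N$ are free over $\mathcal B$ and $X_i$ has distribution $\mu_i$. A distribution $\mu\in\Sigma_{\mathcal B}$ is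 freely infinitely divisible over $\mathcal B$ if for each $n\ge1$ there is $\nu\in\Sigma_{\mathcal B}$ whose $n$-fold free additive convolution $\nu^{\boxplus n}$ equals $\mu$. Norm-convergence in moments: $\mu_n\in\Sigma_{\mathcal B}$ norm-converges in moments to $\mu\in\Sigma_{\mathcal B}$ if for every $j\ge0$ $$\lim_{n\to\infty}\sup_{\|b_1\|=\cdots=\|b_j\|=1}\|\mu_n(\mathcal Xb_1\mathcal Xb_2\cdots\mathcal Xb_j\mathcal X)-\mu(\mathcal Xb_1\mathcal Xb_2\cdots\mathcal Xb_j\mathcal X)\|=0,$$ with $b_i\in\mathcal B$ (for $j=0$: $\mu_n(\mathcal X)\to\mu(\mathcal X)$ in norm). *)

theory Defs
  imports "HOL-Analysis.Analysis"
begin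

section \<open>Unital complex star-algebras and C*-algebras\<close>

class star_algebra_1 = ring_1 +
  fixes scaleC :: "complex \<Rightarrow> 'a \<Rightarrow> 'a" (infixr "*\<^sub>C" 75)
    and star :: "'a \<Rightarrow> 'a"
  assumes scaleC_add_right: "c *\<^sub>C (x + y) = c *\<^sub>C x + c *\<^sub>C y"
    and scaleC_add_left: "(c + d) *\<^sub>C x = c *\<^sub>C x + d *\<^sub>C x"
    and scaleC_scaleC: "c *\<^sub>C (d *\<^sub>C x) = (c * d) *\<^sub>C x"
    and scaleC_one: "1 *\<^sub>C x = x"
    and mult_scaleC_left: "(c *\<^sub>C x) * y = c *\<^sub>C (x * y)"
    and mult_scaleC_right: "x * (c *\<^sub>C y) = c *\<^sub>C (x * y)"
    and star_add: "star (x + y) = star x + star y"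
    and star_scaleC: "star (c *\<^sub>C x) = cnj c *\<^sub>C star x"
    and star_mult: "star (x * y) = star y * star x"
    and star_star: "star (star x) = x"

lemma (in star_algebra_1) star_one: "star 1 = 1"
  by (metis star_mult star_star mult_1_left mult_1_right)

class cstar_algebra = star_algebra_1 + real_normed_algebra_1 + banach +
  assumes scaleR_eq_scaleC: "r *\<^sub>R x = complex_of_real r *\<^sub>C x"
    and norm_scaleC: "norm (c *\<^sub>C x) = cmod c * norm x"
    and cstar_identity: "norm (star x * x) = (norm x)\<^sup>2"

definition selfadjoint :: "'a::star_algebra_1 \<Rightarrow> bool" where
  "selfadjoint a \<longleftrightarrow> star a = a"

definition cstar_spectrum :: "'a::star_algebra_1 \<Rightarrow> complex set" where
  "cstar_spectrum a =
     {z. \<not> (\<exists>c. c * (a - z *\<^sub>C 1) = 1 \<and> (a - z *\<^sub>C 1) * c = 1)}"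

definition cstar_positive :: "'a::cstar_algebra \<Rightarrow> bool" where
  "cstar_positive a \<longleftrightarrow> selfadjoint a \<and> cstar_spectrum a \<subseteq> complex_of_real ` {0..}"

definition unital_alg_hom :: "('a::star_algebra_1 \<Rightarrow> 'b::star_algebra_1) \<Rightarrow> bool" where
  "unital_alg_hom f \<longleftrightarrow>
     f 1 = 1 \<and> (\<forall>x y. f (x + y) = f x + f y) \<and> (\<forall>c x. f (c *\<^sub>C x) = c *\<^sub>C f x) \<and>
     (\<forall>x y. f (x * y) = f x * f y)"

definition unital_star_hom :: "('a::star_algebra_1 \<Rightarrow> 'b::star_algebra_1) \<Rightarrow> bool" where
  "unital_star_hom f \<longleftrightarrow> unital_alg_hom f \<and> (\<forall>x. f (star x) = star (f x))"

text \<open>An inclusion of C*-algebras is given by its inclusion map, so that the smaller algebra is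
  a type of its own; it carries the restricted norm, whence the isometry condition.\<close>

definition cstar_inclusion :: "('b::cstar_algebra \<Rightarrow> 'a::cstar_algebra) \<Rightarrow> bool" where
  "cstar_inclusion \<iota> \<longleftrightarrow> unital_star_hom \<iota> \<and> (\<forall>b. norm (\<iota> b) = norm b)"

text \<open>The ambient algebra need not be a C*-algebra (it may be a free algebra as below), so
  positivity of the map is expressed on the squares \<open>p\<^sup>* p\<close>.\<close>

definition pos_cond_exp ::
    "('b::cstar_algebra \<Rightarrow> 'c::star_algebra_1) \<Rightarrow> ('c \<Rightarrow> 'b) \<Rightarrow> bool" where
  "pos_cond_exp \<iota> E \<longleftrightarrow>
     E 1 = 1 \<and>
     (\<forall>x y. E (x + y) = E x + E y) \<and> (\<forall>c x. E (c *\<^sub>C x) = c *\<^sub>C E x) \<and>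
     (\<forall>b x b'. E (\<iota> b * x * \<iota> b') = b * E x * b') \<and>
     (\<forall>x. cstar_positive (E (star x * x)))"

section \<open>The star-algebra freely generated by an algebra and selfadjoint symbols\<close>

text \<open>Formal expressions in elements of \<open>'b\<close> and symbols indexed by \<open>'i\<close>, modulo the least
  congruence that makes them a unital complex algebra in which the constants form a copy of
  \<open>'b\<close>.\<close>

datatype ('b, 'i) expr =
    Const 'b
  | Var 'i
  | Add "('b, 'i) expr" "('b, 'i) expr"
  | Mul "('b, 'i) expr" "('b, 'i) expr"
  | Scale complex "('b, 'i) expr"

inductive expr_eq :: "('b::star_algebra_1, 'i) expr \<Rightarrow> ('b, 'i) expr \<Rightarrow> bool" where
  refl: "expr_eq p p"
| sym: "expr_eq p q \<Longrightarrow> expr_eq q p"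
| trans: "expr_eq p q \<Longrightarrow> expr_eq q r \<Longrightarrow> expr_eq p r"
| Add_cong: "expr_eq p p' \<Longrightarrow> expr_eq q q' \<Longrightarrow> expr_eq (Add p q) (Add p' q')"
| Mul_cong: "expr_eq p p' \<Longrightarrow> expr_eq q q' \<Longrightarrow> expr_eq (Mul p q) (Mul p' q')"
| Scale_cong: "expr_eq p p' \<Longrightarrow> expr_eq (Scale c p) (Scale c p')"
| Add_assoc: "expr_eq (Add (Add p q) r) (Add p (Add q r))"
| Add_commute: "expr_eq (Add p q) (Add q p)"
| Add_zero: "expr_eq (Add (Const 0) p) p"
| Add_minus: "expr_eq (Add (Scale (-1) p) p) (Const 0)"
| Mul_assoc: "expr_eq (Mul (Mul p q) r) (Mul p (Mul q r))"
| Mul_one_left: "expr_eq (Mul (Const 1) p) p"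
| Mul_one_right: "expr_eq (Mul p (Const 1)) p"
| Mul_Add_left: "expr_eq (Mul (Add p q) r) (Add (Mul p r) (Mul q r))"
| Mul_Add_right: "expr_eq (Mul p (Add q r)) (Add (Mul p q) (Mul p r))"
| Scale_Add_right: "expr_eq (Scale c (Add p q)) (Add (Scale c p) (Scale c q))"
| Scale_Add_left: "expr_eq (Scale (c + d) p) (Add (Scale c p) (Scale d p))"
| Scale_Scale: "expr_eq (Scale c (Scale d p)) (Scale (c * d) p)"
| Scale_one: "expr_eq (Scale 1 p) p"
| Mul_Scale_left: "expr_eq (Mul (Scale c p) q) (Scale c (Mul p q))"
| Mul_Scale_right: "expr_eq (Mul p (Scale c q)) (Scale c (Mul p q))"
| Const_Add: "expr_eq (Add (Const a) (Const b)) (Const (a + b))"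
| Const_Mul: "expr_eq (Mul (Const a) (Const b)) (Const (a * b))"
| Const_Scale: "expr_eq (Scale c (Const a)) (Const (c *\<^sub>C a))"

quotient_type (overloaded) ('b, 'i) free_alg = "('b::star_algebra_1, 'i) expr" / expr_eq
proof (rule equivpI)
  show "reflp (expr_eq :: ('b, 'i) expr \<Rightarrow> _)"
    by (rule reflpI) (rule expr_eq.refl)
  show "symp (expr_eq :: ('b, 'i) expr \<Rightarrow> _)"
    by (rule sympI) (rule expr_eq.sym)
  show "transp (expr_eq :: ('b, 'i) expr \<Rightarrow> _)"
    by (rule transpI) (rule expr_eq.trans)
qed

primrec expr_star :: "('b::star_algebra_1, 'i) expr \<Rightarrow> ('b, 'i) expr" where
  "expr_star (Const b) = Const (star b)"
| "expr_star (Var i) = Var i"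
| "expr_star (Add p q) = Add (expr_star p) (expr_star q)"
| "expr_star (Mul p q) = Mul (expr_star q) (expr_star p)"
| "expr_star (Scale c p) = Scale (cnj c) (expr_star p)"

primrec expr_eval :: "('b \<Rightarrow> 'c::star_algebra_1) \<Rightarrow> ('i \<Rightarrow> 'c) \<Rightarrow> ('b, 'i) expr \<Rightarrow> 'c" where
  "expr_eval \<iota> x (Const b) = \<iota> b"
| "expr_eval \<iota> x (Var i) = x i"
| "expr_eval \<iota> x (Add p q) = expr_eval \<iota> x p + expr_eval \<iota> x q"
| "expr_eval \<iota> x (Mul p q) = expr_eval \<iota> x p * expr_eval \<iota> x q"
| "expr_eval \<iota> x (Scale c p) = c *\<^sub>C expr_eval \<iota> x p"

lemma scaleC_minus_one: "(-1) *\<^sub>C x = - (x :: 'a::star_algebra_1)"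
proof -
  have z: "0 *\<^sub>C x = 0"
    using scaleC_add_left[of 0 0 x] by simp
  have "(-1) *\<^sub>C x + x = 0"
    using scaleC_add_left[of "-1" 1 x] z by (simp add: scaleC_one)
  then show ?thesis
    by (simp add: eq_neg_iff_add_eq_0)
qed

lemma star_zero: "star 0 = (0 :: 'a::star_algebra_1)"
  using star_add[of 0 "0 :: 'a"] by simp

lemma unital_alg_hom_zero: "unital_alg_hom f \<Longrightarrow> f 0 = 0"
  unfolding unital_alg_hom_def by (metis add_cancel_right_right add_0)

lemma expr_eval_cong:
  assumes "unital_alg_hom \<iota>" and "expr_eq p q"
  shows "expr_eval \<iota> x p = expr_eval \<iota> x q"
  using assms(2,1)
  by (induction rule: expr_eq.induct)
     (simp_all add: unital_alg_hom_zero add_ac mult.assoc distrib_left distrib_right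
       scaleC_add_left scaleC_add_right scaleC_scaleC scaleC_one mult_scaleC_left
       mult_scaleC_right scaleC_minus_one unital_alg_hom_def)

lemma expr_star_cong: "expr_eq p q \<Longrightarrow> expr_eq (expr_star p) (expr_star q)"
  by (induction rule: expr_eq.induct)
     (auto simp: star_zero star_one star_add star_mult star_scaleC intro: expr_eq.intros)

lemma expr_star_star: "expr_star (expr_star p) = p"
  by (induction p) (simp_all add: star_star)

lemma unital_alg_hom_id: "unital_alg_hom (\<lambda>b. b)"
  by (simp add: unital_alg_hom_def)

instantiation free_alg :: (star_algebra_1, type) star_algebra_1
begin

lift_definition zero_free_alg :: "('a, 'b) free_alg" is "Const 0" .

lift_definition one_free_alg :: "('a, 'b) free_alg" is "Const 1" .

lift_definition plus_free_alg :: "('a, 'b) free_alg \<Rightarrow> ('a, 'b) free_alg \<Rightarrow> ('a, 'b) free_alg"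
  is Add by (rule expr_eq.Add_cong)

lift_definition times_free_alg :: "('a, 'b) free_alg \<Rightarrow> ('a, 'b) free_alg \<Rightarrow> ('a, 'b) free_alg"
  is Mul by (rule expr_eq.Mul_cong)

lift_definition scaleC_free_alg :: "complex \<Rightarrow> ('a, 'b) free_alg \<Rightarrow> ('a, 'b) free_alg"
  is Scale by (rule expr_eq.Scale_cong)

lift_definition uminus_free_alg :: "('a, 'b) free_alg \<Rightarrow> ('a, 'b) free_alg"
  is "Scale (-1)" by (rule expr_eq.Scale_cong)

lift_definition minus_free_alg :: "('a, 'b) free_alg \<Rightarrow> ('a, 'b) free_alg \<Rightarrow> ('a, 'b) free_alg"
  is "\<lambda>p q. Add p (Scale (-1) q)" by (intro expr_eq.Add_cong expr_eq.Scale_cong)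

lift_definition star_free_alg :: "('a, 'b) free_alg \<Rightarrow> ('a, 'b) free_alg"
  is expr_star by (rule expr_star_cong)

instance
proof
  show "(0 :: ('a, 'b) free_alg) \<noteq> 1"
  proof (transfer, rule notI)
    assume "expr_eq (Const 0) (Const 1 :: ('a, 'b) expr)"
    from expr_eval_cong[OF unital_alg_hom_id this, of "\<lambda>_. 0"] show False
      by simp
  qed
qed (transfer; auto simp: expr_star_star intro: expr_eq.intros)+

end

lift_definition free_const :: "'b::star_algebra_1 \<Rightarrow> ('b, 'i) free_alg" is Const .

lift_definition free_var :: "'i \<Rightarrow> ('b::star_algebra_1, 'i) free_alg" is Var .

definition free_eval ::
    "('b::star_algebra_1 \<Rightarrow> 'c::star_algebra_1) \<Rightarrow> ('i \<Rightarrow> 'c) \<Rightarrow> ('b, 'i) free_alg \<Rightarrow> 'c" where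
  "free_eval \<iota> x =
     (THE f. unital_alg_hom f \<and> (\<forall>b. f (free_const b) = \<iota> b) \<and> (\<forall>i. f (free_var i) = x i))"

lemma free_alg_hom_unique:
  assumes f: "unital_alg_hom f" and g: "unital_alg_hom g"
    and const: "\<And>b. f (free_const b) = g (free_const b)"
    and var: "\<And>i. f (free_var i) = g (free_var i)"
  shows "f p = g p"
proof -
  have *: "f (abs_free_alg e) = g (abs_free_alg e)" for e
  proof (induction e)
    case (Const b)
    show ?case using const[of b] by (simp add: free_const.abs_eq)
  next
    case (Var i)
    show ?case using var[of i] by (simp add: free_var.abs_eq)
  next
    case (Add p q)
    then show ?case
      using f g by (simp add: plus_free_alg.abs_eq[symmetric] unital_alg_hom_def)
  next
    case (Mul p q)
    then show ?case
      using f g by (simp add: times_free_alg.abs_eq[symmetric] unital_alg_hom_def)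
  next
    case (Scale c p)
    then show ?case
      using f g by (simp add: scaleC_free_alg.abs_eq[symmetric] unital_alg_hom_def)
  qed
  show ?thesis
    using *[of "rep_free_alg p"] by (simp add: Quotient3_abs_rep[OF Quotient3_free_alg])
qed

lemma free_alg_hom_exists:
  assumes \<iota>: "unital_alg_hom \<iota>"
  shows "\<exists>f. unital_alg_hom f \<and> (\<forall>b. f (free_const b) = \<iota> b) \<and> (\<forall>i. f (free_var i) = x i)"
proof -
  define f where "f p = expr_eval \<iota> x (rep_free_alg p)" for p
  have f: "f (abs_free_alg e) = expr_eval \<iota> x e" for e
    unfolding f_def
    by (rule expr_eval_cong[OF \<iota>]) (rule Quotient3_rep_abs[OF Quotient3_free_alg], rule expr_eq.refl)
  have abs: "\<exists>e. p = abs_free_alg e" for p :: "('a, 'c) free_alg"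
    by (metis Quotient3_abs_rep[OF Quotient3_free_alg])
  have add: "f (p + q) = f p + f q" for p q
    using abs[of p] abs[of q] by (auto simp: plus_free_alg.abs_eq f)
  have mult: "f (p * q) = f p * f q" for p q
    using abs[of p] abs[of q] by (auto simp: times_free_alg.abs_eq f)
  have scale: "f (c *\<^sub>C p) = c *\<^sub>C f p" for c p
    using abs[of p] by (auto simp: scaleC_free_alg.abs_eq f)
  have "f 1 = 1"
    using \<iota> by (simp add: one_free_alg.abs_eq f unital_alg_hom_def)
  moreover have "f (free_const b) = \<iota> b" for b
    by (simp add: free_const.abs_eq f)
  moreover have "f (free_var i) = x i" for i
    by (simp add: free_var.abs_eq f)
  ultimately show ?thesis
    using add mult scale unfolding unital_alg_hom_def by blast
qed

lemma free_eval:
  assumes "unital_alg_hom \<iota>"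
  shows "unital_alg_hom (free_eval \<iota> x)"
    and "free_eval \<iota> x (free_const b) = \<iota> b"
    and "free_eval \<iota> x (free_var i) = x i"
proof -
  have "\<exists>!f. unital_alg_hom f \<and> (\<forall>b. f (free_const b) = \<iota> b) \<and> (\<forall>i. f (free_var i) = x i)"
  proof (rule ex_ex1I[OF free_alg_hom_exists[OF assms]])
    fix f g
    assume "unital_alg_hom f \<and> (\<forall>b. f (free_const b) = \<iota> b) \<and> (\<forall>i. f (free_var i) = x i)"
      and "unital_alg_hom g \<and> (\<forall>b. g (free_const b) = \<iota> b) \<and> (\<forall>i. g (free_var i) = x i)"
    then show "f = g"
      by - (rule ext, rule free_alg_hom_unique, simp_all)
  qed
  from theI'[OF this]
  show "unital_alg_hom (free_eval \<iota> x)" "free_eval \<iota> x (free_const b) = \<iota> b"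
    "free_eval \<iota> x (free_var i) = x i"
    unfolding free_eval_def by blast+
qed

section \<open>Distributions\<close>

type_synonym 'b poly1 = "('b, unit) free_alg"

abbreviation indet :: "'b::star_algebra_1 poly1" where
  "indet \<equiv> free_var ()"

definition distributions :: "('b::cstar_algebra poly1 \<Rightarrow> 'b) set" where
  "distributions = {\<mu>. pos_cond_exp free_const \<mu>}"

definition distr_of ::
    "('b::cstar_algebra \<Rightarrow> 'c::star_algebra_1) \<Rightarrow> ('c \<Rightarrow> 'b) \<Rightarrow> 'c \<Rightarrow> 'b poly1 \<Rightarrow> 'b" where
  "distr_of \<iota> E a = E \<circ> free_eval \<iota> (\<lambda>_. a)"

section \<open>Freeness with amalgamation and free additive convolution\<close>

inductive_set gen_star_alg ::
    "('b::star_algebra_1 \<Rightarrow> 'c::star_algebra_1) \<Rightarrow> 'c \<Rightarrow> 'c set" for \<iota> a where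
  base: "\<iota> b \<in> gen_star_alg \<iota> a"
| gen: "a \<in> gen_star_alg \<iota> a"
| add: "x \<in> gen_star_alg \<iota> a \<Longrightarrow> y \<in> gen_star_alg \<iota> a \<Longrightarrow> x + y \<in> gen_star_alg \<iota> a"
| mult: "x \<in> gen_star_alg \<iota> a \<Longrightarrow> y \<in> gen_star_alg \<iota> a \<Longrightarrow> x * y \<in> gen_star_alg \<iota> a"
| scaleC: "x \<in> gen_star_alg \<iota> a \<Longrightarrow> c *\<^sub>C x \<in> gen_star_alg \<iota> a"
| star: "x \<in> gen_star_alg \<iota> a \<Longrightarrow> star x \<in> gen_star_alg \<iota> a"

definition free_over ::
    "('b::cstar_algebra \<Rightarrow> 'c::star_algebra_1) \<Rightarrow> ('c \<Rightarrow> 'b) \<Rightarrow> 'i set \<Rightarrow> ('i \<Rightarrow> 'c) \<Rightarrow> bool" where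
  "free_over \<iota> E I X \<longleftrightarrow>
     (\<forall>n\<ge>1. \<forall>(\<epsilon> :: nat \<Rightarrow> 'i) (A :: nat \<Rightarrow> 'c).
        (\<forall>l\<in>{1..n}. \<epsilon> l \<in> I \<and> A l \<in> gen_star_alg \<iota> (X (\<epsilon> l)) \<and> E (A l) = 0) \<longrightarrow>
        (\<forall>l\<in>{1..<n}. \<epsilon> l \<noteq> \<epsilon> (Suc l)) \<longrightarrow>
        E (prod_list (map A [1..<Suc n])) = 0)"

text \<open>\<open>is_free_convolution N \<mu>s \<mu>\<close> says that \<open>\<mu>\<close> is the free additive convolution of
  \<open>\<mu>s 1, \<dots>, \<mu>s N\<close>. The realization is sought on the algebra freely generated by \<open>'b\<close> and
  symbols \<open>X\<^sub>0, X\<^sub>1, \<dots>\<close>: any positive conditional expectation \<open>E\<close> on a star-algebra containing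
  \<open>'b\<close>, with selfadjoint elements \<open>Y\<^sub>i\<close>, pulls back along the evaluation \<open>X\<^sub>i \<mapsto> Y\<^sub>i\<close> to one on
  this algebra for which the symbols have the same joint distribution, so nothing is lost.\<close>

definition is_free_convolution ::
    "nat \<Rightarrow> (nat \<Rightarrow> 'b::cstar_algebra poly1 \<Rightarrow> 'b) \<Rightarrow> ('b poly1 \<Rightarrow> 'b) \<Rightarrow> bool" where
  "is_free_convolution N \<mu>s \<mu> \<longleftrightarrow>
     (\<exists>\<Phi> :: ('b, nat) free_alg \<Rightarrow> 'b.
        pos_cond_exp free_const \<Phi> \<and>
        free_over free_const \<Phi> {1..N} free_var \<and>
        (\<forall>i\<in>{1..N}. distr_of free_const \<Phi> (free_var i) = \<mu>s i) \<and>
        distr_of free_const \<Phi> (\<Sum>i\<in>{1..N}. free_var i) = \<mu>)"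

definition freely_infinitely_divisible :: "('b::cstar_algebra poly1 \<Rightarrow> 'b) \<Rightarrow> bool" where
  "freely_infinitely_divisible \<mu> \<longleftrightarrow>
     \<mu> \<in> distributions \<and>
     (\<forall>n\<ge>1. \<exists>\<nu>\<in>distributions. is_free_convolution n (\<lambda>_. \<nu>) \<mu>)"

section \<open>Norm-convergence in moments\<close>

definition moment_word :: "'b::star_algebra_1 list \<Rightarrow> 'b poly1" where
  "moment_word bs = indet * prod_list (map (\<lambda>b. free_const b * indet) bs)"

text \<open>The supremum is taken in the extended reals, since the moments of a general distribution
  need not be bounded on the unit sphere.\<close>

definition norm_converges_in_moments ::
    "(nat \<Rightarrow> 'b::cstar_algebra poly1 \<Rightarrow> 'b) \<Rightarrow> ('b poly1 \<Rightarrow> 'b) \<Rightarrow> bool" where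
  "norm_converges_in_moments \<mu>s \<mu> \<longleftrightarrow>
     (\<forall>j. (\<lambda>n. SUP bs\<in>{bs. length bs = j \<and> (\<forall>b\<in>set bs. norm b = 1)}.
               ereal (norm (\<mu>s n (moment_word bs) - \<mu> (moment_word bs)))) \<longlonglongrightarrow> 0)"

end

theory Submission
  imports Defs
begin

text \<open>For a word in the \<open>j\<close>-th row, with coefficients that converge in norm as \<open>j \<rightarrow> \<infinity>\<close> and with \<open>N\<close>
  distinct letters, \<open>k\<^sub>j\<^sup>N\<close> times its expectation converges; this is shown by induction on the degree.
  If \<open>N \<ge> 2\<close>, freeness reduces the word to words of lower degree. If \<open>N = 1\<close>, the expansion of
  the corresponding moment of the row sum contains this expectation \<open>k\<^sub>j\<close> times, while its other terms
  involve words with at least two distinct letters. Admitting convergent sequences of coefficients, and not only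
  constant ones, is what makes the statement stable under nesting of expectations.

  For \<open>n \<ge> 1\<close> one splits the first \<open>n \<lfloor>k\<^sub>j / n\<rfloor>\<close> elements of the row into \<open>n\<close> blocks of equal length. The joint
  moments of the block sums then converge; the limit is positive, the limiting variables are free with a common
  distribution, and their sum has distribution \<open>\<mu>\<close>. Whenever two limits have to be compared, the two
  families of blocks are interleaved into one, for which convergence is known. No free cumulants are needed.\<close>

section \<open>Positivity and bounded conditional expectations in C*-algebras\<close>

text \<open>The hypotheses speak of moments of whole row sums only, and a block sum is not a
  function of its row sum; hence the detour through single letters. Expanded over distinct letters,
  a moment of block sums becomes a combination of expectations with \<open>N\<close> distinct
  letters, each of order \<open>k j\<close> to the power \<open>- N\<close>, while the number of
  ways to choose the letters is governed by \<open>k j ^ N\<close> times a constant that depends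
  only on the proportions of the blocks in the row. So limits depend only on proportions, and fewer
  than \<open>n\<close> omitted elements do not affect them. Norm-convergence, being uniform on the
  unit sphere, is what permits coefficients that move with the row. Two facts about C*-algebras
  enter: a positive conditional expectation is bounded, and norm limits of positive elements are
  positive. Both rest on one estimate: a normal \<open>T\<close> has norm below 1 as soon as
  \<open>1 - l *\<^sub>C T\<close> is invertible for every \<open>l\<close> in the closed unit
  disk.\<close>

lemma scaleC_zero_left: "0 *\<^sub>C x = (0 :: 'a::star_algebra_1)"
  using scaleC_add_left[of 0 0 x] by simp

lemma scaleC_zero_right: "c *\<^sub>C 0 = (0 :: 'a::star_algebra_1)"
  using scaleC_add_right[of c 0 "0 :: 'a"] by simp

lemma scaleC_minus_right: "c *\<^sub>C (- x) = - (c *\<^sub>C (x :: 'a::star_algebra_1))"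
  using scaleC_add_right[of c x "- x"] by (simp add: scaleC_zero_right eq_neg_iff_add_eq_0 add.commute)

lemma scaleC_minus_left: "(- c) *\<^sub>C x = - (c *\<^sub>C (x :: 'a::star_algebra_1))"
  using scaleC_add_left[of c "- c" x] by (simp add: scaleC_zero_left eq_neg_iff_add_eq_0 add.commute)

lemma scaleC_diff_right: "c *\<^sub>C (x - y) = c *\<^sub>C x - c *\<^sub>C (y :: 'a::star_algebra_1)"
  using scaleC_add_right[of c x "- y"] by (simp add: scaleC_minus_right)

lemma scaleC_diff_left: "(c - d) *\<^sub>C x = c *\<^sub>C x - d *\<^sub>C (x :: 'a::star_algebra_1)"
  using scaleC_add_left[of c "- d" x] by (simp add: scaleC_minus_left)

lemma star_minus: "star (- x) = - star (x :: 'a::star_algebra_1)"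
  using star_add[of x "- x"] by (simp add: star_zero eq_neg_iff_add_eq_0 add.commute)

lemma star_diff: "star (x - y) = star x - star (y :: 'a::star_algebra_1)"
  using star_add[of x "- y"] by (simp add: star_minus)

lemma norm_star: "norm (star x) = norm (x :: 'a::cstar_algebra)"
proof -
  have *: "norm y \<le> norm (star y)" for y :: 'a
  proof (cases "y = 0")
    case False
    have "norm y * norm y \<le> norm (star y) * norm y"
      using cstar_identity[of y] norm_mult_ineq[of "star y" y] by (simp add: power2_eq_square)
    then show ?thesis using False by simp
  qed (simp add: star_zero)
  show ?thesis using *[of x] *[of "star x"] by (simp add: star_star)
qed

lemma tendsto_star:
  assumes "(f \<longlongrightarrow> (l :: 'a::cstar_algebra)) F"
  shows "((\<lambda>x. star (f x)) \<longlongrightarrow> star l) F"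
proof -
  have "((\<lambda>x. f x - l) \<longlongrightarrow> 0) F"
    using assms by (simp add: LIM_zero_iff)
  then have "((\<lambda>x. norm (star (f x) - star l)) \<longlongrightarrow> 0) F"
    by (simp add: star_diff[symmetric] norm_star tendsto_norm_zero_iff)
  then show ?thesis
    by (simp add: tendsto_norm_zero_iff LIM_zero_iff)
qed

lemma tendsto_scaleC:
  assumes "(f \<longlongrightarrow> (l :: 'a::cstar_algebra)) F"
  shows "((\<lambda>x. c *\<^sub>C f x) \<longlongrightarrow> c *\<^sub>C l) F"
proof -
  have "((\<lambda>x. norm (f x - l)) \<longlongrightarrow> 0) F"
    using assms by (simp add: tendsto_norm_zero_iff LIM_zero_iff)
  then have "((\<lambda>x. cmod c * norm (f x - l)) \<longlongrightarrow> 0) F"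
    by (rule tendsto_mult_right_zero)
  then have "((\<lambda>x. norm (c *\<^sub>C f x - c *\<^sub>C l)) \<longlongrightarrow> 0) F"
    by (simp add: scaleC_diff_right[symmetric] norm_scaleC)
  then show ?thesis
    by (simp add: tendsto_norm_zero_iff LIM_zero_iff)
qed

section \<open>Invertibility, normal elements and resolvents\<close>

lemma neumann_inverse:
  fixes x :: "'a::{real_normed_algebra_1,banach}"
  assumes "norm x < 1"
  shows "\<exists>y. y * (1 - x) = 1 \<and> (1 - x) * y = 1"
proof -
  have s: "summable (\<lambda>i. x ^ i)"
    by (rule complete_algebra_summable_geometric[OF assms])
  have t: "(\<Sum>i. x ^ Suc i) = (\<Sum>i. x ^ i) - 1"
    using suminf_split_head[OF s] by (simp del: power_Suc)
  have "x * (\<Sum>i. x ^ i) = (\<Sum>i. x ^ Suc i)"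
    using suminf_mult[OF s, of x] by simp
  moreover have "(\<Sum>i. x ^ i) * x = (\<Sum>i. x ^ Suc i)"
    using suminf_mult2[OF s, of x] by (simp add: power_commutes)
  ultimately show ?thesis
    by (intro exI[of _ "\<Sum>i. x ^ i"]) (simp add: t algebra_simps del: power_Suc)
qed

definition normal :: "'a::star_algebra_1 \<Rightarrow> bool" where
  "normal x \<longleftrightarrow> star x * x = x * star x"

lemma star_power: "star (x ^ n) = star x ^ n" for x :: "'a::star_algebra_1"
  by (induction n) (simp_all add: star_one star_mult power_commutes)

text \<open>Normality rewrites \<open>star (x\<^sup>2) * x\<^sup>2\<close> as the square of the
  selfadjoint element \<open>star x * x\<close>, so that the C*-identity applies three times.
  Iterated, this gives the exact norm of \<open>x ^ (2 ^ n)\<close>.\<close>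

lemma norm_power2_normal:
  fixes x :: "'a::cstar_algebra"
  assumes "normal x"
  shows "norm (x\<^sup>2) = (norm x)\<^sup>2"
proof -
  have sa: "norm (h\<^sup>2) = (norm h)\<^sup>2" if "star h = h" for h :: 'a
    using cstar_identity[of h] that by (simp add: power2_eq_square)
  have "star (x\<^sup>2) * x\<^sup>2 = star x * (star x * x) * x"
    by (simp add: star_mult power2_eq_square mult.assoc)
  also have "\<dots> = star x * (x * star x) * x"
    using assms by (simp add: normal_def)
  finally have eq: "star (x\<^sup>2) * x\<^sup>2 = (star x * x)\<^sup>2"
    by (simp add: power2_eq_square mult.assoc)
  have "(norm (x\<^sup>2))\<^sup>2 = norm ((star x * x)\<^sup>2)"
    using cstar_identity[of "x\<^sup>2"] eq by simp
  also have "\<dots> = (norm (star x * x))\<^sup>2"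
    by (rule sa) (simp add: star_mult star_star)
  also have "\<dots> = ((norm x)\<^sup>2)\<^sup>2"
    by (simp add: cstar_identity)
  finally show ?thesis
    by (rule power2_eq_imp_eq) simp_all
qed

lemma normal_power2:
  fixes x :: "'a::star_algebra_1"
  assumes "normal x"
  shows "normal (x\<^sup>2)"
  unfolding normal_def star_power
  using assms by (intro power_commuting_commutes power_commuting_commutes[symmetric]) (simp add: normal_def)

lemma norm_power_normal:
  fixes x :: "'a::cstar_algebra"
  assumes "normal x"
  shows "norm (x ^ (2 ^ n)) = norm x ^ (2 ^ n)"
proof -
  have "normal (x ^ (2 ^ n)) \<and> norm (x ^ (2 ^ n)) = norm x ^ (2 ^ n)"
  proof (induction n)
    case 0
    then show ?case using assms by simp
  next
    case (Suc n)
    have "y ^ (2 ^ Suc n) = (y ^ (2 ^ n))\<^sup>2" for y :: "'b::monoid_mult"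
      by (simp add: power_mult[symmetric] mult.commute)
    then show ?case using Suc normal_power2 norm_power2_normal by metis
  qed
  then show ?thesis ..
qed

lemma scaleC_power: "(c *\<^sub>C x) ^ n = c ^ n *\<^sub>C (x ^ n)" for x :: "'a::star_algebra_1"
  by (induction n) (simp_all add: scaleC_one mult_scaleC_left mult_scaleC_right scaleC_scaleC mult.commute)

text \<open>The resolvent identity \<open>R l - R m = (l - m) *\<^sub>C (R l * T * R m)\<close>
  first bounds \<open>R m\<close> for \<open>m\<close> near \<open>l\<close>, which gives
  continuity. Compactness of the disk then bounds \<open>R\<close> by some \<open>K\<close>, and the
  same identity makes \<open>K * norm T * K\<close> a Lipschitz constant.\<close>

lemma resolvent_lipschitz:
  fixes T :: "'a::cstar_algebra"
  assumes inv: "\<And>l. cmod l \<le> 1 \<Longrightarrow> R l * (1 - l *\<^sub>C T) = 1 \<and> (1 - l *\<^sub>C T) * R l = 1"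
  obtains L where "0 \<le> L"
    and "\<And>l m. cmod l \<le> 1 \<Longrightarrow> cmod m \<le> 1 \<Longrightarrow> norm (R l - R m) \<le> L * cmod (l - m)"
proof -
  have res: "R l - R m = (l - m) *\<^sub>C (R l * T * R m)" if "cmod l \<le> 1" "cmod m \<le> 1" for l m
  proof -
    have "R l - R m = R l * ((1 - m *\<^sub>C T) * R m) - (R l * (1 - l *\<^sub>C T)) * R m"
      using inv[OF that(1)] inv[OF that(2)] by simp
    also have "\<dots> = R l * ((1 - m *\<^sub>C T) - (1 - l *\<^sub>C T)) * R m"
      by (simp add: algebra_simps)
    also have "(1 - m *\<^sub>C T) - (1 - l *\<^sub>C T) = (l - m) *\<^sub>C T"
      by (simp add: scaleC_diff_left)
    finally show ?thesis by (simp add: mult_scaleC_left mult_scaleC_right)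
  qed
  have bnd: "norm (R l - R m) \<le> cmod (l - m) * (norm (R l) * norm T * norm (R m))"
    if "cmod l \<le> 1" "cmod m \<le> 1" for l m
  proof -
    have "norm (R l * T * R m) \<le> norm (R l) * norm T * norm (R m)"
      by (meson norm_mult_ineq mult_right_mono norm_ge_zero order_trans)
    then show ?thesis
      by (simp add: res[OF that] norm_scaleC mult_left_mono)
  qed
  have cont: "continuous_on (cball 0 1) R"
    unfolding continuous_on_iff
  proof (intro ballI allI impI)
    fix l :: complex and e :: real assume l: "l \<in> cball 0 1" and e: "e > 0"
    define A where "A = norm (R l) * norm T + 1"
    have A: "A > 0" unfolding A_def by (smt (verit) mult_nonneg_nonneg norm_ge_zero)
    \<comment> \<open>The first bound makes the difference at most half of
      \<open>norm (R m)\<close>, hence \<open>norm (R m) \<le> 2 * norm (R l)\<close>; the second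
      turns this into an error below \<open>e\<close>. The added 1 keeps the denominator visibly
      positive.\<close>
    define d where "d = min (1 / (2 * A)) (e / (2 * A * (norm (R l) + 1)))"
    have d: "d > 0" unfolding d_def using A e by (simp add: add_nonneg_pos)
    show "\<exists>d>0. \<forall>m\<in>cball 0 1. dist m l < d \<longrightarrow> dist (R m) (R l) < e"
    proof (intro exI conjI ballI impI)
      fix m assume m: "m \<in> cball 0 1" and dm: "dist m l < d"
      have b: "norm (R l - R m) \<le> cmod (l - m) * (norm (R l) * norm T * norm (R m))"
        using bnd[of l m] l m by simp
      have lm: "cmod (l - m) < d" using dm by (simp add: dist_norm norm_minus_commute)
      have b2: "norm (R l - R m) \<le> cmod (l - m) * (A * norm (R m))"
        using b unfolding A_def
        by (smt (verit) mult_left_mono mult_right_mono norm_ge_zero)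
      have "cmod (l - m) * A \<le> 1 / 2"
      proof -
        have "cmod (l - m) * A \<le> (1 / (2 * A)) * A"
          using lm A unfolding d_def by (intro mult_right_mono) auto
        then show ?thesis using A by simp
      qed
      then have "norm (R l - R m) \<le> 1 / 2 * norm (R m)"
        using b2 by (smt (verit) mult.assoc mult_right_mono norm_ge_zero)
      then have "norm (R m) \<le> 2 * norm (R l)"
        using norm_triangle_ineq2[of "R m" "R l"] by (simp add: norm_minus_commute)
      then have "norm (R l - R m) \<le> cmod (l - m) * (A * (2 * norm (R l)))"
        using b2 A by (smt (verit) mult_left_mono norm_ge_zero)
      also have "\<dots> \<le> cmod (l - m) * (A * (2 * (norm (R l) + 1)))"
        using A by (intro mult_left_mono) auto
      also have "\<dots> < d * (A * (2 * (norm (R l) + 1)))"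
        using lm A by (intro mult_strict_right_mono) (auto intro!: mult_pos_pos add_nonneg_pos)
      also have "\<dots> \<le> (e / (2 * A * (norm (R l) + 1))) * (A * (2 * (norm (R l) + 1)))"
        using A unfolding d_def by (intro mult_right_mono) auto
      also have "\<dots> = e"
        using A by (simp add: field_simps add_nonneg_eq_0_iff)
      finally show "dist (R m) (R l) < e"
        by (simp add: dist_norm norm_minus_commute)
    qed (rule d)
  qed
  have "bounded (R ` cball 0 1)"
    by (intro compact_imp_bounded compact_continuous_image cont compact_cball)
  then obtain K where "\<forall>x\<in>R ` cball 0 1. norm x \<le> K"
    by (auto simp: bounded_iff)
  then have K: "norm (R l) \<le> K" if "cmod l \<le> 1" for l
    using that by (simp add: mem_cball_0)
  have K0: "0 \<le> K" by (rule order_trans[OF norm_ge_zero K[of 0]]) simp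
  show ?thesis
  proof (rule that[of "K * norm T * K"])
    fix l m :: complex assume *: "cmod l \<le> 1" "cmod m \<le> 1"
    have "norm (R l) * norm T * norm (R m) \<le> K * norm T * K"
      using K * K0 by (intro mult_mono) auto
    then have "cmod (l - m) * (norm (R l) * norm T * norm (R m)) \<le> cmod (l - m) * (K * norm T * K)"
      by (intro mult_left_mono) auto
    then show "norm (R l - R m) \<le> K * norm T * K * cmod (l - m)"
      using bnd[OF *] by (simp add: mult.commute)
  qed (use K0 in auto)
qed

text \<open>Averaging over \<open>\<plusminus>\<close> turns an inverse of \<open>1 - P\<close> into one of \<open>1 - P\<^sup>2\<close> without increasing the
  Lipschitz constant.\<close>

lemma inverse_power_lipschitz:
  fixes T :: "'a::cstar_algebra"
  assumes R: "\<And>l. cmod l \<le> 1 \<Longrightarrow> R l * (1 - l *\<^sub>C T) = 1"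
    and L: "\<And>l m. cmod l \<le> 1 \<Longrightarrow> cmod m \<le> 1 \<Longrightarrow> norm (R l - R m) \<le> L * cmod (l - m)"
  shows "\<exists>G. (\<forall>l. cmod l \<le> 1 \<longrightarrow> G l * (1 - (l *\<^sub>C T) ^ (2 ^ n)) = 1) \<and>
    (\<forall>l m. cmod l \<le> 1 \<longrightarrow> cmod m \<le> 1 \<longrightarrow> norm (G l - G m) \<le> L * cmod (l - m))"
proof (induction n)
  case 0
  then show ?case using R L by auto
next
  case (Suc n)
  then obtain G where G: "\<And>l. cmod l \<le> 1 \<Longrightarrow> G l * (1 - (l *\<^sub>C T) ^ (2 ^ n)) = 1"
    and GL: "\<And>l m. cmod l \<le> 1 \<Longrightarrow> cmod m \<le> 1 \<Longrightarrow> norm (G l - G m) \<le> L * cmod (l - m)"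
    by blast
  \<comment> \<open>A \<open>2 ^ n\<close>-th root of -1 on the unit circle: replacing
    \<open>l\<close> by \<open>z * l\<close> changes the sign of
    \<open>(l *\<^sub>C T) ^ (2 ^ n)\<close> and stays in the disk.\<close>
  define z where "z = cis (pi / 2 ^ n)"
  have "z ^ (2 ^ n) = cis pi"
    using Complex.DeMoivre[of "pi / 2 ^ n" "2 ^ n"] by (simp add: z_def)
  then have z: "z ^ (2 ^ n) = -1" "cmod z = 1"
    by (simp_all add: z_def)
  define G' where "G' l = (1/2) *\<^sub>R (G l + G (z * l))" for l
  have "G' l * (1 - (l *\<^sub>C T) ^ (2 ^ Suc n)) = 1" if l: "cmod l \<le> 1" for l
  proof -
    define P where "P = (l *\<^sub>C T) ^ (2 ^ n)"
    have P2: "(l *\<^sub>C T) ^ (2 ^ Suc n) = P * P"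
      by (simp add: P_def power_add[symmetric] mult_2)
    have "((z * l) *\<^sub>C T) ^ (2 ^ n) = - P"
      by (simp add: P_def scaleC_power power_mult_distrib z scaleC_minus_left)
    then have b: "G (z * l) * (1 + P) = 1"
      using G[of "z * l"] l z by (simp add: norm_mult)
    have a: "G l * (1 - P) = 1" using G[OF l] by (simp add: P_def)
    have "1 - P * P = (1 - P) * (1 + P)" "1 - P * P = (1 + P) * (1 - P)"
      by (simp_all add: algebra_simps)
    then have "G l * (1 - P * P) = 1 + P" "G (z * l) * (1 - P * P) = 1 - P"
      using a b by (metis mult.assoc mult_1_left)+
    then have "(G l + G (z * l)) * (1 - P * P) = 2"
      by (simp add: distrib_right)
    then have "(1/2) *\<^sub>R ((G l + G (z * l)) * (1 - P * P)) = (1/2) *\<^sub>R 2" by simp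
    moreover have "(1/2) *\<^sub>R (2 :: 'a) = 1"
      using scaleR_half_double[of "1 :: 'a"] by simp
    ultimately show ?thesis
      unfolding G'_def P2 by simp
  qed
  moreover have "norm (G' l - G' m) \<le> L * cmod (l - m)" if lm: "cmod l \<le> 1" "cmod m \<le> 1" for l m
  proof -
    have "G' l - G' m = (1/2) *\<^sub>R ((G l - G m) + (G (z * l) - G (z * m)))"
      by (simp add: G'_def algebra_simps)
    then have "norm (G' l - G' m) \<le> (1/2) * (norm (G l - G m) + norm (G (z * l) - G (z * m)))"
      by (simp add: norm_triangle_ineq)
    moreover have "norm (G (z * l) - G (z * m)) \<le> L * cmod (z * l - z * m)"
      using lm z by (intro GL) (simp_all add: norm_mult)
    moreover have "cmod (z * l - z * m) = cmod (l - m)"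
      by (simp add: right_diff_distrib[symmetric] norm_mult z)
    ultimately show ?thesis using GL[OF lm] by simp
  qed
  ultimately show ?case by blast
qed

text \<open>This stands in for the spectral radius formula. For \<open>s\<close> slightly below \<open>1 / \<parallel>T\<parallel>\<close> the inverses of
  \<open>1 - (s T) ^ 2 ^ n\<close> tend to \<open>1\<close>; by the Lipschitz bound, which is uniform in \<open>n\<close>, they stay near \<open>1\<close>
  at \<open>s = 1 / \<parallel>T\<parallel>\<close>, although \<open>(s T) ^ 2 ^ n\<close> has norm \<open>1\<close> there.\<close>

lemma norm_less_1_normal:
  fixes T :: "'a::cstar_algebra"
  assumes N: "normal T"
    and inv: "\<And>l. cmod l \<le> 1 \<Longrightarrow> \<exists>y. y * (1 - l *\<^sub>C T) = 1 \<and> (1 - l *\<^sub>C T) * y = 1"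
  shows "norm T < 1"
proof (rule ccontr)
  assume "\<not> norm T < 1"
  then have T1: "norm T \<ge> 1" by simp
  obtain R where R: "\<And>l. cmod l \<le> 1 \<Longrightarrow> R l * (1 - l *\<^sub>C T) = 1 \<and> (1 - l *\<^sub>C T) * R l = 1"
    using inv by metis
  obtain L where L0: "0 \<le> L"
    and L: "\<And>l m. cmod l \<le> 1 \<Longrightarrow> cmod m \<le> 1 \<Longrightarrow> norm (R l - R m) \<le> L * cmod (l - m)"
    using resolvent_lipschitz[of R T] R by blast
  define s where "s = 1 / norm T"
  have s: "0 < s" "s \<le> 1" "s * norm T = 1"
    using T1 by (auto simp: s_def divide_le_eq_1)
  \<comment> \<open>Error budget: a power of norm below 1/12 at \<open>r\<close> forces
    \<open>norm (H r - 1) \<le> 1/6\<close>, and the Lipschitz bound over the distance from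
    \<open>r\<close> to \<open>s\<close> adds at most 1/6. This leaves
    \<open>norm (H s - 1) \<le> 1/3\<close>, while \<open>norm (P s) = 1\<close>.\<close>
  define r where "r = max 0 (s - 1 / (6 * (L + 1)))"
  have "0 < 1 / (6 * (L + 1))" using L0 by simp
  then have r: "0 \<le> r" "r < s" "s - r \<le> 1 / (6 * (L + 1))"
    using s unfolding r_def by linarith+
  have rT: "0 \<le> r * norm T" "r * norm T < 1"
    using r s T1 by (auto simp: s_def field_simps)
  have nP: "norm ((complex_of_real u *\<^sub>C T) ^ (2 ^ n)) = (u * norm T) ^ (2 ^ n)" if "u \<ge> 0" for u n
    using that by (simp add: scaleC_power norm_scaleC norm_power norm_power_normal[OF N] power_mult_distrib)
  have "(\<lambda>n. (r * norm T) ^ n) \<longlonglongrightarrow> 0"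
    using rT by (intro LIMSEQ_power_zero) simp
  then have "\<forall>\<^sub>F n in sequentially. (r * norm T) ^ n < 1/12"
    by (rule order_tendstoD) simp
  then obtain n0 where n0: "\<And>n. n \<ge> n0 \<Longrightarrow> (r * norm T) ^ n < 1/12"
    by (auto simp: eventually_sequentially)
  have small: "(r * norm T) ^ (2 ^ n0) < 1/12"
    by (rule n0) simp
  obtain G where G: "\<And>l. cmod l \<le> 1 \<Longrightarrow> G l * (1 - (l *\<^sub>C T) ^ (2 ^ n0)) = 1"
    and GL: "\<And>l m. cmod l \<le> 1 \<Longrightarrow> cmod m \<le> 1 \<Longrightarrow> norm (G l - G m) \<le> L * cmod (l - m)"
    using inverse_power_lipschitz[of R T L n0] R L by blast
  define P where "P u = (complex_of_real u *\<^sub>C T) ^ (2 ^ n0)" for u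
  define H where "H u = G (complex_of_real u)" for u
  have HP: "H u - 1 = H u * P u" if "0 \<le> u" "u \<le> 1" for u
    using G[of "complex_of_real u"] that by (simp add: H_def P_def algebra_simps)
  have Pr: "norm (P r) < 1/12" using small r by (simp add: P_def nP)
  have Ps: "norm (P s) = 1" using s by (simp add: P_def nP)
  have r1: "r \<le> 1" using r s by simp
  have "norm (H r - 1) \<le> norm (H r) * (1/12)"
    using HP[OF r(1) r1] norm_mult_ineq[of "H r" "P r"] Pr
    by (smt (verit) mult_left_mono norm_ge_zero)
  moreover have "norm (H r) \<le> norm (H r - 1) + 1"
    using norm_triangle_ineq[of "H r - 1" 1] by simp
  ultimately have a: "norm (H r - 1) \<le> 1/6" by linarith
  have "norm (H r - H s) \<le> L * cmod (complex_of_real r - complex_of_real s)"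
    unfolding H_def by (rule GL) (use r r1 s in simp_all)
  also have "cmod (complex_of_real r - complex_of_real s) = s - r"
    using r by (metis abs_minus_commute abs_of_pos diff_gt_0_iff_gt norm_of_real of_real_diff)
  also have "L * (s - r) \<le> L * (1 / (6 * (L + 1)))"
    using r L0 by (intro mult_left_mono) auto
  also have "\<dots> \<le> 1/6" using L0 by (simp add: field_simps)
  finally have b: "norm (H s - 1) \<le> 1/3"
    using a norm_triangle_ineq[of "H r - 1" "H s - H r"] by (simp add: norm_minus_commute)
  \<comment> \<open>Rewriting the inverse relation for \<open>P s\<close> bounds its norm, which is
    1, by 1/3 + 1/3.\<close>
  have "P s = (H s - 1) - (H s - 1) * P s"
    using HP[of s] s by (simp add: algebra_simps)
  then have "norm (P s) \<le> norm (H s - 1) + norm (H s - 1) * norm (P s)"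
    by (smt (verit) norm_mult_ineq norm_triangle_ineq4)
  then show False using b Ps by simp
qed

text \<open>\<open>R\<close> is normal because \<open>a\<close> is selfadjoint. With
  \<open>T\<close> equal to \<open>d / 2\<close> times \<open>R\<close>, the element
  \<open>1 - l *\<^sub>C T\<close> is \<open>R * (a - w *\<^sub>C 1)\<close> for a point
  \<open>w\<close> within \<open>d / 2\<close> of \<open>z\<close>, which is still off the half-line
  and so outside the spectrum. Scaling by \<open>d / 2\<close> instead of \<open>d\<close> leaves
  room for the closed disk; hence the 2 in \<open>2 / d\<close>.\<close>

lemma resolvent_bound:
  fixes a :: "'a::cstar_algebra"
  assumes a: "cstar_positive a" and d: "0 < d" "\<And>x. 0 \<le> x \<Longrightarrow> d \<le> cmod (complex_of_real x - z)"
  shows "\<exists>R. R * (a - z *\<^sub>C 1) = 1 \<and> (a - z *\<^sub>C 1) * R = 1 \<and> norm R \<le> 2 / d"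
proof -
  have inv: "\<exists>c. c * (a - w *\<^sub>C 1) = 1 \<and> (a - w *\<^sub>C 1) * c = 1"
    if "\<And>x. 0 \<le> x \<Longrightarrow> complex_of_real x \<noteq> w" for w
    using a that unfolding cstar_positive_def cstar_spectrum_def by blast
  obtain R where R: "R * (a - z *\<^sub>C 1) = 1" "(a - z *\<^sub>C 1) * R = 1"
    using inv[of z] d by fastforce
  have sa: "star a = a" using a by (simp add: cstar_positive_def selfadjoint_def)
  define A where "A = a - z *\<^sub>C 1"
  have RA: "R * A = 1" "A * R = 1" using R by (simp_all add: A_def)
  have sA: "star A = a - cnj z *\<^sub>C 1"
    by (simp add: A_def star_diff star_scaleC star_one sa)
  have "A * (a - cnj z *\<^sub>C 1) = (a - cnj z *\<^sub>C 1) * A"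
    unfolding A_def
    by (simp add: algebra_simps mult_scaleC_left mult_scaleC_right scaleC_scaleC scaleC_diff_right mult.commute)
  then have comm: "A * star A = star A * A"
    unfolding sA .
  have sR: "star A * star R = 1" "star R * star A = 1"
    using RA by (simp_all add: star_mult[symmetric] star_one)
  have "star R * R * (A * star A) = star R * (R * A) * star A"
    by (simp only: mult.assoc)
  then have U: "star R * R * (A * star A) = 1" by (simp add: RA sR)
  have "A * star A * (R * star R) = star A * (A * R) * star R"
    unfolding comm by (simp only: mult.assoc)
  then have V: "A * star A * (R * star R) = 1" by (simp add: RA sR)
  have nR: "star R * R = R * star R"
    by (metis U V mult.assoc mult_1_left mult_1_right)
  have "norm (complex_of_real (d / 2) *\<^sub>C R) < 1"
  proof (rule norm_less_1_normal)
    show "normal (complex_of_real (d / 2) *\<^sub>C R)"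
      unfolding normal_def by (simp add: star_scaleC mult_scaleC_left mult_scaleC_right nR)
    fix l :: complex assume l: "cmod l \<le> 1"
    define w where "w = z + l * (d / 2)"
    have "complex_of_real x \<noteq> w" if "0 \<le> x" for x
    proof
      assume "complex_of_real x = w"
      then have "cmod (complex_of_real x - z) = cmod l * (d / 2)"
        using d by (simp add: w_def norm_mult)
      also have "\<dots> \<le> d / 2" using l d by (simp add: field_simps)
      finally show False using d(2)[OF that] d(1) by simp
    qed
    then obtain S where S: "S * (a - w *\<^sub>C 1) = 1" "(a - w *\<^sub>C 1) * S = 1"
      using inv[of w] by blast
    have aw: "a - w *\<^sub>C 1 = A - (l * (d / 2)) *\<^sub>C 1"
      by (simp add: A_def w_def scaleC_add_left)
    have T: "1 - l *\<^sub>C complex_of_real (d / 2) *\<^sub>C R = R * (a - w *\<^sub>C 1)"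
      unfolding aw by (simp add: right_diff_distrib RA mult_scaleC_right scaleC_scaleC)
    show "\<exists>y. y * (1 - l *\<^sub>C complex_of_real (d / 2) *\<^sub>C R) = 1 \<and>
        (1 - l *\<^sub>C complex_of_real (d / 2) *\<^sub>C R) * y = 1"
      unfolding T by (intro exI[of _ "S * A"]) (metis RA S mult.assoc mult_1_left)
  qed
  then have "norm R \<le> 2 / d"
    using d by (simp add: norm_scaleC field_simps)
  then show ?thesis using R by blast
qed

text \<open>At a point \<open>z\<close> off the half-line the resolvents of all \<open>a n\<close>
  obey the same bound \<open>2 / d\<close>. A Neumann series around one \<open>a n\<close> with
  \<open>norm (a n - l) < d / 2\<close> therefore inverts \<open>l - z *\<^sub>C 1\<close>.\<close>

lemma cstar_positive_closed:
  fixes a :: "nat \<Rightarrow> 'a::cstar_algebra"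
  assumes pos: "\<And>n. cstar_positive (a n)" and lim: "a \<longlonglongrightarrow> l"
  shows "cstar_positive l"
  unfolding cstar_positive_def selfadjoint_def
proof
  show "star l = l"
    using tendsto_star[OF lim] lim pos
    by (intro LIMSEQ_unique[of a]) (simp_all add: cstar_positive_def selfadjoint_def)
  show "cstar_spectrum l \<subseteq> complex_of_real ` {0..}"
  proof (rule subsetI, rule ccontr)
    fix z assume z: "z \<in> cstar_spectrum l" "z \<notin> complex_of_real ` {0..}"
    have "closed (complex_of_real ` {0..})"
    proof -
      have "complex_of_real ` {0..} = \<real>\<^sub>\<ge>\<^sub>0"
        by (auto simp: nonneg_Reals_def)
      then show ?thesis by simp
    qed
    then obtain d where d: "d > 0" "\<And>x. x \<in> complex_of_real ` {0..} \<Longrightarrow> d \<le> dist z x"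
      using separate_point_closed z(2) by metis
    have d2: "d \<le> cmod (complex_of_real x - z)" if "0 \<le> x" for x
      using d(2)[of "complex_of_real x"] that by (simp add: dist_norm norm_minus_commute)
    have "\<forall>\<^sub>F n in sequentially. dist (a n) l < d / 2"
      using lim d(1) by (intro tendstoD) auto
    then obtain n where n: "norm (a n - l) < d / 2"
      by (auto simp: eventually_sequentially dist_norm)
    obtain R where R: "R * (a n - z *\<^sub>C 1) = 1" "(a n - z *\<^sub>C 1) * R = 1" "norm R \<le> 2 / d"
      using resolvent_bound[OF pos d(1) d2] by blast
    have "norm (R * (a n - l)) \<le> norm R * norm (a n - l)" by (rule norm_mult_ineq)
    also have "\<dots> \<le> (2 / d) * norm (a n - l)" using R by (intro mult_right_mono) auto
    also have "\<dots> < (2 / d) * (d / 2)" using n d by (intro mult_strict_left_mono) auto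
    finally have "norm (R * (a n - l)) < 1" using d by simp
    then obtain y where y: "y * (1 - R * (a n - l)) = 1" "(1 - R * (a n - l)) * y = 1"
      using neumann_inverse by blast
    have "(a n - z *\<^sub>C 1) * (1 - R * (a n - l)) = (a n - z *\<^sub>C 1) - ((a n - z *\<^sub>C 1) * R) * (a n - l)"
      by (simp add: right_diff_distrib mult.assoc)
    also have "\<dots> = l - z *\<^sub>C 1" by (simp add: R)
    finally have "l - z *\<^sub>C 1 = (a n - z *\<^sub>C 1) * (1 - R * (a n - l))" by simp
    moreover have "(y * R) * ((a n - z *\<^sub>C 1) * (1 - R * (a n - l))) =
        y * (R * (a n - z *\<^sub>C 1)) * (1 - R * (a n - l))"
      by (simp only: mult.assoc)
    moreover have "(a n - z *\<^sub>C 1) * (1 - R * (a n - l)) * (y * R) =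
        (a n - z *\<^sub>C 1) * ((1 - R * (a n - l)) * y) * R"
      by (simp only: mult.assoc)
    ultimately have "(y * R) * (l - z *\<^sub>C 1) = 1 \<and> (l - z *\<^sub>C 1) * (y * R) = 1"
      by (simp only: R y mult_1_right mult_1_left)
    then show False using z(1) unfolding cstar_spectrum_def by blast
  qed
qed

text \<open>The two positivity assumptions confine the spectrum of \<open>x\<close> to the interval
  from -1 to 1. Halving \<open>x\<close> moves it inside the open disk, as
  \<open>norm_less_1_normal\<close> requires; this is the origin of the 2.\<close>

lemma norm_between_minus_one_one:
  fixes x :: "'a::cstar_algebra"
  assumes "cstar_positive (1 - x)" and "cstar_positive (1 + x)"
  shows "norm x < 2"
proof -
  have sa: "star x = x"
    using assms(2) by (simp add: cstar_positive_def selfadjoint_def star_add star_one)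
  have inv: "\<exists>c. c * (x - w *\<^sub>C 1) = 1 \<and> (x - w *\<^sub>C 1) * c = 1" if w: "1 < cmod w" for w
  proof -
    \<comment> \<open>Spectral mapping for \<open>v + u x\<close>, needed for \<open>1 - x\<close>
      and \<open>1 + x\<close>; the condition \<open>u * u = 1\<close> makes \<open>u\<close> its
      own inverse.\<close>
    have sp: "w \<in> complex_of_real ` {0..}"
      if pb: "cstar_positive b" and "b = v *\<^sub>C 1 + u *\<^sub>C x" "u * u = 1" "w = v + u * z"
        "\<not> (\<exists>c. c * (x - z *\<^sub>C 1) = 1 \<and> (x - z *\<^sub>C 1) * c = 1)" for b u v w z
    proof (rule ccontr)
      assume "w \<notin> complex_of_real ` {0..}"
      then obtain c where c: "c * (b - w *\<^sub>C 1) = 1" "(b - w *\<^sub>C 1) * c = 1"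
        using pb unfolding cstar_positive_def cstar_spectrum_def by blast
      have "b - w *\<^sub>C 1 = u *\<^sub>C (x - z *\<^sub>C 1)"
        using that by (simp add: scaleC_diff_right scaleC_add_left scaleC_scaleC)
      then have "(u *\<^sub>C c) * (x - z *\<^sub>C 1) = 1" "(x - z *\<^sub>C 1) * (u *\<^sub>C c) = 1"
        using c by (simp_all add: mult_scaleC_left mult_scaleC_right)
      then show False using that(5) by blast
    qed
    show ?thesis
    proof (rule ccontr)
      assume n: "\<not> ?thesis"
      have "1 - w \<in> complex_of_real ` {0..}"
        by (rule sp[OF assms(1) _ _ _ n, where u = "-1" and v = 1])
           (simp_all add: scaleC_one scaleC_minus_one)
      moreover have "1 + w \<in> complex_of_real ` {0..}"
        by (rule sp[OF assms(2) _ _ _ n, where u = 1 and v = 1]) (simp_all add: scaleC_one)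
      ultimately obtain p q where p: "p \<ge> 0" "1 - w = complex_of_real p"
        and q: "q \<ge> 0" "1 + w = complex_of_real q" by auto
      have "w = complex_of_real (1 - p)" using p(2) by (simp add: algebra_simps)
      moreover have "w = complex_of_real (q - 1)" using q(2) by (simp add: algebra_simps)
      ultimately have "1 - p = q - 1" "cmod w = \<bar>1 - p\<bar>"
        by (metis of_real_eq_iff, metis norm_of_real)
      then show False using p q w by auto
    qed
  qed
  have "norm (complex_of_real (1/2) *\<^sub>C x) < 1"
  proof (rule norm_less_1_normal)
    show "normal (complex_of_real (1/2) *\<^sub>C x)"
      by (simp add: normal_def star_scaleC sa)
    fix l :: complex assume l: "cmod l \<le> 1"
    show "\<exists>y. y * (1 - l *\<^sub>C complex_of_real (1/2) *\<^sub>C x) = 1 \<and>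
        (1 - l *\<^sub>C complex_of_real (1/2) *\<^sub>C x) * y = 1"
    proof (cases "l = 0")
      case True
      then show ?thesis by (intro exI[of _ 1]) (simp add: scaleC_zero_left)
    next
      case False
      define u where "u = - (l / 2)"
      have u: "u \<noteq> 0" using False by (simp add: u_def)
      have "1 < cmod (2 / l)" using l False by (simp add: norm_divide field_simps)
      then obtain c where c: "c * (x - (2 / l) *\<^sub>C 1) = 1" "(x - (2 / l) *\<^sub>C 1) * c = 1"
        using inv by blast
      have "1 - l *\<^sub>C complex_of_real (1/2) *\<^sub>C x = u *\<^sub>C (x - (2 / l) *\<^sub>C 1)"
        using False by (simp add: u_def scaleC_diff_right scaleC_scaleC scaleC_minus_left scaleC_one)
      then have "(inverse u *\<^sub>C c) * (1 - l *\<^sub>C complex_of_real (1/2) *\<^sub>C x) = 1"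
        "(1 - l *\<^sub>C complex_of_real (1/2) *\<^sub>C x) * (inverse u *\<^sub>C c) = 1"
        using c u by (simp_all add: mult_scaleC_left mult_scaleC_right scaleC_scaleC scaleC_one)
      then show ?thesis by blast
    qed
  qed
  then show ?thesis by (simp add: norm_scaleC)
qed

text \<open>The equation \<open>1 - h = (1 - y)\<^sup>2\<close> is the fixed point equation
  \<open>y = (h + y\<^sup>2) / 2\<close>. Its right-hand side maps the selfadjoint elements of norm
  at most 1/2 into themselves and contracts by 1/2, so Banach's theorem provides
  \<open>y\<close>.\<close>

lemma one_minus_square:
  fixes h :: "'a::cstar_algebra"
  assumes sa: "star h = h" and h: "norm h \<le> 1/2"
  shows "\<exists>y. 1 - h = star y * y"
proof -
  define S where "S = {y :: 'a. star y = y \<and> norm y \<le> 1/2}"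
  define f where "f y = (1/2) *\<^sub>R (h + y * y)" for y
  have star_scaleR: "star (r *\<^sub>R x) = r *\<^sub>R star x" for r and x :: 'a
    by (simp add: scaleR_eq_scaleC star_scaleC)
  have cs: "continuous_on UNIV (star :: 'a \<Rightarrow> 'a)"
    unfolding continuous_on_def by (auto intro: tendsto_star)
  have "closed S"
    unfolding S_def
    by (intro closed_Collect_conj closed_Collect_eq closed_Collect_le cs continuous_intros)
  then have "complete S" by (simp add: complete_eq_closed)
  moreover have "0 \<in> S" by (simp add: S_def star_zero)
  moreover have "f y \<in> S" if "y \<in> S" for y
  proof -
    have "norm y * norm y \<le> (1/2) * (1/2)"
      using that by (intro mult_mono) (auto simp: S_def)
    then have "norm (y * y) \<le> 1/4" using norm_mult_ineq[of y y] by simp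
    then have "norm (h + y * y) \<le> 1"
      using h norm_triangle_ineq[of h "y * y"] by simp
    then show ?thesis
      using that by (simp add: S_def f_def star_scaleR star_add star_mult sa)
  qed
  moreover have "dist (f x) (f y) \<le> (1/2) * dist x y" if "x \<in> S" "y \<in> S" for x y
  proof -
    have "(h + x * x) - (h + y * y) = x * (x - y) + (x - y) * y"
      by (simp add: algebra_simps)
    then have "f x - f y = (1/2) *\<^sub>R (x * (x - y) + (x - y) * y)"
      unfolding f_def scaleR_diff_right[symmetric] by simp
    then have "norm (f x - f y) \<le> (1/2) * (norm x * norm (x - y) + norm (x - y) * norm y)"
      by simp (meson add_mono norm_mult_ineq norm_triangle_le)
    also have "\<dots> \<le> (1/2) * ((1/2) * norm (x - y) + norm (x - y) * (1/2))"
      using that unfolding S_def by (intro mult_left_mono add_mono mult_right_mono) auto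
    finally show ?thesis by (simp add: dist_norm)
  qed
  ultimately have "\<exists>!y\<in>S. f y = y"
    by (intro Banach_fix[where c = "1/2"]) auto
  then obtain y where y: "y \<in> S" "f y = y" by blast
  have "2 *\<^sub>R y = 2 *\<^sub>R f y" by (simp only: y)
  then have "y + y = h + y * y" by (simp add: f_def scaleR_2)
  then have "1 - h = star (1 - y) * (1 - y)"
    using y(1) by (simp add: S_def star_diff star_one algebra_simps)
  then show ?thesis by blast
qed

text \<open>Positivity is given on squares only. For selfadjoint \<open>h\<close> of norm at most
  1/2 both \<open>1 - h\<close> and \<open>1 + h\<close> are squares, so
  \<open>norm (E h) < 2\<close>; rescaling yields the factor 4, and splitting into real and
  imaginary parts doubles it. The bound serves to take limits inside \<open>E\<close>.\<close>

lemma pos_cond_exp_bounded: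
  fixes E :: "'a::cstar_algebra \<Rightarrow> 'b::cstar_algebra"
  assumes E: "pos_cond_exp \<iota> E"
  shows "norm (E x) \<le> 8 * norm x"
proof -
  have add: "E (x + y) = E x + E y" and scale: "E (c *\<^sub>C x) = c *\<^sub>C E x"
    and one: "E 1 = 1" and pos: "cstar_positive (E (star x * x))" for x y c
    using E unfolding pos_cond_exp_def by auto
  have minus: "E (- x) = - E x" for x using scale[of "-1" x] by (simp add: scaleC_minus_one)
  have scaleR: "E (r *\<^sub>R x) = r *\<^sub>R E x" for r x
    by (simp only: scaleR_eq_scaleC scale)
  have small: "norm (E h) < 2" if h: "star h = h" "norm h \<le> 1/2" for h
  proof (rule norm_between_minus_one_one)
    obtain y where "1 - h = star y * y" using one_minus_square[OF h] by blast
    then have "cstar_positive (E (1 - h))" using pos by simp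
    then show "cstar_positive (1 - E h)"
      using add[of 1 "- h"] by (simp only: one minus diff_conv_add_uminus)
    obtain y where "1 - (- h) = star y * y"
      using one_minus_square[of "- h"] h by (auto simp: star_minus)
    then have "cstar_positive (E (1 + h))" using pos by simp
    then show "cstar_positive (1 + E h)" by (simp add: one add)
  qed
  have sa: "norm (E h) \<le> 4 * norm h" if h: "star h = h" for h
  proof (cases "h = 0")
    case False
    define r where "r = 1 / (2 * norm h)"
    have r: "r > 0" "r * norm h = 1/2" using False by (simp_all add: r_def)
    have "norm (E (r *\<^sub>R h)) < 2"
      using r by (intro small) (simp_all add: scaleR_eq_scaleC star_scaleC h norm_scaleC)
    then have "r * norm (E h) < 2" using r by (simp add: scaleR)
    then show ?thesis using False by (simp add: r_def field_simps)
  next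
    case True
    then show ?thesis using scaleR[of 0 0] by simp
  qed
  define p where "p = (1/2) *\<^sub>R (x + star x)"
  define q where "q = (1/2) *\<^sub>R (\<i> *\<^sub>C (star x - x))"
  have half: "(1/2) *\<^sub>R (u + u) = u" for u :: 'a
    by (simp flip: scaleR_2)
  have "\<i> *\<^sub>C q = (1/2) *\<^sub>R (x - star x)"
    by (simp add: q_def scaleR_eq_scaleC scaleC_scaleC) (simp add: scaleC_diff_right scaleC_minus_left)
  then have x: "x = p + \<i> *\<^sub>C q"
    by (simp add: p_def scaleR_add_right[symmetric] half)
  have "star p = p"
    by (simp add: p_def scaleR_eq_scaleC star_scaleC star_add star_star add.commute)
  moreover have "star q = q"
    by (simp add: q_def scaleR_eq_scaleC star_scaleC star_diff star_star scaleC_minus_left scaleC_minus_right scaleC_diff_right)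
  moreover have "norm p \<le> norm x"
    using norm_triangle_ineq[of x "star x"] by (simp add: p_def norm_star)
  moreover have "norm q \<le> norm x"
    using norm_triangle_ineq4[of "star x" x] by (simp add: q_def norm_star norm_scaleC)
  ultimately have "norm (E p) \<le> 4 * norm x" "norm (E q) \<le> 4 * norm x"
    using sa[of p] sa[of q] by auto
  moreover have "norm (E x) \<le> norm (E p) + norm (\<i> *\<^sub>C E q)"
    unfolding x add scale by (rule norm_triangle_ineq)
  ultimately show ?thesis by (simp add: norm_scaleC)
qed

section \<open>Sums over disjoint blocks of a free family are free\<close>

lemma gen_star_alg_diff:
  "x \<in> gen_star_alg \<iota> a \<Longrightarrow> y \<in> gen_star_alg \<iota> a \<Longrightarrow> x - y \<in> gen_star_alg \<iota> a"
  by (metis diff_conv_add_uminus gen_star_alg.add gen_star_alg.scaleC scaleC_minus_one)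

text \<open>The ambient algebra is any star-algebra, so that the same facts apply to
  \<open>E\<close> on the C*-algebra and to \<open>\<mu>\<close> and \<open>\<Phi>\<close> on free
  algebras.\<close>

locale cond_exp =
  fixes \<iota> :: "'b::cstar_algebra \<Rightarrow> 'c::star_algebra_1" and E :: "'c \<Rightarrow> 'b"
  assumes hom: "unital_star_hom \<iota>" and pce: "pos_cond_exp \<iota> E"
begin

lemma inc_one: "\<iota> 1 = 1" and inc_add: "\<iota> (a + b) = \<iota> a + \<iota> b"
  and inc_mult: "\<iota> (a * b) = \<iota> a * \<iota> b" and inc_scaleC: "\<iota> (c *\<^sub>C a) = c *\<^sub>C \<iota> a"
  and inc_star: "\<iota> (star a) = star (\<iota> a)"
  using hom unfolding unital_star_hom_def unital_alg_hom_def by auto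

lemma inc_alg_hom: "unital_alg_hom \<iota>"
  using hom unfolding unital_star_hom_def by simp

lemma inc_zero: "\<iota> 0 = 0"
  using inc_alg_hom by (rule unital_alg_hom_zero)

lemma E_one: "E 1 = 1" and E_add: "E (x + y) = E x + E y"
  and E_scaleC: "E (c *\<^sub>C x) = c *\<^sub>C E x" and E_bimod: "E (\<iota> b * x * \<iota> b') = b * E x * b'"
  and E_pos: "cstar_positive (E (star x * x))"
  using pce unfolding pos_cond_exp_def by auto

lemma E_zero: "E 0 = 0"
  using E_scaleC[of 0 0] by (simp add: scaleC_zero_left)

lemma E_minus: "E (- x) = - E x"
  using E_scaleC[of "-1" x] by (simp add: scaleC_minus_one)

lemma E_diff: "E (x - y) = E x - E y"
  using E_add[of x "- y"] by (simp add: E_minus)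

lemma E_sum: "E (sum f A) = (\<Sum>i\<in>A. E (f i))"
  by (induction A rule: infinite_finite_induct) (simp_all add: E_zero E_add)

lemma E_left: "E (\<iota> b * x) = b * E x"
  using E_bimod[of b x 1] by (simp add: inc_one)

lemma E_right: "E (x * \<iota> b) = E x * b"
  using E_bimod[of 1 x b] by (simp add: inc_one)

lemma E_inc: "E (\<iota> b) = b"
  using E_left[of b 1] by (simp add: E_one)

text \<open>The words annihilated by freeness, as lists, so that they can be extended and
  concatenated. The empty list is excluded because \<open>E 1 = 1\<close>.\<close>

definition centred :: "'i set \<Rightarrow> ('i \<Rightarrow> 'c) \<Rightarrow> ('i \<times> 'c) list \<Rightarrow> bool" where
  "centred G X as \<longleftrightarrow> as \<noteq> [] \<and> distinct_adj (map fst as) \<and>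
     (\<forall>(i, a)\<in>set as. i \<in> G \<and> a \<in> gen_star_alg \<iota> (X i) \<and> E a = 0)"

lemma free_over_list:
  assumes "free_over \<iota> E I X" and "centred I X as"
  shows "E (prod_list (map snd as)) = 0"
proof -
  \<comment> \<open>Freeness counts positions from 1, lists count from 0.\<close>
  define \<epsilon> where "\<epsilon> l = fst (as ! (l - 1))" for l
  define A where "A l = snd (as ! (l - 1))" for l
  have "map A [1..<Suc (length as)] = map snd as"
    by (rule nth_equalityI) (simp_all add: A_def del: upt_Suc)
  moreover have "\<epsilon> l \<in> I \<and> A l \<in> gen_star_alg \<iota> (X (\<epsilon> l)) \<and> E (A l) = 0" if "l \<in> {1..length as}" for l
  proof -
    have "as ! (l - 1) \<in> set as" using that by (intro nth_mem) auto
    then show ?thesis using assms(2) unfolding centred_def \<epsilon>_def A_def by fastforce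
  qed
  moreover have "\<epsilon> l \<noteq> \<epsilon> (Suc l)" if "l \<in> {1..<length as}" for l
  proof -
    have "distinct_adj (map fst as)" using assms(2) by (simp add: centred_def)
    then have "map fst as ! (l - 1) \<noteq> map fst as ! Suc (l - 1)"
      using that unfolding distinct_adj_conv_nth by (elim allE[of _ "l - 1"]) auto
    then show ?thesis using that by (simp add: \<epsilon>_def nth_map less_imp_diff_less)
  qed
  moreover have "1 \<le> length as" using assms(2) by (simp add: centred_def Suc_le_eq)
  ultimately show ?thesis
    using assms(1) unfolding free_over_def by metis
qed

lemma free_overI:
  assumes "\<And>as. centred I X as \<Longrightarrow> E (prod_list (map snd as)) = 0"
  shows "free_over \<iota> E I X"
  unfolding free_over_def
proof (intro allI impI)
  fix n \<epsilon> A
  assume n: "1 \<le> n"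
    and 1: "\<forall>l\<in>{1..n}. \<epsilon> l \<in> I \<and> A l \<in> gen_star_alg \<iota> (X (\<epsilon> l)) \<and> E (A l) = 0"
    and 2: "\<forall>l\<in>{1..<n}. \<epsilon> l \<noteq> \<epsilon> (Suc l)"
  define as where "as = map (\<lambda>l. (\<epsilon> l, A l)) [1..<Suc n]"
  have "centred I X as"
    unfolding centred_def
  proof (intro conjI)
    show "as \<noteq> []" using n by (simp add: as_def)
    show "distinct_adj (map fst as)"
      using 2 by (auto simp: as_def distinct_adj_conv_nth simp del: upt_Suc)
    show "\<forall>(i, a)\<in>set as. i \<in> I \<and> a \<in> gen_star_alg \<iota> (X i) \<and> E a = 0"
      using 1 by (auto simp: as_def simp del: upt_Suc)
  qed
  from assms[OF this] show "E (prod_list (map A [1..<Suc n])) = 0"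
    by (simp add: as_def comp_def del: upt_Suc)
qed

text \<open>\<open>F\<close> records which indices may come first, since this decides what may be
  put in front of a word. Sums suffice: coefficients, and with them scalars, are absorbed by the
  first factor.\<close>

inductive_set cspan :: "'i set \<Rightarrow> 'i set \<Rightarrow> ('i \<Rightarrow> 'c) \<Rightarrow> 'c set" for F G X where
  zero: "0 \<in> cspan F G X"
| prod: "centred G X as \<Longrightarrow> fst (hd as) \<in> F \<Longrightarrow> y \<in> cspan F G X \<Longrightarrow>
    prod_list (map snd as) + y \<in> cspan F G X"

lemma cspan_add: "x \<in> cspan F G X \<Longrightarrow> y \<in> cspan F G X \<Longrightarrow> x + y \<in> cspan F G X"
  by (induction x rule: cspan.induct) (auto simp: add.assoc intro: cspan.prod)

lemma cspan_single: "centred G X as \<Longrightarrow> fst (hd as) \<in> F \<Longrightarrow> prod_list (map snd as) \<in> cspan F G X"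
  using cspan.prod[OF _ _ cspan.zero, of G X as F] by simp

lemma cspan_mono:
  assumes "G \<subseteq> G'" and "x \<in> cspan F G X" shows "x \<in> cspan F G' X"
  using assms(2)
proof (induction rule: cspan.induct)
  case (prod as y)
  then have "centred G' X as" using assms(1) unfolding centred_def by fastforce
  then show ?case using prod by (intro cspan.prod)
qed (rule cspan.zero)

lemma E_cspan:
  assumes "free_over \<iota> E I X" and "x \<in> cspan F I X" shows "E x = 0"
  using assms(2) by induction (simp_all add: E_zero E_add free_over_list[OF assms(1)])

lemma centred_scale:
  assumes "centred G X as"
  shows "\<iota> b * prod_list (map snd as) \<in> cspan G G X"
proof -
  obtain i a rest where as: "as = (i, a) # rest"
    using assms unfolding centred_def by (cases as) auto
  have "centred G X ((i, \<iota> b * a) # rest)"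
    using assms unfolding centred_def as
    by (auto simp: E_left intro: gen_star_alg.mult gen_star_alg.base)
  from cspan_single[OF this, of G] show ?thesis
    using assms by (simp add: as mult.assoc centred_def)
qed

text \<open>The usual decomposition, constants plus alternating centred words, of the algebra that
  the \<open>X i\<close> with \<open>i\<close> in \<open>G\<close> generate over the
  coefficients.\<close>

definition wspan :: "'i set \<Rightarrow> ('i \<Rightarrow> 'c) \<Rightarrow> 'c set" where
  "wspan G X = {\<iota> b + y |b y. y \<in> cspan G G X}"

lemma wspan_inc: "\<iota> b \<in> wspan G X"
  unfolding wspan_def using cspan.zero by force

lemma wspan_cspan: "y \<in> cspan G G X \<Longrightarrow> y \<in> wspan G X"
  unfolding wspan_def using inc_zero by force

lemma wspan_add:
  assumes "x \<in> wspan G X" "y \<in> wspan G X" shows "x + y \<in> wspan G X"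
proof -
  obtain b u b' v where "x = \<iota> b + u" "y = \<iota> b' + v" "u \<in> cspan G G X" "v \<in> cspan G G X"
    using assms unfolding wspan_def by auto
  moreover from this have "x + y = \<iota> (b + b') + (u + v)" by (simp add: inc_add)
  ultimately show ?thesis unfolding wspan_def using cspan_add by blast
qed

lemma wspan_induct [consumes 1, case_names inc prod add]:
  assumes "x \<in> wspan G X" and "\<And>b. P (\<iota> b)" and "\<And>as. centred G X as \<Longrightarrow> P (prod_list (map snd as))"
    and "\<And>x y. P x \<Longrightarrow> P y \<Longrightarrow> P (x + y)"
  shows "P x"
proof -
  obtain b y where x: "x = \<iota> b + y" "y \<in> cspan G G X" using assms(1) unfolding wspan_def by auto
  from x(2) have "P y"
    by (induction rule: cspan.induct) (use assms(2)[of 0] assms(3,4) in \<open>auto simp: inc_zero\<close>)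
  then show ?thesis using assms(2,4) x(1) by blast
qed

lemma wspan_scale: "x \<in> wspan G X \<Longrightarrow> \<iota> b * x \<in> wspan G X"
  by (induction rule: wspan_induct)
    (auto simp: distrib_left inc_mult[symmetric] intro: wspan_add wspan_inc wspan_cspan centred_scale)

text \<open>Only the first factor of a word interacts with \<open>a\<close>. If its index differs
  from \<open>l\<close>, then \<open>a\<close> is centred and prepended. If it equals
  \<open>l\<close>, then the product of the two is centred and its expectation is absorbed by the
  rest of the word.\<close>

lemma wspan_gen:
  assumes l: "l \<in> G" and a: "a \<in> gen_star_alg \<iota> (X l)" and x: "x \<in> wspan G X"
  shows "a * x \<in> wspan G X"
  using x
proof (induction rule: wspan_induct)
  have dec: "c \<in> wspan G X" if c: "c \<in> gen_star_alg \<iota> (X l)" for c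
  proof -
    have "centred G X [(l, c - \<iota> (E c))]"
      using l c by (auto simp: centred_def E_diff E_inc intro: gen_star_alg_diff gen_star_alg.base)
    from wspan_add[OF wspan_inc wspan_cspan[OF cspan_single[OF this]], of "E c"] show ?thesis
      using l by simp
  qed
  {
    case (inc b)
    show ?case by (rule dec) (intro gen_star_alg.mult a gen_star_alg.base)
  next
    case (prod as)
    then obtain i c rest where as: "as = (i, c) # rest"
      unfolding centred_def by (cases as) auto
    show ?case
    proof (cases "i = l")
      case True
      let ?e = "E (a * c)"
      have ac: "a * c \<in> gen_star_alg \<iota> (X l)"
        using prod a True unfolding centred_def as by (auto intro: gen_star_alg.mult)
      have "centred G X ((l, a * c - \<iota> ?e) # rest)"
        using prod True ac unfolding centred_def as
        by (auto simp: E_diff E_inc intro: gen_star_alg_diff gen_star_alg.base)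
      from wspan_cspan[OF cspan_single[OF this, of G]]
      have 1: "(a * c - \<iota> ?e) * prod_list (map snd rest) \<in> wspan G X" using l by simp
      have 2: "\<iota> ?e * prod_list (map snd rest) \<in> wspan G X"
      proof (cases "rest = []")
        case True
        then show ?thesis by (simp add: wspan_inc)
      next
        case False
        then have "centred G X rest"
          using prod unfolding centred_def as by (cases rest) auto
        then show ?thesis by (intro wspan_cspan centred_scale)
      qed
      have "a * prod_list (map snd as) =
          (a * c - \<iota> ?e) * prod_list (map snd rest) + \<iota> ?e * prod_list (map snd rest)"
        by (simp add: as algebra_simps)
      then show ?thesis using wspan_add[OF 1 2] by simp
    next
      case False
      have "centred G X ((l, a - \<iota> (E a)) # as)"
        using prod False a l unfolding centred_def as
        by (auto simp: E_diff E_inc intro: gen_star_alg_diff gen_star_alg.base)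
      from wspan_cspan[OF cspan_single[OF this, of G]]
      have 1: "(a - \<iota> (E a)) * prod_list (map snd as) \<in> wspan G X" using l by simp
      have 2: "\<iota> (E a) * prod_list (map snd as) \<in> wspan G X"
        by (intro wspan_cspan centred_scale prod)
      show ?thesis using wspan_add[OF 1 2] by (simp add: algebra_simps)
    qed
  next
    case (add x y)
    then show ?case by (simp add: distrib_left wspan_add)
  }
qed

lemma gen_star_alg_sum_wspan:
  assumes G: "finite G" and sa: "\<And>i. i \<in> G \<Longrightarrow> selfadjoint (X i)"
    and x: "x \<in> gen_star_alg \<iota> (\<Sum>i\<in>G. X i)"
  shows "x \<in> wspan G X"
proof -
  have star_sum: "star (\<Sum>i\<in>H. X i) = (\<Sum>i\<in>H. X i)" if "H \<subseteq> G" "finite H" for H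
    using that(2,1) by (induction H) (auto simp: star_zero star_add sa[unfolded selfadjoint_def])
  have sum: "(\<Sum>i\<in>H. X i) * w \<in> wspan G X" if "w \<in> wspan G X" "H \<subseteq> G" "finite H" for w H
    using that(3,2)
  proof (induction H)
    case empty
    show ?case using wspan_inc[of 0 G X] by (simp add: inc_zero)
  next
    case (insert i H)
    then have "X i * w \<in> wspan G X"
      using that(1) gen_star_alg.gen by (intro wspan_gen[of i]) auto
    then show ?case using insert by (simp add: distrib_right wspan_add)
  qed
  \<comment> \<open>Elements act by left multiplication, and \<open>x\<close> and
    \<open>star x\<close> are treated together to make the case of \<open>star\<close> trivial. The
    element itself is recovered as \<open>x * \<iota> 1\<close>.\<close>
  have "(\<forall>w\<in>wspan G X. x * w \<in> wspan G X) \<and> (\<forall>w\<in>wspan G X. star x * w \<in> wspan G X)"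
    using x
  proof (induction rule: gen_star_alg.induct)
    case (base b)
    then show ?case by (auto simp: inc_star[symmetric] wspan_scale)
  next
    case gen
    then show ?case using sum[OF _ subset_refl G] star_sum[OF subset_refl G] by simp
  next
    case (add x y)
    then show ?case by (auto simp: star_add distrib_right wspan_add)
  next
    case (mult x y)
    then show ?case by (auto simp: star_mult mult.assoc)
  next
    case (scaleC x c)
    have "c *\<^sub>C x * w = \<iota> (c *\<^sub>C 1) * (x * w)" for c x w
      by (simp add: inc_scaleC inc_one mult_scaleC_left)
    then show ?case using scaleC by (simp add: star_scaleC wspan_scale)
  next
    case (star x)
    then show ?case by (simp add: star_star)
  qed
  then have "x * \<iota> 1 \<in> wspan G X" using wspan_inc by blast
  then show ?thesis by (simp add: inc_one)
qed

text \<open>At the seam the last index of the left word lies in \<open>G\<close> and the first index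
  of the right word in \<open>F'\<close>, so disjointness keeps the concatenation
  alternating.\<close>

lemma cspan_mult:
  assumes "G \<subseteq> I" "F' \<inter> G = {}" and x: "x \<in> cspan F G X" and y: "y \<in> cspan F' I X"
  shows "x * y \<in> cspan F I X"
  using x
proof (induction rule: cspan.induct)
  case zero
  show ?case by (simp add: cspan.zero)
next
  case (prod as x)
  from y have "prod_list (map snd as) * y \<in> cspan F I X"
  proof (induction rule: cspan.induct)
    case zero
    show ?case by (simp add: cspan.zero)
  next
    case (prod bs y)
    have ne: "as \<noteq> []" "bs \<noteq> []" using \<open>centred G X as\<close> prod(1) by (auto simp: centred_def)
    have "last as \<in> set as" using ne by simp
    then have "fst (last as) \<in> G" using \<open>centred G X as\<close> unfolding centred_def by fastforce
    then have "fst (last as) \<noteq> fst (hd bs)" using prod(2) assms(2) by auto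
    then have "centred I X (as @ bs)"
      using \<open>centred G X as\<close> prod(1) assms(1) ne unfolding centred_def
      by (auto simp: distinct_adj_append_iff last_map hd_map)
    from cspan_single[OF this, of F]
    have "prod_list (map snd as) * prod_list (map snd bs) \<in> cspan F I X"
      using \<open>fst (hd as) \<in> F\<close> ne by simp
    then show ?case using prod by (simp add: distrib_left cspan_add)
  qed
  then show ?case using prod by (simp add: distrib_right cspan_add)
qed

text \<open>An element of the algebra of one block with expectation 0 has no constant part, because
  \<open>E\<close> vanishes on alternating centred words. A product over alternating blocks is thus
  a sum of concatenations that are alternating and centred for the original family.\<close>

lemma free_over_sums:
  assumes free: "free_over \<iota> E I X"
    and G: "\<And>d. d \<in> D \<Longrightarrow> finite (G d) \<and> G d \<subseteq> I"
    and disj: "\<And>d d'. d \<in> D \<Longrightarrow> d' \<in> D \<Longrightarrow> d \<noteq> d' \<Longrightarrow> G d \<inter> G d' = {}"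
    and sa: "\<And>i. i \<in> I \<Longrightarrow> selfadjoint (X i)"
  shows "free_over \<iota> E D (\<lambda>d. \<Sum>i\<in>G d. X i)"
proof (rule free_overI)
  fix as assume as: "centred D (\<lambda>d. \<Sum>i\<in>G d. X i) as"
  have dec: "a \<in> cspan (G d) (G d) X"
    if "d \<in> D" "a \<in> gen_star_alg \<iota> (\<Sum>i\<in>G d. X i)" "E a = 0" for d a
  proof -
    have "a \<in> wspan (G d) X"
      using that G sa by (intro gen_star_alg_sum_wspan) auto
    then obtain b y where a: "a = \<iota> b + y" and y: "y \<in> cspan (G d) (G d) X"
      unfolding wspan_def by auto
    have "E y = 0"
      by (rule E_cspan[OF free cspan_mono[OF _ y]]) (use G that in auto)
    then have "b = 0" using that(3) by (simp add: a E_add E_inc)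
    then show ?thesis using y by (simp add: a inc_zero)
  qed
  from as have "prod_list (map snd as) \<in> cspan (G (fst (hd as))) I X"
  proof (induction as)
    case Nil
    then show ?case by (simp add: centred_def)
  next
    case (Cons da as)
    obtain d a where da: "da = (d, a)" by force
    have d: "d \<in> D" and a: "a \<in> cspan (G d) (G d) X"
      using Cons.prems dec unfolding centred_def da by auto
    show ?case
    proof (cases "as = []")
      case True
      have "a \<in> cspan (G d) I X" by (rule cspan_mono[OF _ a]) (use G d in auto)
      then show ?thesis using True by (simp add: da)
    next
      case False
      then have c: "centred D (\<lambda>d. \<Sum>i\<in>G d. X i) as"
        and ne: "d \<noteq> fst (hd as)" and hd: "fst (hd as) \<in> D"
        using Cons.prems unfolding centred_def da by (cases as; auto)+
      have "a * prod_list (map snd as) \<in> cspan (G d) I X"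
        by (rule cspan_mult[OF _ _ a Cons.IH[OF c]]) (use disj[OF hd d] ne G d in auto)
      then show ?thesis by (simp add: da)
    qed
  qed
  then show "E (prod_list (map snd as)) = 0" by (rule E_cspan[OF free])
qed

end

section \<open>Asymptotics of the mixed moments of a free array\<close>

text \<open>A colour carries the block of row indices that it ranges over, and a tag to have infinitely
  many colours for each block.\<close>

type_synonym block = "nat \<Rightarrow> nat set"
type_synonym colour = "block \<times> nat"

text \<open>Formal words, to be evaluated row by row: coefficient sequences, which may vary with the
  row; single variables, whose index is the value of a labelling at the colour; and whole block
  sums. Distinct colours are meant to receive distinct indices.\<close>

datatype 'b tok = TC "nat \<Rightarrow> 'b" | TV colour | TY block

definition cols :: "'b tok list \<Rightarrow> colour set" where "cols w = {c. TV c \<in> set w}"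
definition blocks :: "'b tok list \<Rightarrow> block set" where "blocks w = {H. TY H \<in> set w}"
definition conv_word :: "'b::real_normed_vector tok list \<Rightarrow> bool" where
  "conv_word w \<longleftrightarrow> (\<forall>b. TC b \<in> set w \<longrightarrow> convergent b)"

primrec is_letter :: "'b tok \<Rightarrow> bool" where
  "is_letter (TC b) = False" | "is_letter (TV c) = True" | "is_letter (TY H) = True"
primrec is_TY :: "'b tok \<Rightarrow> bool" where
  "is_TY (TC b) = False" | "is_TY (TV c) = False" | "is_TY (TY H) = True"

definition deg :: "'b tok list \<Rightarrow> nat" where "deg w = length (filter is_letter w)"
definition nY :: "'b tok list \<Rightarrow> nat" where "nY w = length (filter is_TY w)"

lemma cols_simps [simp]:
  "cols [] = {}" "cols (TC b # w) = cols w" "cols (TV c # w) = insert c (cols w)"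
  "cols (TY H # w) = cols w" "cols (u @ v) = cols u \<union> cols v"
  by (auto simp: cols_def)

lemma blocks_simps [simp]:
  "blocks [] = {}" "blocks (TC b # w) = blocks w" "blocks (TV c # w) = blocks w"
  "blocks (TY H # w) = insert H (blocks w)" "blocks (u @ v) = blocks u \<union> blocks v"
  by (auto simp: blocks_def)

lemma conv_word_simps [simp]:
  "conv_word []" "conv_word (TC b # w) \<longleftrightarrow> convergent b \<and> conv_word w"
  "conv_word (TV c # w) \<longleftrightarrow> conv_word w" "conv_word (TY H # w) \<longleftrightarrow> conv_word w"
  "conv_word (u @ v) \<longleftrightarrow> conv_word u \<and> conv_word v"
  by (auto simp: conv_word_def)

lemma deg_simps [simp]:
  "deg [] = 0" "deg (TC b # w) = deg w" "deg (TV c # w) = Suc (deg w)"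
  "deg (TY H # w) = Suc (deg w)" "deg (u @ v) = deg u + deg v"
  by (auto simp: deg_def)

lemma nY_simps [simp]:
  "nY [] = 0" "nY (TC b # w) = nY w" "nY (TV c # w) = nY w"
  "nY (TY H # w) = Suc (nY w)" "nY (u @ v) = nY u + nY v"
  by (auto simp: nY_def)

lemma finite_cols [simp]: "finite (cols w)"
proof (induction w)
  case (Cons t w) then show ?case by (cases t) auto
qed simp

lemma deg_pos: "cols w \<noteq> {} \<Longrightarrow> 0 < deg w"
proof (induction w)
  case (Cons t w) then show ?case by (cases t) auto
qed simp

lemma nY_0: "nY w = 0 \<longleftrightarrow> blocks w = {}"
proof (induction w)
  case (Cons t w) then show ?case by (cases t) auto
qed simp

lemma exists_fresh: "finite C \<Longrightarrow> \<exists>i. (H :: block, i :: nat) \<notin> C"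
proof -
  assume "finite C"
  then have "finite (snd ` C)" by simp
  then obtain i where "i \<notin> snd ` C" using ex_new_if_finite[OF infinite_UNIV_nat] by blast
  then show ?thesis by force
qed

text \<open>A coefficient joins the run on its right; those after the last letter stay in the last
  run.\<close>

lemma runs_exist:
  assumes "blocks w = {}" "cols w \<noteq> {}"
  shows "\<exists>rs. concat (map snd rs) = w \<and> distinct_adj (map fst rs) \<and>
    (\<forall>(c, r)\<in>set rs. cols r = {c})"
  using assms
proof (induction w)
  case (Cons t w)
  show ?case
  proof (cases "cols w = {}")
    case True
    then obtain c where "t = TV c" using Cons.prems by (cases t) auto
    then show ?thesis using True by (intro exI[of _ "[(c, t # w)]"]) simp
  next
    case False
    then obtain rs where rs: "concat (map snd rs) = w" "distinct_adj (map fst rs)"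
      "\<forall>(c, r)\<in>set rs. cols r = {c}"
      using Cons by (cases t) auto
    then obtain d r rs' where rs': "rs = (d, r) # rs'"
      using False by (cases rs) auto
    show ?thesis
    proof (cases t)
      case (TC b)
      then show ?thesis using rs by (intro exI[of _ "(d, t # r) # rs'"]) (auto simp: rs' distinct_adj_Cons)
    next
      case (TV c)
      show ?thesis
      proof (cases "c = d")
        case True
        then show ?thesis
          using rs TV by (intro exI[of _ "(d, t # r) # rs'"]) (auto simp: rs' distinct_adj_Cons)
      next
        case False
        then show ?thesis using rs TV by (intro exI[of _ "(c, [t]) # rs"]) (auto simp: rs')
      qed
    next
      case (TY H)
      then show ?thesis using Cons.prems by simp
    qed
  qed
qed simp

section \<open>Scaled expectations of words with distinct letters\<close>

locale array = cond_exp \<iota> E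
  for \<iota> :: "'b::cstar_algebra \<Rightarrow> 'a::cstar_algebra" and E :: "'a \<Rightarrow> 'b" +
  fixes k :: "nat \<Rightarrow> nat" and X :: "nat \<Rightarrow> nat \<Rightarrow> 'a"
  assumes k_lim: "filterlim k at_top sequentially"
    and free: "free_over \<iota> E {(j, l). 1 \<le> l \<and> l \<le> k j} (\<lambda>(j, l). X j l)"
    and ident: "\<And>j l m. 1 \<le> l \<Longrightarrow> l \<le> k j \<Longrightarrow> 1 \<le> m \<Longrightarrow> m \<le> k j \<Longrightarrow>
           distr_of \<iota> E (X j l) = distr_of \<iota> E (X j m)"
begin

primrec tokv :: "nat \<Rightarrow> (colour \<Rightarrow> nat) \<Rightarrow> 'b tok \<Rightarrow> 'a" where
  "tokv j \<sigma> (TC b) = \<iota> (b j)"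
| "tokv j \<sigma> (TV c) = X j (\<sigma> c)"
| "tokv j \<sigma> (TY H) = (\<Sum>l\<in>H j. X j l)"

definition val :: "nat \<Rightarrow> (colour \<Rightarrow> nat) \<Rightarrow> 'b tok list \<Rightarrow> 'a" where
  "val j \<sigma> w = prod_list (map (tokv j \<sigma>) w)"

lemma val_simps [simp]:
  "val j \<sigma> [] = 1" "val j \<sigma> (t # w) = tokv j \<sigma> t * val j \<sigma> w"
  "val j \<sigma> (u @ v) = val j \<sigma> u * val j \<sigma> v"
  by (simp_all add: val_def)

lemma val_cong: "(\<And>c. c \<in> cols w \<Longrightarrow> \<sigma> c = \<tau> c) \<Longrightarrow> val j \<sigma> w = val j \<tau> w"
proof (induction w)
  case (Cons t w) then show ?case by (cases t) auto
qed simp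

lemma k_pos: "\<forall>\<^sub>F j in sequentially. 0 < k j"
  using filterlim_at_top[THEN iffD1, OF k_lim, rule_format, of 1] by (simp add: Suc_le_eq)

lemma inverse_k: "(\<lambda>j. inverse (real (k j))) \<longlonglongrightarrow> 0"
  by (rule tendsto_inverse_0_at_top) (rule filterlim_compose[OF filterlim_real_sequentially k_lim])

definition valid :: "nat \<Rightarrow> colour set \<Rightarrow> (colour \<Rightarrow> nat) \<Rightarrow> bool" where
  "valid j C \<sigma> \<longleftrightarrow> inj_on \<sigma> C \<and> \<sigma> ` C \<subseteq> {1..k j}"

text \<open>Two claims at once: the value does not depend on which distinct indices the colours
  receive, and it converges after rescaling by one factor \<open>k j\<close> per colour. It is
  stated for arbitrary \<open>v\<close> because products with centred runs are treated like
  words.\<close>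

definition good :: "colour set \<Rightarrow> (nat \<Rightarrow> (colour \<Rightarrow> nat) \<Rightarrow> 'b) \<Rightarrow> bool" where
  "good C v \<longleftrightarrow> (\<exists>t. (\<forall>j \<sigma>. valid j C \<sigma> \<longrightarrow> v j \<sigma> = t j) \<and>
     convergent (\<lambda>j. real (k j) ^ card C *\<^sub>R t j))"

lemma valid_mono: "valid j C \<sigma> \<Longrightarrow> C' \<subseteq> C \<Longrightarrow> valid j C' \<sigma>"
  unfolding valid_def by (auto intro: inj_on_subset)

lemma valid_k_pos: "valid j C \<sigma> \<Longrightarrow> C \<noteq> {} \<Longrightarrow> 0 < k j"
  unfolding valid_def by fastforce

lemma good_cong:
  assumes "good C u" and eq: "\<And>j \<sigma>. valid j C \<sigma> \<Longrightarrow> u j \<sigma> = v j \<sigma>"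
  shows "good C v"
proof -
  obtain t where "\<forall>j \<sigma>. valid j C \<sigma> \<longrightarrow> u j \<sigma> = t j"
    and "convergent (\<lambda>j. real (k j) ^ card C *\<^sub>R t j)"
    using assms(1) unfolding good_def by blast
  then show ?thesis unfolding good_def by (intro exI[of _ t]) (simp add: eq[symmetric])
qed

lemma good_zero: "(\<And>j \<sigma>. valid j C \<sigma> \<Longrightarrow> v j \<sigma> = 0) \<Longrightarrow> good C v"
  unfolding good_def by (intro exI[of _ "\<lambda>_. 0"]) (simp add: convergent_const)

lemma good_add:
  assumes "good C u" "good C v" shows "good C (\<lambda>j \<sigma>. u j \<sigma> + v j \<sigma>)"
proof -
  obtain s where "\<forall>j \<sigma>. valid j C \<sigma> \<longrightarrow> u j \<sigma> = s j"
    "convergent (\<lambda>j. real (k j) ^ card C *\<^sub>R s j)"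
    using assms(1) unfolding good_def by blast
  moreover obtain t where "\<forall>j \<sigma>. valid j C \<sigma> \<longrightarrow> v j \<sigma> = t j"
    "convergent (\<lambda>j. real (k j) ^ card C *\<^sub>R t j)"
    using assms(2) unfolding good_def by blast
  ultimately show ?thesis unfolding good_def
    by (intro exI[of _ "\<lambda>j. s j + t j"]) (simp add: scaleR_add_right convergent_add)
qed

lemma good_minus:
  assumes "good C u" shows "good C (\<lambda>j \<sigma>. - u j \<sigma>)"
proof -
  obtain s where "\<forall>j \<sigma>. valid j C \<sigma> \<longrightarrow> u j \<sigma> = s j"
    and "convergent (\<lambda>j. real (k j) ^ card C *\<^sub>R s j)"
    using assms unfolding good_def by blast
  then show ?thesis unfolding good_def
    by (intro exI[of _ "\<lambda>j. - s j"]) (simp add: convergent_minus_iff[symmetric])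
qed

lemma good_diff: "good C u \<Longrightarrow> good C v \<Longrightarrow> good C (\<lambda>j \<sigma>. u j \<sigma> - v j \<sigma>)"
  using good_add[OF _ good_minus, of C u v] by simp

text \<open>If a colour has disappeared, \<open>1 / k j\<close> supplies the missing power; if none
  has, the rescaled quantity tends to 0.\<close>

lemma good_divide:
  assumes "good C' v" "finite C" "C' \<subseteq> C" "card C \<le> Suc (card C')"
  shows "good C (\<lambda>j \<sigma>. inverse (real (k j)) *\<^sub>R v j \<sigma>)"
proof -
  obtain t where t: "\<forall>j \<sigma>. valid j C' \<sigma> \<longrightarrow> v j \<sigma> = t j"
    and conv: "convergent (\<lambda>j. real (k j) ^ card C' *\<^sub>R t j)"
    using assms(1) unfolding good_def by blast
  have "card C' \<le> card C" using assms by (simp add: card_mono)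
  then consider "card C = Suc (card C')" | "card C = card C'" using assms(4) by linarith
  then have "convergent (\<lambda>j. real (k j) ^ card C *\<^sub>R (inverse (real (k j)) *\<^sub>R t j))"
  proof cases
    case 1
    have "\<forall>\<^sub>F j in sequentially. real (k j) ^ card C' *\<^sub>R t j =
        real (k j) ^ card C *\<^sub>R (inverse (real (k j)) *\<^sub>R t j)"
      using k_pos by eventually_elim (simp add: 1)
    from convergent_cong[OF this] conv show ?thesis by simp
  next
    case 2
    obtain l where "(\<lambda>j. real (k j) ^ card C' *\<^sub>R t j) \<longlonglongrightarrow> l"
      using conv unfolding convergent_def by blast
    from tendsto_scaleR[OF inverse_k this] show ?thesis
      unfolding convergent_def by (intro exI[of _ 0]) (simp add: 2 mult.commute)
  qed
  then show ?thesis
    using t valid_mono[OF _ assms(3)] unfolding good_def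
    by (intro exI[of _ "\<lambda>j. inverse (real (k j)) *\<^sub>R t j"]) metis
qed

definition vgood :: "'b tok list \<Rightarrow> bool" where
  "vgood w \<longleftrightarrow> good (cols w) (\<lambda>j \<sigma>. E (val j \<sigma> w))"

definition run :: "colour \<times> 'b tok list \<times> (nat \<Rightarrow> 'b) \<Rightarrow> bool" where
  "run r = (case r of (c, w, t) \<Rightarrow> cols w = {c} \<and> blocks w = {} \<and> conv_word w \<and>
     (\<forall>j \<sigma>. valid j {c} \<sigma> \<longrightarrow> E (val j \<sigma> w) = t j) \<and> convergent (\<lambda>j. real (k j) *\<^sub>R t j))"

definition cprod :: "nat \<Rightarrow> (colour \<Rightarrow> nat) \<Rightarrow> (colour \<times> 'b tok list \<times> (nat \<Rightarrow> 'b)) list \<Rightarrow> 'a" where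
  "cprod j \<sigma> rs = prod_list (map (\<lambda>(c, w, t). val j \<sigma> w - \<iota> (t j)) rs)"

definition rdeg :: "(colour \<times> 'b tok list \<times> (nat \<Rightarrow> 'b)) list \<Rightarrow> nat" where
  "rdeg rs = sum_list (map (\<lambda>(c, w, t). deg w) rs)"

lemma cprod_simps [simp]: "cprod j \<sigma> [] = 1"
  "cprod j \<sigma> ((c, w, t) # rs) = (val j \<sigma> w - \<iota> (t j)) * cprod j \<sigma> rs"
  by (simp_all add: cprod_def)

lemma rdeg_simps [simp]: "rdeg [] = 0" "rdeg ((c, w, t) # rs) = deg w + rdeg rs"
  by (simp_all add: rdeg_def)

text \<open>Centring a run of letters of one colour replaces it by its expectation \<open>t\<close>. As \<open>k\<^sub>j t\<^sub>j\<close> converges it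
  is admissible as a coefficient, and the factor \<open>1 / k\<^sub>j\<close> makes up for the colour that may get lost.\<close>

lemma scaled_const:
  assumes "valid j C \<sigma>" "C \<noteq> {}"
  shows "E (val j \<sigma> u * \<iota> (t j) * z) =
    inverse (real (k j)) *\<^sub>R E (val j \<sigma> (u @ [TC (\<lambda>j. real (k j) *\<^sub>R t j)]) * z)"
proof -
  have sc: "\<iota> (r *\<^sub>R b) = complex_of_real r *\<^sub>C \<iota> b" for r b
    by (simp add: scaleR_eq_scaleC inc_scaleC)
  have "k j \<noteq> 0" using valid_k_pos[OF assms] by simp
  then show ?thesis
    by (simp add: sc mult_scaleC_left mult_scaleC_right E_scaleC scaleR_eq_scaleC scaleC_scaleC
        scaleC_one inc_scaleC)
qed

text \<open>Expanding the first factor \<open>val j \<sigma> w - \<iota> (t j)\<close> appends to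
  the prefix \<open>u\<close> either \<open>w\<close> or the coefficient
  \<open>k\<^sub>j t\<^sub>j\<close>, the latter with a factor \<open>1 / k\<^sub>j\<close>. In the
  end only words of degree below \<open>m\<close> remain.\<close>

lemma good_cprod:
  assumes IH: "\<And>w. deg w < m \<Longrightarrow> conv_word w \<Longrightarrow> blocks w = {} \<Longrightarrow> vgood w"
    and "list_all (run) rs" "conv_word u" "blocks u = {}" "deg u + rdeg rs < m"
  shows "good (cols u \<union> fst ` set rs) (\<lambda>j \<sigma>. E (val j \<sigma> u * cprod j \<sigma> rs))"
  using assms(2-)
proof (induction rs arbitrary: u)
  case Nil
  then show ?case using IH[of u] by (simp add: vgood_def)
next
  case (Cons r rs)
  obtain c w t where r: "r = (c, w, t)" by (cases r)
  have w: "cols w = {c}" "blocks w = {}" "conv_word w"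
    and t: "convergent (\<lambda>j. real (k j) *\<^sub>R t j)"
    using Cons.prems by (auto simp: run_def r)
  let ?u' = "u @ [TC (\<lambda>j. real (k j) *\<^sub>R t j)]"
  let ?C = "cols u \<union> fst ` set (r # rs)"
  have "good (cols (u @ w) \<union> fst ` set rs) (\<lambda>j \<sigma>. E (val j \<sigma> (u @ w) * cprod j \<sigma> rs))"
    by (rule Cons.IH) (use Cons.prems w r in auto)
  then have 1: "good ?C (\<lambda>j \<sigma>. E (val j \<sigma> (u @ w) * cprod j \<sigma> rs))"
    by (simp add: w r insert_commute)
  have "good (cols ?u' \<union> fst ` set rs) (\<lambda>j \<sigma>. E (val j \<sigma> ?u' * cprod j \<sigma> rs))"
    by (rule Cons.IH) (use Cons.prems t r in auto)
  then have "good ?C (\<lambda>j \<sigma>. inverse (real (k j)) *\<^sub>R E (val j \<sigma> ?u' * cprod j \<sigma> rs))"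
    by (rule good_divide) (auto simp: r card_insert_le_m1 card_insert_if)
  from good_diff[OF 1 this] show ?case
  proof (rule good_cong)
    fix j \<sigma> assume v: "valid j ?C \<sigma>"
    note sc = scaled_const[OF v, where u = u and t = t and z = "cprod j \<sigma> rs"]
    have "E (val j \<sigma> u * cprod j \<sigma> (r # rs)) =
        E (val j \<sigma> (u @ w) * cprod j \<sigma> rs) - E (val j \<sigma> u * \<iota> (t j) * cprod j \<sigma> rs)"
      by (simp add: r algebra_simps flip: E_diff)
    then show "E (val j \<sigma> (u @ w) * cprod j \<sigma> rs) - inverse (real (k j)) *\<^sub>R E (val j \<sigma> ?u' * cprod j \<sigma> rs) =
      E (val j \<sigma> u * cprod j \<sigma> (r # rs))"
      using sc by simp
  qed
qed

text \<open>The same expansion in total degree \<open>m\<close>. All terms other than the uncentred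
  word have lost the letters of some run and fall under \<open>good_cprod\<close>, so goodness of
  the centred product carries over to the word.\<close>

lemma vgood_of_cprod:
  assumes IH: "\<And>w. deg w < m \<Longrightarrow> conv_word w \<Longrightarrow> blocks w = {} \<Longrightarrow> vgood w"
    and "list_all (run) rs" "conv_word u" "blocks u = {}" "deg u + rdeg rs = m"
    and "good (cols u \<union> fst ` set rs) (\<lambda>j \<sigma>. E (val j \<sigma> u * cprod j \<sigma> rs))"
  shows "vgood (u @ concat (map (fst \<circ> snd) rs))"
  using assms(2-)
proof (induction rs arbitrary: u)
  case Nil
  then show ?case by (simp add: vgood_def)
next
  case (Cons r rs)
  obtain c w t where r: "r = (c, w, t)" by (cases r)
  have w: "cols w = {c}" "blocks w = {}" "conv_word w"
    and t: "convergent (\<lambda>j. real (k j) *\<^sub>R t j)"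
    using Cons.prems by (auto simp: run_def r)
  let ?u' = "u @ [TC (\<lambda>j. real (k j) *\<^sub>R t j)]"
  let ?C = "cols u \<union> fst ` set (r # rs)"
  have "good (cols ?u' \<union> fst ` set rs) (\<lambda>j \<sigma>. E (val j \<sigma> ?u' * cprod j \<sigma> rs))"
    by (rule good_cprod[OF IH]) (use Cons.prems t r w deg_pos[of w] in auto)
  then have "good ?C (\<lambda>j \<sigma>. inverse (real (k j)) *\<^sub>R E (val j \<sigma> ?u' * cprod j \<sigma> rs))"
    by (rule good_divide) (auto simp: r card_insert_le_m1 card_insert_if)
  from good_add[OF Cons.prems(5) this]
  have "good ?C (\<lambda>j \<sigma>. E (val j \<sigma> (u @ w) * cprod j \<sigma> rs))"
  proof (rule good_cong)
    fix j \<sigma> assume v: "valid j ?C \<sigma>"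
    note sc = scaled_const[OF v, where u = u and t = t and z = "cprod j \<sigma> rs"]
    have "E (val j \<sigma> u * cprod j \<sigma> (r # rs)) =
        E (val j \<sigma> (u @ w) * cprod j \<sigma> rs) - E (val j \<sigma> u * \<iota> (t j) * cprod j \<sigma> rs)"
      by (simp add: r algebra_simps flip: E_diff)
    then show "E (val j \<sigma> u * cprod j \<sigma> (r # rs)) + inverse (real (k j)) *\<^sub>R E (val j \<sigma> ?u' * cprod j \<sigma> rs) =
      E (val j \<sigma> (u @ w) * cprod j \<sigma> rs)"
      using sc by simp
  qed
  then have "good (cols (u @ w) \<union> fst ` set rs) (\<lambda>j \<sigma>. E (val j \<sigma> (u @ w) * cprod j \<sigma> rs))"
    by (simp add: w r insert_commute)
  then have "vgood ((u @ w) @ concat (map (fst \<circ> snd) rs))"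
    by (intro Cons.IH) (use Cons.prems w r in auto)
  then show ?case by (simp add: r comp_def)
qed

lemma val_gen_star_alg:
  assumes "blocks w = {}" "cols w \<subseteq> {c}"
  shows "val j \<sigma> w \<in> gen_star_alg \<iota> (X j (\<sigma> c))"
  using assms
proof (induction w)
  case Nil
  then show ?case using gen_star_alg.base[of \<iota> 1] by (simp add: inc_one)
next
  case (Cons t w)
  then show ?case by (cases t) (auto intro: gen_star_alg.intros)
qed

text \<open>An injective labelling sends adjacent runs, whose colours differ, to different variables
  of the row, so freeness applies.\<close>

lemma E_cprod_zero:
  assumes "list_all (run) rs" "distinct_adj (map fst rs)" "rs \<noteq> []" "valid j (fst ` set rs) \<sigma>"
  shows "E (cprod j \<sigma> rs) = 0"
proof -
  define as where "as = map (\<lambda>(c, w, t). ((j, \<sigma> c), val j \<sigma> w - \<iota> (t j))) rs"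
  have "centred {(j, l). 1 \<le> l \<and> l \<le> k j} (\<lambda>(j, l). X j l) as"
    unfolding centred_def
  proof (intro conjI ballI)
    show "as \<noteq> []" using assms by (simp add: as_def)
    have "map fst as = map (\<lambda>c. (j, \<sigma> c)) (map fst rs)"
      by (simp add: as_def case_prod_unfold)
    moreover have "inj_on (\<lambda>c. (j, \<sigma> c)) (set (map fst rs))"
      using assms(4) unfolding valid_def inj_on_def by auto
    ultimately show "distinct_adj (map fst as)"
      using assms(2) distinct_adj_mapI by metis
    fix x assume "x \<in> set as"
    then obtain c w t where x: "x = ((j, \<sigma> c), val j \<sigma> w - \<iota> (t j))" and r: "(c, w, t) \<in> set rs"
      unfolding as_def by auto
    have "run (c, w, t)" using assms(1) r by (auto simp: list_all_iff)
    moreover have v: "valid j {c} \<sigma>"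
      by (rule valid_mono[OF assms(4)]) (use r in force)
    ultimately show "case x of (i, a) \<Rightarrow> i \<in> {(j, l). 1 \<le> l \<and> l \<le> k j} \<and>
        a \<in> gen_star_alg \<iota> (case i of (j, l) \<Rightarrow> X j l) \<and> E a = 0"
      unfolding x run_def
      by (auto simp: E_diff E_inc valid_def intro!: gen_star_alg_diff gen_star_alg.base val_gen_star_alg)
  qed
  from free_over_list[OF free this] show ?thesis
    by (simp add: as_def cprod_def comp_def case_prod_unfold)
qed

text \<open>With two or more colours, some letter lies outside any given run. Every run thus has
  degree below \<open>m\<close>, and the induction hypothesis provides its expectation sequence. The
  product of the centred runs has expectation 0, which \<open>vgood_of_cprod\<close> turns into
  goodness of the word.\<close>

lemma vgood_multi:
  assumes IH: "\<And>w. deg w < m \<Longrightarrow> conv_word w \<Longrightarrow> blocks w = {} \<Longrightarrow> vgood w"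
    and w: "conv_word w" "blocks w = {}" "deg w = m" "2 \<le> card (cols w)"
  shows "vgood w"
proof -
  obtain rs0 where rs0: "concat (map snd rs0) = w" "distinct_adj (map fst rs0)"
    "\<forall>(c, r)\<in>set rs0. cols r = {c}"
    using runs_exist[OF w(2)] w(4) by fastforce
  have sub: "conv_word r \<and> blocks r = {}" if r: "(c, r) \<in> set rs0" for c r
  proof -
    obtain xs ys where "rs0 = xs @ (c, r) # ys" using split_list[OF r] by blast
    then have "w = concat (map snd xs) @ r @ concat (map snd ys)" using rs0(1) by simp
    then show ?thesis using w by simp
  qed
  have cw: "cols (concat (map snd rs)) = fst ` set rs" if "\<forall>(c, r)\<in>set rs. cols r = {c}"
    for rs :: "(colour \<times> 'b tok list) list"
    using that by (induction rs) auto
  have dl: "deg r < m" if mem: "(c, r) \<in> set rs0" for c r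
  proof -
    obtain xs ys where xy: "rs0 = xs @ (c, r) # ys" using split_list[OF mem] by blast
    then have weq: "w = concat (map snd xs) @ r @ concat (map snd ys)" using rs0(1) by simp
    have r: "cols r = {c}" using rs0(3) mem by auto
    have "cols (concat (map snd xs) @ concat (map snd ys)) \<noteq> {}"
    proof
      assume "cols (concat (map snd xs) @ concat (map snd ys)) = {}"
      then have "cols w = {c}" using r by (simp add: weq)
      then show False using w(4) by simp
    qed
    from deg_pos[OF this] show ?thesis using w(3) by (auto simp: weq)
  qed
  define T where "T r = (SOME t. (\<forall>j \<sigma>. valid j (cols r) \<sigma> \<longrightarrow> E (val j \<sigma> r) = t j) \<and>
     convergent (\<lambda>j. real (k j) ^ card (cols r) *\<^sub>R t j))" for r
  have T: "(\<forall>j \<sigma>. valid j (cols r) \<sigma> \<longrightarrow> E (val j \<sigma> r) = T r j) \<and>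
     convergent (\<lambda>j. real (k j) ^ card (cols r) *\<^sub>R T r j)" if "(c, r) \<in> set rs0" for c r
  proof -
    have "vgood r" using IH dl sub that by blast
    then show ?thesis unfolding vgood_def good_def T_def by (rule someI_ex)
  qed
  define rs where "rs = map (\<lambda>(c, r). (c, r, T r)) rs0"
  have run: "list_all (run) rs"
    unfolding list_all_iff
  proof
    fix x assume "x \<in> set rs"
    then obtain c r where x: "x = (c, r, T r)" and r: "(c, r) \<in> set rs0" unfolding rs_def by auto
    have "cols r = {c}" using rs0(3) r by auto
    then show "run x" using T[OF r] sub[OF r] by (simp add: x run_def)
  qed
  have fst_rs: "map fst rs = map fst rs0" and snd_rs: "map (fst \<circ> snd) rs = map snd rs0"
    by (simp_all add: rs_def case_prod_unfold)
  have ne: "rs \<noteq> []" using w(4) rs0(1) by (auto simp: rs_def)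
  have "deg (concat (map (fst \<circ> snd) rs)) = rdeg rs"
    by (induction rs) (auto simp: rdeg_def case_prod_unfold)
  then have rd: "rdeg rs = m" using w(3) rs0(1) by (simp add: snd_rs)
  have "vgood ([] @ concat (map (fst \<circ> snd) rs))"
    by (rule vgood_of_cprod[OF IH run])
      (use rd fst_rs rs0(2) in \<open>auto intro!: good_zero E_cprod_zero[OF run _ ne]\<close>)
  then show ?thesis using rs0(1) by (simp add: snd_rs)
qed

end

text \<open>Serves to merge all letters into one colour, or to turn all of them into row sums, with
  the coefficients left in place.\<close>

definition relabel :: "'b tok \<Rightarrow> 'b tok list \<Rightarrow> 'b tok list" where
  "relabel s w = map (\<lambda>t. if is_letter t then s else t) w"

lemma relabel_simps [simp]:
  "relabel s [] = []" "relabel s (TC b # w) = TC b # relabel s w" "relabel s (TV c # w) = s # relabel s w"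
  "relabel s (TY H # w) = s # relabel s w" "relabel s (u @ v) = relabel s u @ relabel s v"
  by (simp_all add: relabel_def)

lemma relabel_relabel: "is_letter s' \<Longrightarrow> relabel s (relabel s' w) = relabel s w"
  by (simp add: relabel_def)

lemma conv_word_relabel: "is_letter s \<Longrightarrow> conv_word w \<Longrightarrow> conv_word (relabel s w)"
  by (auto simp: relabel_def conv_word_def split: if_splits)

lemma deg_relabel: "is_letter s \<Longrightarrow> deg (relabel s w) = deg w"
proof (induction w)
  case (Cons t w) then show ?case by (cases t; cases s) auto
qed simp

lemma relabel_TV [simp]:
  "blocks (relabel (TV c) w) = {}" "cols (relabel (TV c) w) = (if deg w = 0 then {} else {c})"
proof (induction w)
  case (Cons t w) { case 1 with Cons show ?case by (cases t) auto next case 2 with Cons show ?case by (cases t) auto }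
qed auto

lemma relabel_TY [simp]:
  "cols (relabel (TY H) w) = {}" "blocks (relabel (TY H) w) = (if deg w = 0 then {} else {H})"
proof (induction w)
  case (Cons t w) { case 1 with Cons show ?case by (cases t) auto next case 2 with Cons show ?case by (cases t) auto }
qed auto

lemma relabel_TV_id: "blocks w = {} \<Longrightarrow> cols w \<subseteq> {c} \<Longrightarrow> relabel (TV c) w = w"
proof (induction w)
  case (Cons t w) then show ?case by (cases t) auto
qed simp

lemma split_TY: "0 < nY w \<Longrightarrow> \<exists>u H v. w = u @ TY H # v"
proof (induction w)
  case (Cons t w)
  show ?case
  proof (cases "is_TY t")
    case True
    then obtain H where "t = TY H" by (cases t) auto
    then show ?thesis by (intro exI[of _ "[]"]) simp
  next
    case False
    then have "0 < nY w" using Cons.prems by (cases t) auto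
    then obtain u H v where "w = u @ TY H # v" using Cons.IH by blast
    then show ?thesis by (intro exI[of _ "t # u"]) simp
  qed
qed simp

section \<open>Expansion of block sums over injective labellings\<close>

context array
begin

text \<open>Extensional functions, so that each labelling is counted once. Without colours the only
  labelling is \<open>\<lambda>_. undefined\<close>, which is why words without single letters are
  evaluated there.\<close>

definition Inj :: "nat \<Rightarrow> colour set \<Rightarrow> (colour \<Rightarrow> nat) set" where
  "Inj j C = {\<sigma> \<in> PiE C (\<lambda>c. fst c j). inj_on \<sigma> C}"

definition F :: "colour set \<Rightarrow> nat \<Rightarrow> 'b tok list \<Rightarrow> 'b" where
  "F C j w = (\<Sum>\<sigma>\<in>Inj j C. E (val j \<sigma> w))"

definition block_system :: "block set \<Rightarrow> bool" where
  "block_system B \<longleftrightarrow> (\<forall>H\<in>B. (\<forall>j. H j \<subseteq> {1..k j}) \<and> convergent (\<lambda>j. real (card (H j)) / real (k j))) \<and>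
     (\<forall>H\<in>B. \<forall>H'\<in>B. H \<noteq> H' \<longrightarrow> (\<forall>j. H j \<inter> H' j = {}))"

lemma block_system_finite: "block_system B \<Longrightarrow> H \<in> B \<Longrightarrow> finite (H j)"
  unfolding block_system_def by (meson finite_atLeastAtMost finite_subset)

lemma Inj_empty: "Inj j {} = {\<lambda>_. undefined}"
  by (auto simp: Inj_def)

lemma finite_Inj: "finite C \<Longrightarrow> (\<And>c. c \<in> C \<Longrightarrow> finite (fst c j)) \<Longrightarrow> finite (Inj j C)"
  unfolding Inj_def by (simp add: finite_PiE)

lemma sum_Inj_insert:
  fixes f :: "(colour \<Rightarrow> nat) \<Rightarrow> 'd::comm_monoid_add"
  assumes "finite C" "c \<notin> C" "\<And>c'. c' \<in> insert c C \<Longrightarrow> finite (fst c' j)"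
  shows "(\<Sum>\<tau>\<in>Inj j (insert c C). f \<tau>) = (\<Sum>\<sigma>\<in>Inj j C. \<Sum>l\<in>fst c j - \<sigma> ` C. f (\<sigma>(c := l)))"
proof -
  have upd: "(\<tau>(c := l)) ` C = \<tau> ` C" for \<tau> and l :: nat
    using assms(2) by auto
  have "(\<Sum>\<sigma>\<in>Inj j C. \<Sum>l\<in>fst c j - \<sigma> ` C. f (\<sigma>(c := l))) =
      (\<Sum>(\<sigma>, l)\<in>(SIGMA \<sigma>:Inj j C. fst c j - \<sigma> ` C). f (\<sigma>(c := l)))"
    using assms by (intro sum.Sigma finite_Inj ballI) auto
  also have "\<dots> = (\<Sum>\<tau>\<in>Inj j (insert c C). f \<tau>)"
  proof (rule sum.reindex_bij_witness[where j = "\<lambda>(\<sigma>, l). \<sigma>(c := l)"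
        and i = "\<lambda>\<tau>. (\<tau>(c := undefined), \<tau> c)"])
    fix a assume "a \<in> (SIGMA \<sigma>:Inj j C. fst c j - \<sigma> ` C)"
    then obtain \<sigma> l where a: "a = (\<sigma>, l)" and \<sigma>: "\<sigma> \<in> PiE C (\<lambda>c. fst c j)" "inj_on \<sigma> C"
      and l: "l \<in> fst c j" "l \<notin> \<sigma> ` C"
      unfolding Inj_def by auto
    have "\<sigma> c = undefined" by (rule PiE_arb[OF \<sigma>(1) assms(2)])
    then show "((case a of (\<sigma>, l) \<Rightarrow> \<sigma>(c := l))(c := undefined), (case a of (\<sigma>, l) \<Rightarrow> \<sigma>(c := l)) c) = a"
      by (auto simp: a)
    have "inj_on (\<sigma>(c := l)) (insert c C)"
      using \<sigma>(2) l(2) assms(2) by (auto simp: inj_on_def)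
    moreover have "\<sigma>(c := l) \<in> PiE (insert c C) (\<lambda>c. fst c j)"
      using \<sigma>(1) l(1) by (auto simp: PiE_iff extensional_def)
    ultimately show "(case a of (\<sigma>, l) \<Rightarrow> \<sigma>(c := l)) \<in> Inj j (insert c C)"
      unfolding Inj_def a by simp
  next
    fix \<tau> assume "\<tau> \<in> Inj j (insert c C)"
    then have \<tau>: "\<tau> \<in> PiE (insert c C) (\<lambda>c. fst c j)" "inj_on \<tau> (insert c C)"
      unfolding Inj_def by auto
    show "(case (\<tau>(c := undefined), \<tau> c) of (\<sigma>, l) \<Rightarrow> \<sigma>(c := l)) = \<tau>" by auto
    have "\<tau>(c := undefined) \<in> PiE C (\<lambda>c. fst c j)"
      using \<tau>(1) assms(2) by (auto simp: PiE_iff extensional_def)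
    moreover have "inj_on (\<tau>(c := undefined)) C"
      using \<tau>(2) assms(2) by (auto simp: inj_on_def)
    moreover have "\<tau> c \<in> fst c j - (\<tau>(c := undefined)) ` C"
      unfolding upd using \<tau> assms(2) by (auto simp: inj_on_def PiE_iff)
    ultimately show "(\<tau>(c := undefined), \<tau> c) \<in> (SIGMA \<sigma>:Inj j C. fst c j - \<sigma> ` C)"
      unfolding Inj_def by auto
  qed auto
  finally show ?thesis by simp
qed

lemma sum_block_split:
  fixes f :: "nat \<Rightarrow> 'd::comm_monoid_add"
  assumes "finite C" "\<sigma> \<in> Inj j C" "finite (H j)"
    and disj: "\<And>c. c \<in> C \<Longrightarrow> fst c = H \<or> fst c j \<inter> H j = {}"
  shows "(\<Sum>l\<in>H j. f l) = (\<Sum>c\<in>{c\<in>C. fst c = H}. f (\<sigma> c)) + (\<Sum>l\<in>H j - \<sigma> ` C. f l)"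
proof -
  have \<sigma>: "\<sigma> c \<in> fst c j" if "c \<in> C" for c
    using assms(2) that unfolding Inj_def by (auto simp: PiE_iff)
  have inj: "inj_on \<sigma> C" using assms(2) unfolding Inj_def by simp
  have "H j = \<sigma> ` {c\<in>C. fst c = H} \<union> (H j - \<sigma> ` C)"
    using \<sigma> disj by fastforce
  then have "(\<Sum>l\<in>H j. f l) = (\<Sum>l\<in>\<sigma> ` {c\<in>C. fst c = H} \<union> (H j - \<sigma> ` C). f l)"
    by simp
  also have "\<dots> = (\<Sum>l\<in>\<sigma> ` {c\<in>C. fst c = H}. f l) + (\<Sum>l\<in>H j - \<sigma> ` C. f l)"
    using assms by (intro sum.union_disjoint) auto
  also have "(\<Sum>l\<in>\<sigma> ` {c\<in>C. fst c = H}. f l) = (\<Sum>c\<in>{c\<in>C. fst c = H}. f (\<sigma> c))"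
    using inj by (subst sum.reindex) (auto intro: inj_on_subset)
  finally show ?thesis .
qed

text \<open>The index chosen in a block sum either repeats that of a colour attached to
  \<open>H\<close> or is new, and then the fresh colour \<open>(H, i)\<close> names it. Disjointness
  of the blocks excludes coincidences with colours of other blocks.\<close>

lemma F_step:
  assumes B: "block_system B" and H: "H \<in> B" and C: "finite C" "fst ` C \<subseteq> B"
    and c': "(H, i) \<notin> C" and uv: "cols u \<subseteq> C" "cols v \<subseteq> C"
  shows "F C j (u @ TY H # v) =
    (\<Sum>c\<in>{c\<in>C. fst c = H}. F C j (u @ TV c # v)) + F (insert (H, i) C) j (u @ TV (H, i) # v)"
proof -
  have fin: "finite (fst c j)" if "c \<in> insert (H, i) C" for c
    using that C H block_system_finite[OF B] by auto
  have disj: "fst c = H \<or> fst c j \<inter> H j = {}" if "c \<in> C" for c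
  proof -
    have "fst c \<in> B" using that C(2) by auto
    then show ?thesis using B H unfolding block_system_def by blast
  qed
  have 1: "E (val j \<sigma> (u @ TY H # v)) = (\<Sum>c\<in>{c\<in>C. fst c = H}. E (val j \<sigma> (u @ TV c # v))) +
      (\<Sum>l\<in>H j - \<sigma> ` C. E (val j (\<sigma>((H, i) := l)) (u @ TV (H, i) # v)))" if \<sigma>: "\<sigma> \<in> Inj j C" for \<sigma>
  proof -
    have cong: "val j (\<sigma>((H, i) := l)) w = val j \<sigma> w" if "cols w \<subseteq> C" for w l
      using that c' by (intro val_cong) auto
    have "E (val j \<sigma> (u @ TY H # v)) = (\<Sum>l\<in>H j. E (val j \<sigma> u * (X j l * val j \<sigma> v)))"
      by (simp add: E_sum[symmetric] sum_distrib_left sum_distrib_right)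
    also have "\<dots> = (\<Sum>c\<in>{c\<in>C. fst c = H}. E (val j \<sigma> u * (X j (\<sigma> c) * val j \<sigma> v))) +
        (\<Sum>l\<in>H j - \<sigma> ` C. E (val j \<sigma> u * (X j l * val j \<sigma> v)))"
      by (rule sum_block_split) (use C \<sigma> H disj block_system_finite[OF B] in auto)
    finally show ?thesis by (simp add: cong[OF uv(1)] cong[OF uv(2)])
  qed
  have "F C j (u @ TY H # v) =
      (\<Sum>\<sigma>\<in>Inj j C. (\<Sum>c\<in>{c\<in>C. fst c = H}. E (val j \<sigma> (u @ TV c # v))) +
        (\<Sum>l\<in>H j - \<sigma> ` C. E (val j (\<sigma>((H, i) := l)) (u @ TV (H, i) # v))))"
    unfolding F_def by (rule sum.cong[OF HOL.refl]) (rule 1)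
  also have "\<dots> = (\<Sum>\<sigma>\<in>Inj j C. \<Sum>c\<in>{c\<in>C. fst c = H}. E (val j \<sigma> (u @ TV c # v))) +
      (\<Sum>\<sigma>\<in>Inj j C. \<Sum>l\<in>fst (H, i) j - \<sigma> ` C. E (val j (\<sigma>((H, i) := l)) (u @ TV (H, i) # v)))"
    by (simp only: sum.distrib fst_conv)
  also have "(\<Sum>\<sigma>\<in>Inj j C. \<Sum>l\<in>fst (H, i) j - \<sigma> ` C. E (val j (\<sigma>((H, i) := l)) (u @ TV (H, i) # v))) =
      F (insert (H, i) C) j (u @ TV (H, i) # v)"
    unfolding F_def by (rule sum_Inj_insert[symmetric]) (use C c' fin in auto)
  also have "(\<Sum>\<sigma>\<in>Inj j C. \<Sum>c\<in>{c\<in>C. fst c = H}. E (val j \<sigma> (u @ TV c # v))) =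
      (\<Sum>c\<in>{c\<in>C. fst c = H}. F C j (u @ TV c # v))"
    unfolding F_def by (rule sum.swap)
  finally show ?thesis .
qed

text \<open>The new index has to avoid those taken by the colours of the same block. Over the reals
  this stays true for a block too small for the colours in \<open>C\<close>: there is then no
  labelling and both sides are 0.\<close>

lemma card_Inj_insert:
  assumes B: "block_system B" and C: "finite C" "fst ` C \<subseteq> B" and c: "c \<notin> C" "fst c \<in> B"
  shows "real (card (Inj j (insert c C))) =
    real (card (Inj j C)) * (real (card (fst c j)) - real (card {c'\<in>C. fst c' = fst c}))"
proof -
  have fin: "finite (fst c' j)" if "c' \<in> insert c C" for c'
    using that C c block_system_finite[OF B] by auto
  have disj: "fst c' = fst c \<or> fst c' j \<inter> fst c j = {}" if "c' \<in> C" for c'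
  proof -
    have "fst c' \<in> B" using that C(2) by auto
    then show ?thesis using B c unfolding block_system_def by blast
  qed
  have "real (card (Inj j (insert c C))) = (\<Sum>\<sigma>\<in>Inj j C. \<Sum>l\<in>fst c j - \<sigma> ` C. 1)"
    using sum_Inj_insert[OF C(1) c(1) fin, where f = "\<lambda>_. 1 :: real"] by simp
  also have "\<dots> = (\<Sum>\<sigma>\<in>Inj j C. real (card (fst c j)) - real (card {c'\<in>C. fst c' = fst c}))"
  proof (rule sum.cong[OF HOL.refl])
    fix \<sigma> assume "\<sigma> \<in> Inj j C"
    from sum_block_split[OF C(1) this, of "fst c" "\<lambda>_. 1 :: real"]
    show "(\<Sum>l\<in>fst c j - \<sigma> ` C. 1) = real (card (fst c j)) - real (card {c'\<in>C. fst c' = fst c})"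
      using disj fin by simp
  qed
  finally show ?thesis by simp
qed

text \<open>The recursion makes the ratio a product of block proportions, each corrected by a term
  of order \<open>1 / k j\<close>.\<close>

lemma card_Inj_convergent:
  assumes B: "block_system B" and "finite C" "fst ` C \<subseteq> B"
  shows "convergent (\<lambda>j. real (card (Inj j C)) / real (k j) ^ card C)"
  using assms(2,3)
proof (induction C)
  case empty
  show ?case by (simp add: Inj_empty convergent_const)
next
  case (insert c C)
  have "convergent (\<lambda>j. real (card (fst c j)) / real (k j))"
    using insert.prems B unfolding block_system_def by simp
  moreover have "convergent (\<lambda>j. real (card {c'\<in>C. fst c' = fst c}) * inverse (real (k j)))"
    by (rule convergent_mult[OF convergent_const]) (use inverse_k in \<open>auto simp: convergent_def\<close>)
  ultimately have "convergent (\<lambda>j. real (card (Inj j C)) / real (k j) ^ card C *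
      (real (card (fst c j)) / real (k j) - real (card {c'\<in>C. fst c' = fst c}) * inverse (real (k j))))"
    using insert by (intro convergent_mult[OF insert.IH] convergent_diff) auto
  moreover have "real (card (Inj j (insert c C))) / real (k j) ^ card (insert c C) =
      real (card (Inj j C)) / real (k j) ^ card C *
      (real (card (fst c j)) / real (k j) - real (card {c'\<in>C. fst c' = fst c}) * inverse (real (k j)))" for j
  proof -
    have "real (card (Inj j (insert c C))) =
        real (card (Inj j C)) * (real (card (fst c j)) - real (card {c'\<in>C. fst c' = fst c}))"
      by (rule card_Inj_insert[OF B]) (use insert in auto)
    then show ?thesis
      using insert.hyps by (simp add: divide_simps)
  qed
  ultimately show ?case by simp
qed

text \<open>Induction on the number of block sums. If there are none, the number of labellings,
  divided by \<open>k j ^ N\<close>, meets an expectation multiplied by \<open>k j ^ N\<close>, and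
  both converge. Expansion keeps the degree and never loses a colour, so the bound \<open>p\<close>
  makes the lemma usable while only words with at least two colours are known to be good.\<close>

lemma F_convergent:
  assumes good: "\<And>w. conv_word w \<Longrightarrow> blocks w = {} \<Longrightarrow> deg w = m \<Longrightarrow> p \<le> card (cols w) \<Longrightarrow> vgood w"
    and B: "block_system B"
    and w: "conv_word w" "deg w = m" "p \<le> card (cols w)" "blocks w \<subseteq> B" "fst ` cols w \<subseteq> B"
  shows "convergent (\<lambda>j. F (cols w) j w)"
  using w
proof (induction "nY w" arbitrary: w)
  case 0
  let ?n = "card (cols w)"
  have "blocks w = {}" using 0(1) nY_0 by metis
  then have "vgood w" using good 0 by simp
  then obtain t where t: "\<And>j \<sigma>. valid j (cols w) \<sigma> \<Longrightarrow> E (val j \<sigma> w) = t j"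
    and conv: "convergent (\<lambda>j. real (k j) ^ ?n *\<^sub>R t j)"
    unfolding vgood_def good_def by blast
  have "valid j (cols w) \<sigma>" if \<sigma>: "\<sigma> \<in> Inj j (cols w)" for j \<sigma>
  proof -
    have "\<sigma> c \<in> {1..k j}" if c: "c \<in> cols w" for c
    proof -
      have "fst c \<in> B" using c 0(6) by auto
      then have "fst c j \<subseteq> {1..k j}" using B unfolding block_system_def by blast
      moreover have "\<sigma> c \<in> fst c j" using \<sigma> c unfolding Inj_def by (auto simp: PiE_iff)
      ultimately show ?thesis by blast
    qed
    then show ?thesis using \<sigma> unfolding valid_def Inj_def by auto
  qed
  then have Feq: "F (cols w) j w = real (card (Inj j (cols w))) *\<^sub>R t j" for j
    unfolding F_def by (simp add: t sum_constant_scaleR del: sum_constant cong: sum.cong)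
  obtain a b where ab: "(\<lambda>j. real (card (Inj j (cols w))) / real (k j) ^ ?n) \<longlonglongrightarrow> a"
    "(\<lambda>j. real (k j) ^ ?n *\<^sub>R t j) \<longlonglongrightarrow> b"
    using card_Inj_convergent[OF B finite_cols 0(6)] conv unfolding convergent_def by blast
  have "\<forall>\<^sub>F j in sequentially.
      (real (card (Inj j (cols w))) / real (k j) ^ ?n) *\<^sub>R (real (k j) ^ ?n *\<^sub>R t j) = F (cols w) j w"
    using k_pos by eventually_elim (simp add: Feq)
  from convergent_cong[OF this] show ?case
    using tendsto_scaleR[OF ab] unfolding convergent_def by blast
next
  case (Suc n)
  obtain u H v where w: "w = u @ TY H # v" using split_TY[of w] Suc(2) by auto
  obtain i where i: "(H, i) \<notin> cols w" using exists_fresh[OF finite_cols] by blast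
  have H: "H \<in> B" using Suc.prems by (simp add: w)
  have cw: "cols w = cols u \<union> cols v" by (simp add: w)
  have same: "convergent (\<lambda>j. F (cols w) j (u @ TV c # v))" if "c \<in> cols w" for c
  proof -
    have eq: "cols (u @ TV c # v) = cols w" using that by (auto simp: w)
    have "convergent (\<lambda>j. F (cols (u @ TV c # v)) j (u @ TV c # v))"
      by (rule Suc.hyps(1)) (use Suc.prems Suc.hyps(2) eq in \<open>auto simp: w\<close>)
    then show ?thesis by (simp only: eq)
  qed
  have new: "convergent (\<lambda>j. F (insert (H, i) (cols w)) j (u @ TV (H, i) # v))"
  proof -
    have eq: "cols (u @ TV (H, i) # v) = insert (H, i) (cols w)" by (auto simp: w)
    have "card (cols w) \<le> card (insert (H, i) (cols w))" by (simp add: card_mono subset_insertI)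
    then have "convergent (\<lambda>j. F (cols (u @ TV (H, i) # v)) j (u @ TV (H, i) # v))"
      by (intro Suc.hyps(1)) (use Suc.prems Suc.hyps(2) H eq in \<open>auto simp: w\<close>)
    then show ?thesis by (simp only: eq)
  qed
  have "F (cols w) j w = (\<Sum>c\<in>{c\<in>cols w. fst c = H}. F (cols w) j (u @ TV c # v)) +
      F (insert (H, i) (cols w)) j (u @ TV (H, i) # v)" for j
    using F_step[OF B H finite_cols Suc.prems(5) i, of u v] cw by (simp add: w)
  moreover have "convergent (\<lambda>j. \<Sum>c\<in>{c\<in>cols w. fst c = H}. F (cols w) j (u @ TV c # v))"
    by (rule convergent_sum) (use same in auto)
  ultimately show ?case using new by (simp add: convergent_add)
qed

definition full_block :: block where "full_block j = {1..k j}"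

lemma block_system_full: "block_system {full_block}"
proof -
  have "\<forall>\<^sub>F j in sequentially. 1 = real (card (full_block j)) / real (k j)"
    using k_pos by eventually_elim (simp add: full_block_def)
  from convergent_cong[OF this] show ?thesis
    unfolding block_system_def by (simp add: full_block_def convergent_const)
qed

text \<open>Within one row the coefficients are constants, so a word of one colour is a polynomial
  in a single variable of the row. This is how equality of distributions enters.\<close>

lemma free_eval_word:
  assumes "blocks w = {}" "cols w \<subseteq> {c}"
  shows "val j \<sigma> w = free_eval \<iota> (\<lambda>_. X j (\<sigma> c))
    (prod_list (map (\<lambda>t. case t of TC b \<Rightarrow> free_const (b j) | _ \<Rightarrow> indet) w))"
  using assms
proof (induction w)
  case Nil
  have "free_eval \<iota> x (1 :: 'b poly1) = 1" for x
    using free_eval(1)[OF inc_alg_hom, of x] by (simp add: unital_alg_hom_def)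
  then show ?case by simp
next
  case (Cons t w)
  have mult: "free_eval \<iota> x (p * q) = free_eval \<iota> x p * free_eval \<iota> x q" for x and p q :: "'b poly1"
    using free_eval(1)[OF inc_alg_hom, of x] by (simp add: unital_alg_hom_def)
  show ?case using Cons
    by (cases t) (auto simp: mult free_eval(2,3)[OF inc_alg_hom])
qed

lemma E_val_ident:
  assumes "blocks w = {}" "cols w \<subseteq> {c}" "\<sigma> c \<in> {1..k j}" "\<tau> c \<in> {1..k j}"
  shows "E (val j \<sigma> w) = E (val j \<tau> w)"
proof -
  have "distr_of \<iota> E (X j (\<sigma> c)) = distr_of \<iota> E (X j (\<tau> c))"
    using assms by (intro ident) auto
  then show ?thesis
    unfolding free_eval_word[OF assms(1,2)] distr_of_def comp_def by metis
qed

lemma val_relabel: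
  assumes "blocks w = {}" "cols w \<subseteq> {c}"
  shows "val j \<sigma> w = val j (\<lambda>_. \<sigma> c) (relabel (TV c') w)"
  using assms
proof (induction w)
  case (Cons t w) then show ?case by (cases t) auto
qed simp

end

text \<open>Isolates what the combinatorics has to know about the row sums. Norm-convergence in
  moments will supply it.\<close>

locale array_conv = array \<iota> E k X
  for \<iota> :: "'b::cstar_algebra \<Rightarrow> 'a::cstar_algebra" and E k X +
  assumes S_conv: "\<And>w. conv_word w \<Longrightarrow> cols w = {} \<Longrightarrow> blocks w \<subseteq> {full_block} \<Longrightarrow>
    convergent (\<lambda>j. E (val j (\<lambda>_. undefined) w))"
begin

text \<open>Turn all letters of \<open>w\<close> into row sums. Expanding one of them introduces
  \<open>c0\<close>; each other one repeats \<open>c0\<close> or brings in a second colour, and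
  terms of the latter kind converge by \<open>multi\<close>. What is left is the word in
  \<open>c0\<close> alone, a sum of \<open>k j\<close> equal expectations.\<close>

lemma vgood_single:
  assumes multi: "\<And>w. conv_word w \<Longrightarrow> blocks w = {} \<Longrightarrow> deg w = m \<Longrightarrow> 2 \<le> card (cols w) \<Longrightarrow> vgood w"
    and w: "conv_word w" "blocks w = {}" "deg w = m" "cols w = {c}"
  shows "vgood w"
proof -
  define c0 where "c0 = (full_block, 0 :: nat)"
  define c1 where "c1 = (full_block, 1 :: nat)"
  have c01: "c1 \<noteq> c0" by (simp add: c0_def c1_def)
  have m: "0 < m" using deg_pos[of w] w by simp
  note conv = F_convergent[OF multi block_system_full]
  \<comment> \<open>Trades one row sum after another for \<open>c0\<close>. A trade changes
    \<open>v\<close> but not \<open>relabel (TV c0) v\<close>, which is why the conclusion is about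
    the latter.\<close>
  have collapse: "convergent (\<lambda>j. F {c0} j (relabel (TV c0) v))"
    if "conv_word v" "deg v = m" "cols v = {c0}" "blocks v \<subseteq> {full_block}"
      "convergent (\<lambda>j. F {c0} j v)" for v
    using that
  proof (induction "nY v" arbitrary: v)
    case 0
    then have "blocks v = {}" using nY_0 by metis
    then show ?case using 0 by (simp add: relabel_TV_id)
  next
    case (Suc n)
    obtain u H v' where v: "v = u @ TY H # v'" using split_TY[of v] Suc(2) by auto
    have H: "H = full_block" using Suc.prems by (simp add: v)
    have sub: "cols u \<subseteq> {c0}" "cols v' \<subseteq> {c0}" using Suc.prems(3) by (auto simp: v)
    have "F {c0} j v = (\<Sum>c\<in>{c\<in>{c0}. fst c = full_block}. F {c0} j (u @ TV c # v')) +
        F {c1, c0} j (u @ TV c1 # v')" for j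
      using F_step[OF block_system_full, of full_block "{c0}" 1 u v'] sub
      by (simp add: v H c0_def c1_def)
    moreover have "{c\<in>{c0}. fst c = full_block} = {c0}" by (auto simp: c0_def)
    ultimately have eq: "F {c0} j (u @ TV c0 # v') = F {c0} j v - F {c1, c0} j (u @ TV c1 # v')" for j
      by simp
    have cols1: "cols (u @ TV c1 # v') = {c1, c0}" using Suc.prems(3) by (auto simp: v)
    have "convergent (\<lambda>j. F (cols (u @ TV c1 # v')) j (u @ TV c1 # v'))"
      by (rule conv)
        (use Suc.prems m c01 cols1 in \<open>auto simp: v c0_def c1_def\<close>)
    then have "convergent (\<lambda>j. F {c0} j (u @ TV c0 # v'))"
      unfolding eq cols1 by (intro convergent_diff Suc.prems)
    then have "convergent (\<lambda>j. F {c0} j (relabel (TV c0) (u @ TV c0 # v')))"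
      by (intro Suc.hyps(1)) (use Suc.prems Suc.hyps(2) in \<open>auto simp: v\<close>)
    then show ?case by (simp add: v)
  qed
  define y where "y = relabel (TY full_block) w"
  have y: "conv_word y" "cols y = {}" "blocks y = {full_block}" "deg y = m"
    using w m by (simp_all add: y_def conv_word_relabel deg_relabel)
  have "nY y \<noteq> 0" using y(3) nY_0[of y] by simp
  then obtain u H v where uv: "y = u @ TY H # v" using split_TY[of y] by auto
  have H: "H = full_block" using y(3) by (simp add: uv)
  have "F {} j y = F {c0} j (u @ TV c0 # v)" for j
    using F_step[OF block_system_full, of full_block "{}" 0 u v] y(2)
    by (simp add: uv H c0_def)
  moreover have "convergent (\<lambda>j. F {} j y)"
    using S_conv[of y] y by (simp add: F_def Inj_empty)
  ultimately have "convergent (\<lambda>j. F {c0} j (u @ TV c0 # v))" by simp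
  then have "convergent (\<lambda>j. F {c0} j (relabel (TV c0) (u @ TV c0 # v)))"
    by (intro collapse) (use y in \<open>auto simp: uv\<close>)
  moreover have "relabel (TV c0) (u @ TV c0 # v) = relabel (TV c0) w"
  proof -
    have "relabel (TV c0) (u @ TV c0 # v) = relabel (TV c0) y" by (simp add: uv)
    then show ?thesis by (simp add: y_def relabel_relabel)
  qed
  ultimately have conv0: "convergent (\<lambda>j. F {c0} j (relabel (TV c0) w))" by simp
  \<comment> \<open>The first variable of the row is the representative; by identical distribution
    any other gives the same expectation.\<close>
  define t where "t j = E (val j (\<lambda>_. 1) w)" for j
  have t: "E (val j \<sigma> w) = t j" if "\<sigma> c \<in> {1..k j}" for j \<sigma>
    unfolding t_def using that w by (intro E_val_ident[of w c]) auto
  have "F {c0} j (relabel (TV c0) w) = real (k j) *\<^sub>R t j" for j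
  proof -
    have "E (val j \<sigma> (relabel (TV c0) w)) = t j" if "\<sigma> \<in> Inj j {c0}" for \<sigma>
    proof -
      have "\<sigma> c0 \<in> {1..k j}"
        using that unfolding Inj_def by (auto simp: PiE_iff c0_def full_block_def)
      then have "E (val j (\<lambda>_. \<sigma> c0) w) = t j" by (rule t)
      moreover have "val j (\<lambda>_. \<sigma> c0) w = val j (\<lambda>_. \<sigma> c0) (relabel (TV c0) w)"
        by (rule val_relabel[of w c]) (use w in auto)
      moreover have "val j (\<lambda>_. \<sigma> c0) (relabel (TV c0) w) = val j \<sigma> (relabel (TV c0) w)"
        by (rule val_cong) (simp split: if_splits)
      ultimately show ?thesis by simp
    qed
    moreover have "real (card (Inj j {c0})) = real (k j)"
      using card_Inj_insert[OF block_system_full, of "{}" c0 j]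
      by (simp add: Inj_empty c0_def full_block_def)
    ultimately show ?thesis unfolding F_def by (simp add: sum_constant_scaleR del: sum_constant cong: sum.cong)
  qed
  then have "convergent (\<lambda>j. real (k j) *\<^sub>R t j)" using conv0 by simp
  moreover have "\<forall>j \<sigma>. valid j {c} \<sigma> \<longrightarrow> E (val j \<sigma> w) = t j"
    by (simp add: valid_def t)
  ultimately show ?thesis
    unfolding vgood_def good_def w(4) by (intro exI[of _ t]) simp
qed

lemma vgood_all: "conv_word w \<Longrightarrow> blocks w = {} \<Longrightarrow> vgood w"
proof (induction "deg w" arbitrary: w rule: less_induct)
  case less
  have multi: "vgood v" if "conv_word v" "blocks v = {}" "deg v = deg w" "2 \<le> card (cols v)" for v
    by (rule vgood_multi[OF less.hyps that])
  consider "card (cols w) = 0" | "card (cols w) = 1" | "2 \<le> card (cols w)" by linarith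
  then show ?case
  proof cases
    case 1
    then have c: "cols w = {}" by simp
    have "E (val j \<sigma> w) = E (val j (\<lambda>_. undefined) w)" for j \<sigma>
      by (rule arg_cong[of _ _ E], rule val_cong) (simp add: c)
    then show ?thesis
      using S_conv[OF less.prems(1) c] less.prems(2) unfolding vgood_def good_def c
      by (intro exI[of _ "\<lambda>j. E (val j (\<lambda>_. undefined) w)"]) simp
  next
    case 2
    then obtain c where "cols w = {c}" using card_1_singletonE by blast
    from vgood_single[OF multi less.prems HOL.refl this] show ?thesis by blast
  next
    case 3
    with less.prems show ?thesis by (intro multi) auto
  qed
qed

lemma block_words_convergent:
  assumes "block_system B" "conv_word w" "cols w = {}" "blocks w \<subseteq> B"
  shows "convergent (\<lambda>j. E (val j (\<lambda>_. undefined) w))"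
proof -
  have "convergent (\<lambda>j. F (cols w) j w)"
    by (rule F_convergent[where m = "deg w" and p = 0, OF _ assms(1,2)])
      (simp_all add: vgood_all assms)
  then show ?thesis by (simp add: F_def Inj_empty assms)
qed

end

section \<open>Moments of the row sums\<close>

lemma unital_star_hom_free_const: "unital_star_hom (free_const :: 'b::star_algebra_1 \<Rightarrow> ('b, 'i) free_alg)"
  unfolding unital_star_hom_def unital_alg_hom_def
proof (intro conjI allI)
  show "free_const 1 = (1 :: ('b, 'i) free_alg)" by transfer (rule expr_eq.refl)
next
  fix x y :: 'b
  show "free_const (x + y) = (free_const x + free_const y :: ('b, 'i) free_alg)"
    by transfer (rule expr_eq.sym, rule expr_eq.Const_Add)
next
  fix c and x :: 'b
  show "free_const (c *\<^sub>C x) = (c *\<^sub>C free_const x :: ('b, 'i) free_alg)"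
    by transfer (rule expr_eq.sym, rule expr_eq.Const_Scale)
next
  fix x y :: 'b
  show "free_const (x * y) = (free_const x * free_const y :: ('b, 'i) free_alg)"
    by transfer (rule expr_eq.sym, rule expr_eq.Const_Mul)
next
  fix x :: 'b
  show "free_const (star x) = (star (free_const x) :: ('b, 'i) free_alg)"
    by transfer (simp add: expr_eq.refl)
qed

lemma unital_alg_hom_free_const: "unital_alg_hom (free_const :: 'b::star_algebra_1 \<Rightarrow> ('b, 'i) free_alg)"
  using unital_star_hom_free_const unfolding unital_star_hom_def by blast

lemma star_free_var: "star (free_var i) = (free_var i :: ('b::star_algebra_1, 'i) free_alg)"
  by transfer (simp add: expr_eq.refl)

lemma free_alg_induct [case_names const var add mult scaleC]:
  fixes p :: "('b::star_algebra_1, 'i) free_alg"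
  assumes const: "\<And>b. P (free_const b)" and var: "\<And>i. P (free_var i)"
    and add: "\<And>p q. P p \<Longrightarrow> P q \<Longrightarrow> P (p + q)" and mult: "\<And>p q. P p \<Longrightarrow> P q \<Longrightarrow> P (p * q)"
    and scaleC: "\<And>c p. P p \<Longrightarrow> P (c *\<^sub>C p)"
  shows "P p"
proof -
  have "P (abs_free_alg e)" for e
  proof (induction e)
    case (Const b)
    show ?case using const[of b] by (simp add: free_const.abs_eq)
  next
    case (Var i)
    show ?case using var[of i] by (simp add: free_var.abs_eq)
  next
    case (Add p q)
    then show ?case using add by (simp add: plus_free_alg.abs_eq[symmetric])
  next
    case (Mul p q)
    then show ?case using mult by (simp add: times_free_alg.abs_eq[symmetric])
  next
    case (Scale c p)
    then show ?case using scaleC by (simp add: scaleC_free_alg.abs_eq[symmetric])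
  qed
  then have "P (abs_free_alg (rep_free_alg p))" .
  then show ?thesis by (simp add: Quotient3_abs_rep[OF Quotient3_free_alg])
qed

lemma unital_alg_hom_prod_list: "unital_alg_hom f \<Longrightarrow> f (prod_list xs) = prod_list (map f xs)"
  by (induction xs) (simp_all add: unital_alg_hom_def)

lemma free_eval_star:
  assumes \<iota>: "unital_star_hom \<iota>" and x: "\<And>i. star (x i) = x i"
  shows "free_eval \<iota> x (star p) = star (free_eval \<iota> x p)"
proof -
  have hom: "unital_alg_hom \<iota>" using \<iota> by (simp add: unital_star_hom_def)
  note e = free_eval(1)[OF hom, of x, unfolded unital_alg_hom_def]
  show ?thesis
  proof (induction p rule: free_alg_induct)
    case (const b)
    have "star (free_const b) = (free_const (star b) :: ('a, 'c) free_alg)"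
      using unital_star_hom_free_const unfolding unital_star_hom_def by metis
    then show ?case using \<iota> by (simp add: free_eval(2)[OF hom] unital_star_hom_def)
  next
    case (var i)
    then show ?case by (simp add: star_free_var free_eval(3)[OF hom] x)
  next
    case (add p q)
    then show ?case by (simp add: star_add e)
  next
    case (mult p q)
    then show ?case by (simp add: star_mult e)
  next
    case (scaleC c p)
    then show ?case by (simp add: star_scaleC e)
  qed
qed

lemma free_eval_free_eval:
  fixes s :: "'i \<Rightarrow> ('b::star_algebra_1, 'm) free_alg"
  assumes \<iota>: "unital_alg_hom \<iota>"
  shows "free_eval \<iota> x (free_eval free_const s p) = free_eval \<iota> (\<lambda>i. free_eval \<iota> x (s i)) p"
proof (rule free_alg_hom_unique)
  show "unital_alg_hom (\<lambda>p. free_eval \<iota> x (free_eval free_const s p))"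
    using free_eval(1)[OF \<iota>, of x] free_eval(1)[OF unital_alg_hom_free_const, of s]
    by (simp add: unital_alg_hom_def)
qed (simp_all add: free_eval(1-3)[OF \<iota>] free_eval(2,3)[OF unital_alg_hom_free_const])

lemma gen_star_alg_image:
  assumes "unital_star_hom f" and "a \<in> gen_star_alg \<iota> x"
  shows "f a \<in> gen_star_alg (\<lambda>b. f (\<iota> b)) (f x)"
  using assms(2)
  by (induction rule: gen_star_alg.induct)
    (use assms(1) in \<open>auto simp: unital_star_hom_def unital_alg_hom_def intro: gen_star_alg.intros\<close>)

text \<open>Passes from words that end in a coefficient, as in normal forms, to words that begin and
  end with \<open>s\<close>, as in \<open>moment_word\<close>.\<close>

lemma prod_list_rotate:
  fixes s :: "'a::monoid_mult"
  shows "prod_list (map (\<lambda>b. s * f b) (bs @ [c])) = s * prod_list (map (\<lambda>b. f b * s) bs) * f c"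
  by (induction bs) (simp_all add: mult.assoc)

lemma (in cond_exp) distr_of_distributions:
  assumes a: "star a = a" shows "distr_of \<iota> E a \<in> distributions"
proof -
  note e = free_eval(1)[OF inc_alg_hom, of "\<lambda>_ :: unit. a", unfolded unital_alg_hom_def]
  show ?thesis
    unfolding distributions_def pos_cond_exp_def distr_of_def comp_def mem_Collect_eq
    by (auto simp: e free_eval(2)[OF inc_alg_hom] free_eval_star[OF hom a] E_one E_add E_scaleC E_bimod E_pos)
qed

section \<open>Normal form of polynomials in one variable\<close>

definition nf_word :: "'b::star_algebra_1 \<Rightarrow> 'b list \<Rightarrow> 'b poly1" where
  "nf_word b bs = free_const b * prod_list (map (\<lambda>b. indet * free_const b) bs)"

inductive_set nf_span :: "'b::star_algebra_1 poly1 set" where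
  zero: "0 \<in> nf_span"
| word: "p \<in> nf_span \<Longrightarrow> nf_word b bs + p \<in> nf_span"

lemma nf_span_add: "p \<in> nf_span \<Longrightarrow> q \<in> nf_span \<Longrightarrow> p + q \<in> nf_span"
  by (induction rule: nf_span.induct) (auto simp: add.assoc intro: nf_span.word)

lemma nf_span_word: "nf_word b bs \<in> nf_span"
  using nf_span.word[OF nf_span.zero] by simp

lemma nf_word_mult: "nf_word b bs * nf_word c cs \<in> nf_span"
proof -
  have hom: "free_const (x * y) = (free_const x * free_const y :: 'a poly1)" for x y
    using unital_alg_hom_free_const unfolding unital_alg_hom_def by metis
  show ?thesis
  proof (cases bs rule: rev_cases)
    case Nil
    then have "nf_word b bs * nf_word c cs = nf_word (b * c) cs"
      by (simp add: nf_word_def hom mult.assoc)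
    then show ?thesis by (simp add: nf_span_word)
  next
    case (snoc ds d)
    then have "nf_word b bs * nf_word c cs = nf_word b (ds @ (d * c) # cs)"
      by (simp add: nf_word_def hom mult.assoc)
    then show ?thesis by (simp add: nf_span_word)
  qed
qed

text \<open>Adjacent coefficients merge in products and scalars go into the first coefficient, so
  sums of words are closed under addition, multiplication and scaling. Convergence for all
  polynomials thus reduces to words.\<close>

lemma nf_span_UNIV:
  fixes p :: "'a::star_algebra_1 poly1"
  shows "p \<in> nf_span"
proof (induction p rule: free_alg_induct)
  case (const b)
  show ?case using nf_span_word[of b "[]"] by (simp add: nf_word_def)
next
  case (var i)
  have "free_const 1 = (1 :: 'a poly1)"
    using unital_alg_hom_free_const unfolding unital_alg_hom_def by metis
  then have "nf_word 1 [1] = (indet :: 'a poly1)" by (simp add: nf_word_def)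
  then show ?case using nf_span_word[of "1 :: 'a" "[1]"] by simp
next
  case (add p q)
  then show ?case by (rule nf_span_add)
next
  case (mult p q)
  have w: "nf_word b bs * q \<in> nf_span" for b bs
    using mult(2) by induction (auto simp: nf_span.zero distrib_left intro: nf_span_add nf_word_mult)
  show ?case
    using mult(1) by induction (auto simp: nf_span.zero distrib_right intro: nf_span_add w)
next
  case (scaleC c p)
  have w: "c *\<^sub>C nf_word b bs = nf_word (c *\<^sub>C b) bs" for b :: 'a and bs
  proof -
    have "free_const (c *\<^sub>C b) = (c *\<^sub>C free_const b :: 'a poly1)"
      using unital_alg_hom_free_const unfolding unital_alg_hom_def by metis
    then show ?thesis by (simp add: nf_word_def mult_scaleC_left)
  qed
  show ?case
    using scaleC by induction (auto simp: w scaleC_zero_right scaleC_add_right nf_span.zero intro: nf_span.word)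
qed

text \<open>Moves the coefficients to the unit sphere, where norm-convergence is stated. Replacing a
  zero coefficient by 1 is harmless, since the scalar factor is then 0.\<close>

lemma moment_word_normalize:
  "moment_word bs = complex_of_real (prod_list (map norm bs)) *\<^sub>C
     moment_word (map (\<lambda>b. if b = 0 then 1 else complex_of_real (1 / norm b) *\<^sub>C b) bs)"
  (is "_ = _ *\<^sub>C moment_word (map ?u bs)")
proof -
  have scal: "free_const (c *\<^sub>C b) = (c *\<^sub>C free_const b :: 'a poly1)" for c b
    using unital_alg_hom_free_const unfolding unital_alg_hom_def by metis
  have b: "b = complex_of_real (norm b) *\<^sub>C ?u b" for b :: 'a
    by (simp add: scaleC_scaleC scaleC_one scaleC_zero_left flip: of_real_mult)
  have fc: "free_const b * indet = complex_of_real (norm b) *\<^sub>C (free_const (?u b) * indet :: 'a poly1)" for b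
    unfolding mult_scaleC_left[symmetric] scal[symmetric] b[symmetric] ..
  have "prod_list (map (\<lambda>b. free_const b * indet) bs) =
     complex_of_real (prod_list (map norm bs)) *\<^sub>C prod_list (map (\<lambda>b. free_const (?u b) * indet) bs)"
  proof (induction bs)
    case (Cons a bs)
    show ?case
      by (simp only: list.map prod_list.Cons Cons fc[of a] mult_scaleC_left mult_scaleC_right
          scaleC_scaleC of_real_mult mult.commute[of "complex_of_real (prod_list (map norm bs))"])
  qed (simp add: scaleC_one)
  then show ?thesis by (simp add: moment_word_def mult_scaleC_right comp_def)
qed

lemma tendsto_prod_list:
  fixes g :: "'i \<Rightarrow> nat \<Rightarrow> 'a::real_normed_algebra_1"
  assumes "\<And>x. x \<in> set xs \<Longrightarrow> (\<lambda>n. g x n) \<longlonglongrightarrow> l x"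
  shows "(\<lambda>n. prod_list (map (\<lambda>x. g x n) xs)) \<longlonglongrightarrow> prod_list (map l xs)"
  using assms by (induction xs) (auto intro!: tendsto_mult)

lemma interleave_tendsto:
  fixes f g :: "nat \<Rightarrow> 'a::metric_space"
  assumes "f \<longlonglongrightarrow> a" "g \<longlonglongrightarrow> a"
  shows "(\<lambda>j. if even j then f j else g j) \<longlonglongrightarrow> a"
proof (rule tendstoI)
  fix e :: real assume "e > 0"
  from tendstoD[OF assms(1) this] tendstoD[OF assms(2) this]
  show "\<forall>\<^sub>F j in sequentially. dist (if even j then f j else g j) a < e"
    by eventually_elim simp
qed

text \<open>The limit of the interleaved sequence is seen along the even and along the odd
  indices.\<close>

lemma interleave_limits:
  fixes f g :: "nat \<Rightarrow> 'a::metric_space"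
  assumes f: "f \<longlonglongrightarrow> a" and g: "g \<longlonglongrightarrow> b" and c: "convergent (\<lambda>j. if even j then f j else g j)"
  shows "a = b"
proof -
  obtain l where l: "(\<lambda>j. if even j then f j else g j) \<longlonglongrightarrow> l" using c unfolding convergent_def by blast
  have m: "strict_mono (\<lambda>j :: nat. 2 * j)" "strict_mono (\<lambda>j :: nat. 2 * j + 1)"
    by (simp_all add: strict_mono_def)
  have "(\<lambda>j. f (2 * j)) \<longlonglongrightarrow> l" "(\<lambda>j. g (2 * j + 1)) \<longlonglongrightarrow> l"
    using LIMSEQ_subseq_LIMSEQ[OF l m(1)] LIMSEQ_subseq_LIMSEQ[OF l m(2)] by (simp_all add: comp_def)
  moreover have "(\<lambda>j. f (2 * j)) \<longlonglongrightarrow> a" "(\<lambda>j. g (2 * j + 1)) \<longlonglongrightarrow> b"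
    using LIMSEQ_subseq_LIMSEQ[OF f m(1)] LIMSEQ_subseq_LIMSEQ[OF g m(2)] by (simp_all add: comp_def)
  ultimately show ?thesis using LIMSEQ_unique by metis
qed

section \<open>Moments of the row sums with moving coefficients\<close>

locale array_moments = array \<iota> E k X
  for \<iota> :: "'b::cstar_algebra \<Rightarrow> 'a::cstar_algebra" and E k X +
  fixes \<mu> :: "'b poly1 \<Rightarrow> 'b"
  assumes isometric: "norm (\<iota> b) = norm b"
    and \<mu>: "\<mu> \<in> distributions"
    and moments: "norm_converges_in_moments (\<lambda>j. distr_of \<iota> E (\<Sum>l\<in>{1..k j}. X j l)) \<mu>"
begin

lemma cond_exp_\<mu>: "cond_exp free_const \<mu>"
  using \<mu> unital_star_hom_free_const unfolding distributions_def cond_exp_def by simp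

definition S :: "nat \<Rightarrow> 'a" where "S j = (\<Sum>l\<in>{1..k j}. X j l)"

definition mom :: "nat \<Rightarrow> 'b list \<Rightarrow> 'b" where "mom j bs = distr_of \<iota> E (S j) (moment_word bs)"

lemma E_tendsto: assumes "(f \<longlongrightarrow> l) G" shows "((\<lambda>x. E (f x)) \<longlongrightarrow> E l) G"
proof -
  have "((\<lambda>x. 8 * norm (f x - l)) \<longlongrightarrow> 0) G"
    using assms by (intro tendsto_mult_right_zero) (simp add: tendsto_norm_zero_iff LIM_zero_iff)
  then have "((\<lambda>x. E (f x) - E l) \<longlongrightarrow> 0) G"
    by (rule Lim_null_comparison[rotated])
      (simp add: pos_cond_exp_bounded[OF pce] E_diff[symmetric])
  then show ?thesis by (simp add: LIM_zero_iff)
qed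

lemma inc_tendsto: assumes "(f \<longlongrightarrow> l) G" shows "((\<lambda>x. \<iota> (f x)) \<longlongrightarrow> \<iota> l) G"
proof -
  have minus: "\<iota> a - \<iota> b = \<iota> (a - b)" for a b
    using inc_add[of "a - b" b] by simp
  have "((\<lambda>x. norm (\<iota> (f x) - \<iota> l)) \<longlongrightarrow> 0) G"
    using assms by (simp add: minus isometric tendsto_norm_zero_iff LIM_zero_iff)
  then show ?thesis by (simp add: tendsto_norm_zero_iff LIM_zero_iff)
qed

lemma mom_eq: "mom j bs = E (S j * prod_list (map (\<lambda>b. \<iota> b * S j) bs))"
proof -
  note hom = free_eval(1)[OF inc_alg_hom, of "\<lambda>_ :: unit. S j"]
  show ?thesis
    using hom[unfolded unital_alg_hom_def] unital_alg_hom_prod_list[OF hom]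
    by (simp add: mom_def distr_of_def moment_word_def comp_def free_eval(2,3)[OF inc_alg_hom])
qed

text \<open>By homogeneity, the supremum over the unit sphere controls all coefficient lists of a
  given length from the same row on.\<close>

lemma mom_uniform:
  assumes "e > 0"
  shows "\<forall>\<^sub>F j in sequentially. \<forall>bs. length bs = r \<longrightarrow>
    norm (mom j bs - \<mu> (moment_word bs)) \<le> e * prod_list (map norm bs)"
proof -
  interpret mu: cond_exp free_const \<mu> by (rule cond_exp_\<mu>)
  let ?U = "{bs. length bs = r \<and> (\<forall>b\<in>set bs. norm b = 1)} :: 'b list set"
  have "(\<lambda>j. SUP bs\<in>?U. ereal (norm (mom j bs - \<mu> (moment_word bs)))) \<longlonglongrightarrow> 0"
    using moments unfolding norm_converges_in_moments_def mom_def S_def by blast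
  then have "\<forall>\<^sub>F j in sequentially. (SUP bs\<in>?U. ereal (norm (mom j bs - \<mu> (moment_word bs)))) < ereal e"
    by (rule order_tendstoD) (simp add: assms)
  then show ?thesis
  proof eventually_elim
    case (elim j)
    show ?case
    proof (intro allI impI)
      fix bs :: "'b list" assume len: "length bs = r"
      let ?u = "\<lambda>b. if b = 0 then 1 else complex_of_real (1 / norm b) *\<^sub>C b"
      let ?c = "complex_of_real (prod_list (map norm bs))"
      have "map ?u bs \<in> ?U" using len by (auto simp: norm_scaleC norm_divide)
      then have "ereal (norm (mom j (map ?u bs) - \<mu> (moment_word (map ?u bs)))) < ereal e"
        by (intro le_less_trans[OF SUP_upper elim])
      then have le: "norm (mom j (map ?u bs) - \<mu> (moment_word (map ?u bs))) \<le> e" by simp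
      have nn: "0 \<le> prod_list (map norm bs)" by (induction bs) auto
      have "distr_of \<iota> E (S j) (c *\<^sub>C p) = c *\<^sub>C distr_of \<iota> E (S j) p" for c p
        using free_eval(1)[OF inc_alg_hom, of "\<lambda>_ :: unit. S j"]
        by (simp add: distr_of_def E_scaleC unital_alg_hom_def)
      then have "mom j bs - \<mu> (moment_word bs) =
          ?c *\<^sub>C (mom j (map ?u bs) - \<mu> (moment_word (map ?u bs)))"
        unfolding mom_def moment_word_normalize[of bs]
        by (simp only: mu.E_scaleC scaleC_diff_right)
      then have "norm (mom j bs - \<mu> (moment_word bs)) =
          prod_list (map norm bs) * norm (mom j (map ?u bs) - \<mu> (moment_word (map ?u bs)))"
        using nn by (simp add: norm_scaleC)
      also have "\<dots> \<le> prod_list (map norm bs) * e" using le nn by (rule mult_left_mono)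
      finally show "norm (mom j bs - \<mu> (moment_word bs)) \<le> e * prod_list (map norm bs)"
        by (simp add: mult.commute)
    qed
  qed
qed

text \<open>Continuity in the coefficients is borrowed from a fixed row \<open>J\<close>, where it
  follows from that of \<open>E\<close>. At the moving coefficients one passes from
  \<open>mom j\<close> to \<open>\<mu>\<close> and on to \<open>mom J\<close>, then within row
  \<open>J\<close> to the limit coefficients, and back to \<open>\<mu>\<close>: four steps of
  \<open>e / 4\<close>.\<close>

lemma mom_tendsto:
  fixes bs :: "(nat \<Rightarrow> 'b) list"
  assumes bs: "\<And>b. b \<in> set bs \<Longrightarrow> convergent b"
  shows "(\<lambda>j. mom j (map (\<lambda>b. b j) bs)) \<longlonglongrightarrow> \<mu> (moment_word (map lim bs))"
proof (rule LIMSEQ_I)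
  fix e :: real assume e: "e > 0"
  have b: "b \<longlonglongrightarrow> lim b" if "b \<in> set bs" for b
    using bs[OF that] by (simp add: convergent_LIMSEQ_iff)
  define c where "c = prod_list (map norm (map lim bs))"
  have c0: "0 \<le> c" unfolding c_def by (induction bs) auto
  have "(\<lambda>j. prod_list (map (\<lambda>b. norm (b j)) bs)) \<longlonglongrightarrow> prod_list (map (\<lambda>b. norm (lim b)) bs)"
    by (rule tendsto_prod_list) (intro tendsto_norm b)
  then have "(\<lambda>j. prod_list (map norm (map (\<lambda>b. b j) bs))) \<longlonglongrightarrow> c"
    by (simp add: c_def comp_def)
  then have bound: "\<forall>\<^sub>F j in sequentially. prod_list (map norm (map (\<lambda>b. b j) bs)) < c + 1"
    by (rule order_tendstoD) simp
  \<comment> \<open>The products of the norms are eventually below \<open>c + 1\<close>, so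
    \<open>d\<close> times such a product is at most \<open>e / 4\<close>.\<close>
  define d where "d = e / 4 / (c + 1)"
  have d: "d > 0" using e c0 by (simp add: d_def)
  have dc: "d * x \<le> e / 4" if "x \<le> c + 1" for x
  proof -
    have "d * x \<le> d * (c + 1)" using that d by simp
    also have "\<dots> = e / 4"
      unfolding d_def by (rule nonzero_eq_divide_eq[THEN iffD1]) (use c0 in auto)
    finally show ?thesis .
  qed
  obtain J where J: "\<And>j as. j \<ge> J \<Longrightarrow> length as = length bs \<Longrightarrow>
      norm (mom j as - \<mu> (moment_word as)) \<le> d * prod_list (map norm as)"
    using mom_uniform[OF d, of "length bs"] unfolding eventually_sequentially by blast
  have "(\<lambda>j. mom J (map (\<lambda>b. b j) bs)) \<longlonglongrightarrow> mom J (map lim bs)"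
    unfolding mom_eq map_map comp_def
    by (intro E_tendsto tendsto_mult tendsto_const tendsto_prod_list inc_tendsto b)
  then have "\<forall>\<^sub>F j in sequentially. dist (mom J (map (\<lambda>b. b j) bs)) (mom J (map lim bs)) < e / 4"
    using e by (intro tendstoD) auto
  then have "\<forall>\<^sub>F j in sequentially. norm (mom j (map (\<lambda>b. b j) bs) - \<mu> (moment_word (map lim bs))) < e"
    using bound eventually_ge_at_top[of J]
  proof eventually_elim
    case (elim j)
    let ?b = "map (\<lambda>b. b j) bs" and ?l = "map lim bs"
    have 1: "norm (mom j ?b - \<mu> (moment_word ?b)) \<le> e / 4"
      using J[of j ?b] elim dc[of "prod_list (map norm ?b)"] by simp
    have 2: "norm (mom J ?b - \<mu> (moment_word ?b)) \<le> e / 4"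
      using J[of J ?b] elim dc[of "prod_list (map norm ?b)"] by simp
    have 3: "norm (mom J ?l - \<mu> (moment_word ?l)) \<le> e / 4"
      using J[of J ?l] dc[of c] by (simp add: c_def)
    have 4: "norm (mom J ?b - mom J ?l) < e / 4" using elim by (simp add: dist_norm)
    have triangle: "norm (x - w) \<le> norm (x - y) + norm (z - y) + norm (z - v) + norm (v - w)"
      for x y z v w :: 'b
      using norm_triangle_ineq[of "x - z" "z - w"] norm_triangle_ineq[of "x - y" "y - z"]
        norm_triangle_ineq[of "z - v" "v - w"] norm_minus_commute[of y z] by simp
    show ?case
      using triangle[of "mom j ?b" "\<mu> (moment_word ?l)" "\<mu> (moment_word ?b)" "mom J ?b" "mom J ?l"] 1 2 3 4
      by linarith
  qed
  then show "\<exists>no. \<forall>n\<ge>no. norm (mom n (map (\<lambda>b. b n) bs) - \<mu> (moment_word (map lim bs))) < e"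
    unfolding eventually_sequentially .
qed

lemma word_normal_form:
  assumes "conv_word w" "cols w = {}" "blocks w \<subseteq> {full_block}"
  shows "\<exists>b0 bs. convergent b0 \<and> (\<forall>b\<in>set bs. convergent b) \<and>
    (\<forall>j. val j (\<lambda>_. undefined) w = \<iota> (b0 j) * prod_list (map (\<lambda>b. S j * \<iota> (b j)) bs))"
  using assms
proof (induction w)
  case Nil
  show ?case by (intro exI[of _ "\<lambda>_. 1"] exI[of _ "[]"]) (simp add: inc_one convergent_const)
next
  case (Cons t w)
  then obtain b0 bs where b: "convergent b0" "\<forall>b\<in>set bs. convergent b"
    "\<And>j. val j (\<lambda>_. undefined) w = \<iota> (b0 j) * prod_list (map (\<lambda>b. S j * \<iota> (b j)) bs)"
    by (cases t) auto
  show ?case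
  proof (cases t)
    case (TC a)
    have "convergent (\<lambda>j. a j * b0 j)"
      using Cons.prems(1) b(1) by (intro convergent_mult) (auto simp: TC)
    then show ?thesis
      using b by (intro exI[of _ "\<lambda>j. a j * b0 j"] exI[of _ bs]) (simp add: TC inc_mult mult.assoc)
  next
    case (TV c)
    then show ?thesis using Cons.prems by simp
  next
    case (TY H)
    then have "H = full_block" using Cons.prems by simp
    then show ?thesis
      using b by (intro exI[of _ "\<lambda>_. 1"] exI[of _ "b0 # bs"])
        (simp add: TY inc_one convergent_const mult.assoc S_def full_block_def)
  qed
qed

lemma E_alternating:
  "E (\<iota> b * prod_list (map (\<lambda>b. S j * \<iota> b) (bs @ [c]))) = b * mom j bs * c"
proof -
  let ?P = "S j * prod_list (map (\<lambda>b. \<iota> b * S j) bs)"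
  have "\<iota> b * (?P * \<iota> c) = \<iota> b * ?P * \<iota> c" by (simp only: mult.assoc)
  then show ?thesis unfolding prod_list_rotate mom_eq by (simp only: E_left E_right)
qed

text \<open>The outer coefficients leave \<open>E\<close> by the bimodule property; what remains of
  a word in row sums is a moment covered by \<open>mom_tendsto\<close>.\<close>

sublocale array_conv
proof
  fix w :: "'b tok list"
  assume "conv_word w" "cols w = {}" "blocks w \<subseteq> {full_block}"
  from word_normal_form[OF this] obtain b0 bs where b: "convergent b0" "\<forall>b\<in>set bs. convergent b"
    and v: "\<And>j. val j (\<lambda>_. undefined) w = \<iota> (b0 j) * prod_list (map (\<lambda>b. S j * \<iota> (b j)) bs)"
    by blast
  show "convergent (\<lambda>j. E (val j (\<lambda>_. undefined) w))"
  proof (cases bs rule: rev_cases)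
    case Nil
    then show ?thesis using b by (simp add: v E_inc)
  next
    case (snoc cs c)
    have "E (val j (\<lambda>_. undefined) w) = b0 j * mom j (map (\<lambda>b. b j) cs) * c j" for j
      using E_alternating[of "b0 j" j "map (\<lambda>b. b j) cs" "c j"] by (simp add: v snoc comp_def)
    moreover have "convergent (\<lambda>j. mom j (map (\<lambda>b. b j) cs))"
      using mom_tendsto[of cs] b snoc unfolding convergent_def by auto
    ultimately show ?thesis using b snoc by (simp add: convergent_mult)
  qed
qed

lemma S_tendsto: "(\<lambda>j. E (free_eval \<iota> (\<lambda>_. S j) p)) \<longlonglongrightarrow> \<mu> p"
proof -
  interpret mu: cond_exp free_const \<mu> by (rule cond_exp_\<mu>)
  note hom = free_eval(1)[OF inc_alg_hom, of "\<lambda>_ :: unit. S j" for j]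
  note homs = hom[unfolded unital_alg_hom_def] unital_alg_hom_prod_list[OF hom]
  have word: "(\<lambda>j. E (free_eval \<iota> (\<lambda>_. S j) (nf_word b bs))) \<longlonglongrightarrow> \<mu> (nf_word b bs)" for b bs
  proof -
    have ev: "free_eval \<iota> (\<lambda>_. S j) (nf_word b bs) = \<iota> b * prod_list (map (\<lambda>b. S j * \<iota> b) bs)" for j
      by (simp add: nf_word_def homs comp_def free_eval(2,3)[OF inc_alg_hom])
    show ?thesis
    proof (cases bs rule: rev_cases)
      case Nil
      have "\<mu> (nf_word b []) = b" by (simp add: nf_word_def mu.E_inc)
      then show ?thesis unfolding ev unfolding Nil by (simp add: E_inc)
    next
      case (snoc cs c)
      have "(\<lambda>j. mom j (map (\<lambda>b. b j) (map (\<lambda>b _. b) cs))) \<longlonglongrightarrow> \<mu> (moment_word (map lim (map (\<lambda>b _. b) cs)))"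
        by (rule mom_tendsto) (auto simp: convergent_const)
      then have "(\<lambda>j. mom j cs) \<longlonglongrightarrow> \<mu> (moment_word cs)"
        by (simp add: comp_def limI)
      then have "(\<lambda>j. b * mom j cs * c) \<longlonglongrightarrow> b * \<mu> (moment_word cs) * c"
        by (intro tendsto_intros)
      moreover have "\<mu> (nf_word b bs) = b * \<mu> (moment_word cs) * c"
        unfolding nf_word_def snoc prod_list_rotate moment_word_def
        by (simp only: mu.E_left mu.E_right mult.assoc[of "free_const b", symmetric])
          (simp only: mu.E_left mu.E_right mult.assoc)
      ultimately show ?thesis unfolding ev unfolding snoc E_alternating by simp
    qed
  qed
  have "p \<in> nf_span" by (rule nf_span_UNIV)
  then show ?thesis
  proof induction
    case zero
    then show ?case using unital_alg_hom_zero[OF hom] by (simp add: E_zero mu.E_zero)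
  next
    case (word p b bs)
    then show ?case
      using tendsto_add[OF \<open>\<And>b bs. (\<lambda>j. E (free_eval \<iota> (\<lambda>_. S j) (nf_word b bs))) \<longlonglongrightarrow> \<mu> (nf_word b bs)\<close> word.IH]
      by (simp add: homs E_add mu.E_add)
  qed
qed

end

section \<open>Limits of block sums\<close>

context array_conv
begin

text \<open>An algebra of sequences, with one entry per row, on which \<open>E\<close> has a limit.
  It contains the convergent coefficient sequences and the block sums, hence all polynomials in
  them.\<close>

inductive_set seqs :: "block set \<Rightarrow> (nat \<Rightarrow> 'a) set" for B where
  zero: "(\<lambda>_. 0) \<in> seqs B"
| word: "conv_word w \<Longrightarrow> cols w = {} \<Longrightarrow> blocks w \<subseteq> B \<Longrightarrow> T \<in> seqs B \<Longrightarrow>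
    (\<lambda>j. val j (\<lambda>_. undefined) w + T j) \<in> seqs B"

lemma seqs_convergent:
  assumes "block_system B" "T \<in> seqs B" shows "convergent (\<lambda>j. E (T j))"
  using assms(2)
  by induction (auto simp: E_zero E_add convergent_const intro!: convergent_add block_words_convergent[OF assms(1)])

lemma seqs_add: "T \<in> seqs B \<Longrightarrow> U \<in> seqs B \<Longrightarrow> (\<lambda>j. T j + U j) \<in> seqs B"
  by (induction rule: seqs.induct) (auto simp: add.assoc intro: seqs.word)

lemma seqs_word:
  "conv_word w \<Longrightarrow> cols w = {} \<Longrightarrow> blocks w \<subseteq> B \<Longrightarrow> (\<lambda>j. val j (\<lambda>_. undefined) w) \<in> seqs B"
  using seqs.word[OF _ _ _ seqs.zero] by simp

lemma seqs_word_mult: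
  assumes w: "conv_word w" "cols w = {}" "blocks w \<subseteq> B" and T: "T \<in> seqs B"
  shows "(\<lambda>j. val j (\<lambda>_. undefined) w * T j) \<in> seqs B"
  using T
proof induction
  case zero
  show ?case by (simp add: seqs.zero)
next
  case (word v T)
  have "(\<lambda>j. val j (\<lambda>_. undefined) (w @ v) + val j (\<lambda>_. undefined) w * T j) \<in> seqs B"
    by (rule seqs.word) (use w word in auto)
  then show ?case by (simp add: distrib_left)
qed

lemma seqs_mult:
  assumes "T \<in> seqs B" and U: "U \<in> seqs B" shows "(\<lambda>j. T j * U j) \<in> seqs B"
  using assms(1)
proof induction
  case zero
  show ?case by (simp add: seqs.zero)
next
  case (word w T)
  then show ?case by (simp add: distrib_right seqs_add seqs_word_mult U)
qed

lemma seqs_const: "convergent b \<Longrightarrow> (\<lambda>j. \<iota> (b j)) \<in> seqs B"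
  using seqs_word[of "[TC b]" B] by simp

lemma seqs_block: "H \<in> B \<Longrightarrow> (\<lambda>j. \<Sum>l\<in>H j. X j l) \<in> seqs B"
  using seqs_word[of "[TY H]" B] by simp

lemma seqs_scaleC:
  assumes "T \<in> seqs B" shows "(\<lambda>j. c *\<^sub>C T j) \<in> seqs B"
  using seqs_mult[OF seqs_const[of "\<lambda>_. c *\<^sub>C 1"] assms]
  by (simp add: convergent_const inc_scaleC inc_one mult_scaleC_left)

lemma seqs_diff:
  assumes "T \<in> seqs B" "U \<in> seqs B" shows "(\<lambda>j. T j - U j) \<in> seqs B"
  using seqs_add[OF assms(1) seqs_scaleC[OF assms(2), of "-1"]] by (simp add: scaleC_minus_one)

lemma seqs_prod_list:
  "(\<And>T. T \<in> set Ts \<Longrightarrow> f T \<in> seqs B) \<Longrightarrow> (\<lambda>j. prod_list (map (\<lambda>T. f T j) Ts)) \<in> seqs B"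
proof (induction Ts)
  case Nil
  show ?case using seqs_const[of "\<lambda>_. 1" B] by (simp add: convergent_const inc_one)
next
  case (Cons T Ts)
  then show ?case by (simp add: seqs_mult)
qed

lemma seqs_free_eval:
  assumes "\<And>i. (\<lambda>j. Z j i) \<in> seqs B" shows "(\<lambda>j. free_eval \<iota> (Z j) p) \<in> seqs B"
proof -
  note homs = free_eval(1)[OF inc_alg_hom, of "Z j" for j, unfolded unital_alg_hom_def]
  show ?thesis
    by (induction p rule: free_alg_induct)
      (simp_all add: homs free_eval(2,3)[OF inc_alg_hom] seqs_const convergent_const assms
        seqs_add seqs_mult seqs_scaleC)
qed

text \<open>Convergence for every convergent sequence of coefficients implies continuity in them:
  interleave the coefficient sequence with \<open>0\<close>.\<close>

lemma seqs_null:
  assumes B: "block_system B" and U: "U \<in> seqs B" and V: "V \<in> seqs B" and e: "e \<longlonglongrightarrow> 0"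
  shows "(\<lambda>j. E (U j * \<iota> (e j) * V j)) \<longlonglongrightarrow> 0"
proof -
  define f where "f = (\<lambda>j. E (U j * \<iota> (e j) * V j))"
  have conv: "convergent (\<lambda>j. E (U j * \<iota> (d j) * V j))" if "d \<longlonglongrightarrow> 0" for d
  proof -
    have "convergent d" using that unfolding convergent_def by blast
    then show ?thesis by (intro seqs_convergent[OF B] seqs_mult U V seqs_const)
  qed
  obtain l where l: "f \<longlonglongrightarrow> l" using conv[OF e] unfolding f_def convergent_def by blast
  have "convergent (\<lambda>j. E (U j * \<iota> (if even j then e j else 0) * V j))"
    by (rule conv) (rule interleave_tendsto[OF e tendsto_const])
  moreover have "E (U j * \<iota> (if even j then e j else 0) * V j) = (if even j then f j else 0)" for j
    by (simp add: f_def inc_zero E_zero)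
  ultimately have "convergent (\<lambda>j. if even j then f j else 0)" by simp
  then have "l = 0" by (rule interleave_limits[OF l tendsto_const])
  then show ?thesis using l unfolding f_def by simp
qed

text \<open>In the limit expectations merely tend to 0, whereas freeness wants them to be 0. The
  factors are recentred one by one; each error carries a null coefficient sequence between two
  members of \<open>seqs B\<close>, and \<open>seqs_null\<close> disposes of it.\<close>

lemma seqs_centre:
  assumes B: "block_system B" and Ts: "\<And>T. T \<in> set Ts \<Longrightarrow> T \<in> seqs B \<and> (\<lambda>j. E (T j)) \<longlonglongrightarrow> 0"
    and U: "U \<in> seqs B"
  shows "(\<lambda>j. E (U j * prod_list (map (\<lambda>T. T j) Ts)) -
    E (U j * prod_list (map (\<lambda>T. T j - \<iota> (E (T j))) Ts))) \<longlonglongrightarrow> 0"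
  using Ts U
proof (induction Ts arbitrary: U)
  case Nil
  then show ?case by simp
next
  case (Cons T Ts)
  define P where "P j = prod_list (map (\<lambda>T. T j) Ts)" for j
  define Q where "Q j = prod_list (map (\<lambda>T. T j - \<iota> (E (T j))) Ts)" for j
  have c: "(\<lambda>j. T j - \<iota> (E (T j))) \<in> seqs B" if "T \<in> set Ts" for T
    using Cons.prems(1)[of T] that by (intro seqs_diff seqs_const) (auto simp: convergent_def)
  have Q: "Q \<in> seqs B" unfolding Q_def using c by (rule seqs_prod_list)
  have "(\<lambda>j. E ((U j * T j) * P j) - E ((U j * T j) * Q j)) \<longlonglongrightarrow> 0"
    unfolding P_def Q_def by (rule Cons.IH) (use Cons.prems seqs_mult in auto)
  moreover have "(\<lambda>j. E (U j * \<iota> (E (T j)) * Q j)) \<longlonglongrightarrow> 0"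
    using Cons.prems by (intro seqs_null[OF B _ Q]) auto
  ultimately have "(\<lambda>j. (E ((U j * T j) * P j) - E ((U j * T j) * Q j)) + E (U j * \<iota> (E (T j)) * Q j)) \<longlonglongrightarrow> 0"
    by (rule tendsto_add_zero)
  moreover have "E (U j * (T j * P j)) - E (U j * ((T j - \<iota> (E (T j))) * Q j)) =
      (E ((U j * T j) * P j) - E ((U j * T j) * Q j)) + E (U j * \<iota> (E (T j)) * Q j)" for j
    by (simp add: algebra_simps flip: E_diff E_add)
  ultimately show ?case by (simp add: P_def[symmetric] Q_def[symmetric])
qed

lemma block_system_single:
  assumes "\<And>j. H j \<subseteq> {1..k j}" "(\<lambda>j. real (card (H j)) / real (k j)) \<longlonglongrightarrow> a"
  shows "block_system {H}"
  using assms unfolding block_system_def convergent_def by auto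

text \<open>A block may depend on the row in any way, so switching between \<open>H\<close> and
  \<open>H'\<close> by the parity of the row gives a single block of proportion \<open>a\<close>. It
  forms a system of its own even if \<open>H\<close> and \<open>H'\<close> overlap.\<close>

lemma block_limits_eq:
  assumes H: "\<And>j. H j \<subseteq> {1..k j}" "(\<lambda>j. real (card (H j)) / real (k j)) \<longlonglongrightarrow> a"
    and H': "\<And>j. H' j \<subseteq> {1..k j}" "(\<lambda>j. real (card (H' j)) / real (k j)) \<longlonglongrightarrow> a"
    and lim: "(\<lambda>j. E (free_eval \<iota> (\<lambda>_. \<Sum>l\<in>H j. X j l) p)) \<longlonglongrightarrow> x"
      "(\<lambda>j. E (free_eval \<iota> (\<lambda>_. \<Sum>l\<in>H' j. X j l) p)) \<longlonglongrightarrow> y"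
  shows "x = y"
proof (rule interleave_limits[OF lim])
  let ?G = "\<lambda>j. if even j then H j else H' j"
  have "(\<lambda>j. real (card (?G j)) / real (k j)) = (\<lambda>j. if even j then real (card (H j)) / real (k j)
      else real (card (H' j)) / real (k j))" by auto
  then have "(\<lambda>j. real (card (?G j)) / real (k j)) \<longlonglongrightarrow> a"
    using interleave_tendsto[OF H(2) H'(2)] by simp
  then have "block_system {?G}"
    using H(1) H'(1) by (intro block_system_single[of _ a]) auto
  then have "convergent (\<lambda>j. E (free_eval \<iota> (\<lambda>_. \<Sum>l\<in>?G j. X j l) p))"
    by (intro seqs_convergent seqs_free_eval seqs_block) auto
  moreover have "(\<lambda>j. E (free_eval \<iota> (\<lambda>_. \<Sum>l\<in>?G j. X j l) p)) =
      (\<lambda>j. if even j then E (free_eval \<iota> (\<lambda>_. \<Sum>l\<in>H j. X j l) p)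
        else E (free_eval \<iota> (\<lambda>_. \<Sum>l\<in>H' j. X j l) p))"
    by auto
  ultimately show "convergent (\<lambda>j. if even j then E (free_eval \<iota> (\<lambda>_. \<Sum>l\<in>H j. X j l) p)
        else E (free_eval \<iota> (\<lambda>_. \<Sum>l\<in>H' j. X j l) p))" by simp
qed

end

section \<open>The \<open>n\<close> blocks and their limiting joint distribution\<close>

locale array_blocks = array_moments \<iota> E k X \<mu>
  for \<iota> :: "'b::cstar_algebra \<Rightarrow> 'a::cstar_algebra" and E k X \<mu> +
  fixes n :: nat
  assumes n: "1 \<le> n" and sa: "\<And>j l. 1 \<le> l \<Longrightarrow> l \<le> k j \<Longrightarrow> selfadjoint (X j l)"
begin

definition q :: "nat \<Rightarrow> nat" where "q j = k j div n"

definition H :: "nat \<Rightarrow> block" where "H d j = {(d - 1) * q j<..d * q j}"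

definition B :: "block set" where "B = H ` {1..n}"

text \<open>Extended by 0 because the algebra of the realization has a variable for every natural
  number.\<close>

definition Y :: "nat \<Rightarrow> nat \<Rightarrow> 'a" where "Y j d = (if d \<in> {1..n} then \<Sum>l\<in>H d j. X j l else 0)"

text \<open>The limit is taken of functionals on the free algebra itself, so no algebra of limiting
  operators has to be built.\<close>

definition \<Phi> :: "('b, nat) free_alg \<Rightarrow> 'b" where
  "\<Phi> p = lim (\<lambda>j. E (free_eval \<iota> (Y j) p))"

lemma q_le: "d \<le> n \<Longrightarrow> d * q j \<le> k j"
  unfolding q_def by (metis div_times_less_eq_dividend le_trans mult.commute mult_le_mono1)

text \<open>The remainder of the division by \<open>n\<close> is below \<open>n\<close>, so the
  error is at most \<open>1 / k j\<close>.\<close>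

lemma q_ratio: "(\<lambda>j. real (q j) / real (k j)) \<longlonglongrightarrow> 1 / real n"
proof -
  have "(\<lambda>j. 1 / real n - real (q j) / real (k j)) \<longlonglongrightarrow> 0"
  proof (rule Lim_null_comparison[OF _ inverse_k])
    show "\<forall>\<^sub>F j in sequentially. norm (1 / real n - real (q j) / real (k j)) \<le> inverse (real (k j))"
      using k_pos
    proof eventually_elim
      case (elim j)
      have "k j = q j * n + k j mod n" unfolding q_def by simp
      then have "real (k j) = real (q j) * real n + real (k j mod n)"
        by (metis of_nat_add of_nat_mult)
      moreover have "real (k j mod n) \<le> real n" using n by (simp add: less_imp_le)
      ultimately have x: "0 \<le> real (k j) - real (q j) * real n" "real (k j) - real (q j) * real n \<le> real n"
        by auto
      have "1 / real n - real (q j) / real (k j) =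
          (real (k j) - real (q j) * real n) / (real n * real (k j))"
        using n elim by (simp add: field_simps)
      then have "norm (1 / real n - real (q j) / real (k j)) =
          (real (k j) - real (q j) * real n) / (real n * real (k j))"
        using x by simp
      also have "\<dots> \<le> real n / (real n * real (k j))" using x by (intro divide_right_mono) auto
      also have "\<dots> = inverse (real (k j))" using n by (simp add: divide_inverse)
      finally show ?case .
    qed
  qed
  then have "(\<lambda>j. 1 / real n - (1 / real n - real (q j) / real (k j))) \<longlonglongrightarrow> 1 / real n - 0"
    by (intro tendsto_diff tendsto_const)
  then show ?thesis by simp
qed

lemma H_subset: "d \<in> {1..n} \<Longrightarrow> H d j \<subseteq> {1..k j}"
  unfolding H_def using q_le[of d j] by auto

lemma card_H: "d \<in> {1..n} \<Longrightarrow> card (H d j) = q j"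
  unfolding H_def by (cases d) auto

lemma H_ratio: "d \<in> {1..n} \<Longrightarrow> (\<lambda>j. real (card (H d j)) / real (k j)) \<longlonglongrightarrow> 1 / real n"
  by (simp only: card_H q_ratio)

lemma H_disjoint:
  assumes "d \<in> {1..n}" "d' \<in> {1..n}" "d \<noteq> d'" shows "H d j \<inter> H d' j = {}"
proof -
  have *: "H d j \<inter> H d' j = {}" if "d < d'" for d d'
  proof -
    have "d * q j \<le> (d' - 1) * q j" using that by (intro mult_le_mono1) simp
    then show ?thesis unfolding H_def by auto
  qed
  show ?thesis using *[of d d'] *[of d' d] assms(3) by (cases "d < d'") auto
qed

lemma block_system_B: "block_system B"
  unfolding block_system_def B_def
  using H_subset H_ratio H_disjoint by (auto simp: convergent_def) blast+

lemma sum_Y: "(\<Sum>d\<in>{1..n}. Y j d) = (\<Sum>l\<in>{1..n * q j}. X j l)"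
proof -
  have "(\<Sum>d\<in>{1..m}. \<Sum>l\<in>H d j. X j l) = (\<Sum>l\<in>{1..m * q j}. X j l)" for m
  proof (induction m)
    case (Suc m)
    have "{1..Suc m * q j} = {1..m * q j} \<union> H (Suc m) j" by (auto simp: H_def)
    moreover have "{1..m * q j} \<inter> H (Suc m) j = {}" by (auto simp: H_def)
    ultimately have "(\<Sum>l\<in>{1..Suc m * q j}. X j l) = (\<Sum>l\<in>{1..m * q j}. X j l) + (\<Sum>l\<in>H (Suc m) j. X j l)"
      by (simp add: sum.union_disjoint H_def)
    then show ?case using Suc by simp
  qed simp
  from this[of n] show ?thesis by (simp add: Y_def)
qed

lemma Y_seqs: "(\<lambda>j. Y j d) \<in> seqs B"
proof (cases "d \<in> {1..n}")
  case True
  then have "(\<lambda>j. \<Sum>l\<in>H d j. X j l) \<in> seqs B" unfolding B_def by (intro seqs_block imageI)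
  then show ?thesis using True by (simp only: Y_def if_True)
next
  case False
  then show ?thesis by (simp only: Y_def if_False seqs.zero)
qed

lemma star_Y: "star (Y j d) = Y j d"
proof -
  have *: "star (\<Sum>l\<in>A. X j l) = (\<Sum>l\<in>A. X j l)" if "finite A" "A \<subseteq> {1..k j}" for A
    using that by (induction A) (auto simp: star_zero star_add sa[unfolded selfadjoint_def])
  have "finite (H d j)" by (simp add: H_def)
  then show ?thesis
    unfolding Y_def using H_subset[of d j] by (simp add: star_zero * del: One_nat_def)
qed

lemma \<Phi>_tendsto: "(\<lambda>j. E (free_eval \<iota> (Y j) p)) \<longlonglongrightarrow> \<Phi> p"
  unfolding \<Phi>_def
  using seqs_convergent[OF block_system_B seqs_free_eval[OF Y_seqs]] by (simp add: convergent_LIMSEQ_iff)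

lemma \<Phi>_eqI: "(\<lambda>j. E (free_eval \<iota> (Y j) p)) \<longlonglongrightarrow> x \<Longrightarrow> \<Phi> p = x"
  using \<Phi>_tendsto LIMSEQ_unique by blast

text \<open>The algebraic identities hold in every row and pass to the limit. Positivity passes by
  \<open>cstar_positive_closed\<close>, since evaluation at the selfadjoint block sums respects
  \<open>star\<close>.\<close>

lemma pos_cond_exp_\<Phi>: "pos_cond_exp free_const \<Phi>"
proof -
  note ev = free_eval(1)[OF inc_alg_hom, of "Y j" for j, unfolded unital_alg_hom_def]
    free_eval(2)[OF inc_alg_hom, of "Y j" for j]
  show ?thesis
    unfolding pos_cond_exp_def
  proof (intro conjI allI)
    show "\<Phi> 1 = 1" by (rule \<Phi>_eqI) (simp add: ev E_one)
    show "\<Phi> (x + y) = \<Phi> x + \<Phi> y" for x y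
      by (rule \<Phi>_eqI) (simp add: ev E_add tendsto_add \<Phi>_tendsto)
    show "\<Phi> (c *\<^sub>C x) = c *\<^sub>C \<Phi> x" for c x
      by (rule \<Phi>_eqI) (simp add: ev E_scaleC tendsto_scaleC \<Phi>_tendsto)
    show "\<Phi> (free_const b * x * free_const b') = b * \<Phi> x * b'" for b x b'
      by (rule \<Phi>_eqI) (simp add: ev E_bimod tendsto_mult \<Phi>_tendsto)
    show "cstar_positive (\<Phi> (star x * x))" for x
      by (rule cstar_positive_closed[OF _ \<Phi>_tendsto]) (simp add: ev free_eval_star[OF hom star_Y] E_pos)
  qed
qed

lemma free_Y: "free_over \<iota> E {1..n} (Y j)"
proof -
  \<comment> \<open>The array is free as one family indexed by pairs, so the blocks of row
    \<open>j\<close> are embedded as sets of pairs.\<close>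
  have "free_over \<iota> E {1..n} (\<lambda>d. \<Sum>i\<in>Pair j ` H d j. case i of (j, l) \<Rightarrow> X j l)"
  proof (rule free_over_sums[OF free])
    show "finite (Pair j ` H d j) \<and> Pair j ` H d j \<subseteq> {(j, l). 1 \<le> l \<and> l \<le> k j}" if "d \<in> {1..n}" for d
      using H_subset[OF that, of j] by (auto simp: H_def)
    show "Pair j ` H d j \<inter> Pair j ` H d' j = {}" if "d \<in> {1..n}" "d' \<in> {1..n}" "d \<noteq> d'" for d d'
      using H_disjoint[OF that, of j] by auto
    show "selfadjoint (case i of (j, l) \<Rightarrow> X j l)" if "i \<in> {(j, l). 1 \<le> l \<and> l \<le> k j}" for i
      using that sa by auto
  qed
  moreover have "(\<Sum>i\<in>Pair j ` H d j. case i of (j, l) \<Rightarrow> X j l) = (\<Sum>l\<in>H d j. X j l)" for d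
    by (subst sum.reindex) (auto simp: inj_on_def)
  ultimately have "free_over \<iota> E {1..n} (\<lambda>d. \<Sum>l\<in>H d j. X j l)" by simp
  moreover have "centred {1..n} (Y j) as = centred {1..n} (\<lambda>d. \<Sum>l\<in>H d j. X j l) as" for as
    unfolding centred_def Y_def by auto
  ultimately show ?thesis by (intro free_overI) (simp add: free_over_list)
qed

text \<open>A factor centred for \<open>\<Phi>\<close> is only asymptotically centred for
  \<open>E\<close>. The exactly recentred product is annihilated by freeness of the block sums, and
  by \<open>seqs_centre\<close> the two expectations differ by a null sequence.\<close>

lemma free_\<Phi>: "free_over free_const \<Phi> {1..n} free_var"
proof -
  interpret phi: cond_exp free_const \<Phi>
    using pos_cond_exp_\<Phi> unital_star_hom_free_const by (simp add: cond_exp_def)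
  show ?thesis
  proof (rule phi.free_overI)
    fix as assume as: "phi.centred {1..n} free_var as"
    note ev = free_eval(1)[OF inc_alg_hom, of "Y j" for j]
    define Ts where "Ts = map (\<lambda>(i, a) j. free_eval \<iota> (Y j) a) as"
    have Ts: "T \<in> seqs B \<and> (\<lambda>j. E (T j)) \<longlonglongrightarrow> 0" if "T \<in> set Ts" for T
    proof -
      obtain i a where T: "T = (\<lambda>j. free_eval \<iota> (Y j) a)" "(i, a) \<in> set as"
        using \<open>T \<in> set Ts\<close> unfolding Ts_def by auto
      then have "\<Phi> a = 0" using as unfolding phi.centred_def by auto
      then show ?thesis using T \<Phi>_tendsto[of a] seqs_free_eval[OF Y_seqs] by simp
    qed
    have zero: "E (prod_list (map (\<lambda>T. T j - \<iota> (E (T j))) Ts)) = 0" for j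
    proof -
      define cs where "cs = map (\<lambda>(i, a). (i, free_eval \<iota> (Y j) a - \<iota> (E (free_eval \<iota> (Y j) a)))) as"
      have hom_ev: "unital_star_hom (free_eval \<iota> (Y j))"
        unfolding unital_star_hom_def by (intro conjI allI ev free_eval_star hom star_Y)
      have fst_cs: "map fst cs = map fst as" unfolding cs_def by (simp add: case_prod_unfold)
      have "centred {1..n} (Y j) cs"
        unfolding centred_def
      proof (intro conjI ballI)
        show "cs \<noteq> []" using as by (simp add: cs_def phi.centred_def)
        show "distinct_adj (map fst cs)" unfolding fst_cs using as by (simp add: phi.centred_def)
        fix x assume "x \<in> set cs"
        then obtain i a where x: "x = (i, free_eval \<iota> (Y j) a - \<iota> (E (free_eval \<iota> (Y j) a)))"
          and ia: "(i, a) \<in> set as"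
          unfolding cs_def by auto
        have "i \<in> {1..n}" "a \<in> gen_star_alg free_const (free_var i)"
          using as ia unfolding phi.centred_def by auto
        moreover from gen_star_alg_image[OF hom_ev this(2)]
        have "free_eval \<iota> (Y j) a \<in> gen_star_alg \<iota> (Y j i)"
          by (simp add: free_eval(2,3)[OF inc_alg_hom])
        ultimately show "case x of (i, a) \<Rightarrow> i \<in> {1..n} \<and> a \<in> gen_star_alg \<iota> (Y j i) \<and> E a = 0"
          unfolding x by (auto simp: E_diff E_inc intro!: gen_star_alg_diff gen_star_alg.base)
      qed
      from free_over_list[OF free_Y this] show ?thesis
        by (simp add: cs_def Ts_def comp_def case_prod_unfold)
    qed
    have one: "(\<lambda>_. 1) \<in> seqs B" using seqs_const[of "\<lambda>_. 1" B] by (simp add: convergent_const inc_one)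
    have "(\<lambda>j. E (1 * prod_list (map (\<lambda>T. T j) Ts)) -
        E (1 * prod_list (map (\<lambda>T. T j - \<iota> (E (T j))) Ts))) \<longlonglongrightarrow> 0"
      by (rule seqs_centre[OF block_system_B Ts one])
    then have "(\<lambda>j. E (prod_list (map (\<lambda>T. T j) Ts))) \<longlonglongrightarrow> 0" by (simp add: zero)
    moreover have "prod_list (map (\<lambda>T. T j) Ts) = free_eval \<iota> (Y j) (prod_list (map snd as))" for j
      unfolding unital_alg_hom_prod_list[OF ev] by (simp add: Ts_def comp_def case_prod_unfold)
    ultimately show "\<Phi> (prod_list (map snd as)) = 0" by (intro \<Phi>_eqI) simp
  qed
qed

lemma \<Phi>_distr:
  "(\<lambda>j. E (free_eval \<iota> (\<lambda>_. free_eval \<iota> (Y j) s) p)) \<longlonglongrightarrow> distr_of free_const \<Phi> s p"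
  using \<Phi>_tendsto[of "free_eval free_const (\<lambda>_. s) p"]
  by (simp add: distr_of_def free_eval_free_eval[OF inc_alg_hom])

text \<open>All blocks have proportion \<open>1 / n\<close>, so \<open>block_limits_eq\<close>
  identifies their limits.\<close>

lemma distr_var:
  assumes i: "i \<in> {1..n}"
  shows "distr_of free_const \<Phi> (free_var i) = distr_of free_const \<Phi> (free_var 1)"
proof
  fix p
  have 1: "(1 :: nat) \<in> {1..n}" using n by simp
  have lim: "(\<lambda>j. E (free_eval \<iota> (\<lambda>_. \<Sum>l\<in>H d j. X j l) p)) \<longlonglongrightarrow> distr_of free_const \<Phi> (free_var d) p"
    if "d \<in> {1..n}" for d
    using \<Phi>_distr[of "free_var d" p] that by (simp add: free_eval(3)[OF inc_alg_hom] Y_def)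
  show "distr_of free_const \<Phi> (free_var i) p = distr_of free_const \<Phi> (free_var 1) p"
    by (rule block_limits_eq[OF H_subset[OF i] H_ratio[OF i] H_subset[OF 1] H_ratio[OF 1] lim[OF i] lim[OF 1]])
qed

text \<open>The block sums add up to the sum over one larger block, whose proportion tends to 1 like
  that of the whole row. Comparing proportions thus accounts for the omitted elements without any
  estimate of their size.\<close>

lemma distr_sum: "distr_of free_const \<Phi> (\<Sum>i\<in>{1..n}. free_var i) = \<mu>"
proof
  fix p
  note ev = free_eval(1)[OF inc_alg_hom, of "Y j" for j]
  have "free_eval \<iota> (Y j) (\<Sum>i\<in>A. free_var i) = (\<Sum>i\<in>A. Y j i)" if "finite A" for A j
    using that ev[of j] by (induction A)
      (auto simp: unital_alg_hom_zero unital_alg_hom_def free_eval(3)[OF inc_alg_hom])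
  then have 1: "(\<lambda>j. E (free_eval \<iota> (\<lambda>_. \<Sum>l\<in>{1..n * q j}. X j l) p))
      \<longlonglongrightarrow> distr_of free_const \<Phi> (\<Sum>i\<in>{1..n}. free_var i) p"
    using \<Phi>_distr[of "\<Sum>i\<in>{1..n}. free_var i" p] by (simp add: sum_Y del: One_nat_def)
  have 2: "(\<lambda>j. E (free_eval \<iota> (\<lambda>_. \<Sum>l\<in>{1..k j}. X j l) p)) \<longlonglongrightarrow> \<mu> p"
    using S_tendsto[of p] by (simp add: S_def)
  have "(\<lambda>j. real n * (real (q j) / real (k j))) \<longlonglongrightarrow> real n * (1 / real n)"
    by (intro tendsto_mult tendsto_const q_ratio)
  then have 3: "(\<lambda>j. real (card {1..n * q j}) / real (k j)) \<longlonglongrightarrow> 1"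
    using n by simp
  have 4: "(\<lambda>j. real (card {1..k j}) / real (k j)) \<longlonglongrightarrow> 1"
    by (rule tendsto_eventually) (use k_pos in eventually_elim, simp)
  show "distr_of free_const \<Phi> (\<Sum>i\<in>{1..n}. free_var i) p = \<mu> p"
    by (rule block_limits_eq[OF _ 3 _ 4 1 2]) (use q_le[of n] in auto)
qed

lemma free_convolution_root: "\<exists>\<nu>\<in>distributions. is_free_convolution n (\<lambda>_. \<nu>) \<mu>"
proof -
  interpret phi: cond_exp free_const \<Phi>
    using pos_cond_exp_\<Phi> unital_star_hom_free_const by (simp add: cond_exp_def)
  show ?thesis
    unfolding is_free_convolution_def
    using pos_cond_exp_\<Phi> free_\<Phi> distr_var distr_sum phi.distr_of_distributions[OF star_free_var, of 1]
    by blast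
qed

end

theorem theorem3p2:
  fixes \<iota> :: "'b::cstar_algebra \<Rightarrow> 'a::cstar_algebra"
    and E :: "'a \<Rightarrow> 'b"
    and k :: "nat \<Rightarrow> nat"
    and X :: "nat \<Rightarrow> nat \<Rightarrow> 'a"
    and M :: real
    and \<mu> :: "'b poly1 \<Rightarrow> 'b"
  assumes "cstar_inclusion \<iota>"
    and "pos_cond_exp \<iota> E"
    and "filterlim k at_top sequentially"
    and "\<And>j l. 1 \<le> l \<Longrightarrow> l \<le> k j \<Longrightarrow> selfadjoint (X j l)"
    and "free_over \<iota> E {(j, l). 1 \<le> l \<and> l \<le> k j} (\<lambda>(j, l). X j l)"
    and "\<And>j l m. 1 \<le> l \<Longrightarrow> l \<le> k j \<Longrightarrow> 1 \<le> m \<Longrightarrow> m \<le> k j \<Longrightarrow>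
           distr_of \<iota> E (X j l) = distr_of \<iota> E (X j m)"
    and "0 \<le> M"
    and "limsup (\<lambda>j. ereal (norm (\<Sum>l\<in>{1..k j}. X j l))) \<le> ereal M"
    and "\<mu> \<in> distributions"
    and "norm_converges_in_moments (\<lambda>j. distr_of \<iota> E (\<Sum>l\<in>{1..k j}. X j l)) \<mu>"
  shows "freely_infinitely_divisible \<mu>"
  unfolding freely_infinitely_divisible_def
proof (intro conjI allI impI)
  show "\<mu> \<in> distributions" by (rule assms)
  fix n :: nat assume n: "1 \<le> n"
  have \<iota>: "unital_star_hom \<iota>" "\<And>b. norm (\<iota> b) = norm b"
    using assms(1) unfolding cstar_inclusion_def by auto
  interpret array_blocks \<iota> E k X \<mu> n
    by unfold_locales (fact \<iota> assms n)+
  show "\<exists>\<nu>\<in>distributions. is_free_convolution n (\<lambda>_. \<nu>) \<mu>" by (rule free_convolution_root)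
qed

end
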